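(* Let $s\in(0,1)$, $\alpha=1-2s$, $f\in\mathbb H^{-s}(\Omega)$, $\mathcal Y>0$, let $\mathcal G^M$ be an arbitrary mesh on $[0,\mathcal Y]$ with polynomial degree distribution $\boldsymbol r\in\mathbb N^M$, and let $\mathcal T$ be a mesh on $\Omega$ with finite element space $S^q_0(\Omega,\mathcal T)\subset H^1_0(\Omega)$. Let $(\mu_i,v_i)_{i=1}^{\mathcal M}$, $\mathcal M=\dim S^{\boldsymbol r}_{\{\mathcal Y\}}((0,\mathcal Y),\mathcal G^M)$, be eigenpairs such that $(v_i)_i$ is a basis of $S^{\boldsymbol r}_{\{\mathcal Y\}}((0,\mathcal Y),\mathcal G^M)$ with $$\int_0^{\mathcal Y}y^\alpha v_i'v_j'\,dy=\delta_{i,j},\qquad\int_0^{\mathcal Y}y^\alpha v_iv_j\,dy=\mu_i\delta_{i,j}.$$ For each $i$ let $U_i\in H^1_0(\Omega)$ be the solution of $$a_{\mu_i,\Omega}(U_i,V)=d_sv_i(0)\langle f,V\rangle\quad\forall V\in H^1_0(\Omega),$$ and let $\Pi_i:H^1_0(\Omega)\to S^q_0(\Omega,\mathcal T)$ be the Ritz projector defined by $a_{\mu_i,\Omega}(w-\Pi_iw,v)=0$ for all $v\in S^q_0(\Omega,\mathcal T)$. Let $\mathcal U_M$ be the solution of the semidiscrete problem in $H^1_0(\Omega)\otimes S^{\boldsymbol r}_{\{\mathcal Y\}}((0,\mathcal Y),\mathcal G^M)$. Then the Galerkin approximation $\mathcal U_{h,M}\in S^q_0(\Omega,\mathcal T)\otimes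 S^{\boldsymbol r}_{\{\mathcal Y\}}((0,\mathcal Y),\mathcal G^M)$ of $\mathcal U$ satisfies $$\mathcal U_{h,M}(x',y)=\sum_{i=1}^{\mathcal M}\Pi_iU_i(x')\,v_i(y),$$ $$a_{\mathcal C}(\mathcal U_M-\mathcal U_{h,M},\mathcal U_M-\mathcal U_{h,M})=\sum_{i=1}^{\mathcal M}\|U_i-\Pi_iU_i\|^2_{\mu_i,\Omega}.$$
   Context: $\Omega\subset\mathbb R^d$ ($d=1,2$) is a bounded Lipschitz domain, $A\in L^\infty(\Omega,GL(\mathbb R^d))$ symmetric uniformly positive definite, $0\le c\in L^\infty(\Omega)$. $\mathcal Lw=-\operatorname{div}(A\nabla w)+cw$ with homogeneous Dirichlet conditions has eigenpairs $(\lambda_k,\varphi_k)$, $\varphi_k$ orthonormal in $L^2(\Omega)$; $\mathbb H^r(\Omega)$: series $w=\sum_kw_k\varphi_k$ with $\sum_k\lambda_k^rw_k^2<\infty$; $\langle\cdot,\cdot\rangle$ is the duality pairing of $\mathbb H^{-s}$ with $\mathbb H^s$. $d_s=2^{1-2s}\Gamma(1-s)/\Gamma(s)$. $a_\Omega(w,v)=\int_\Omega(A\nabla w\cdot\nabla v+cwv)\,dx'$; $a_{\mu,\Omega}(U,V)=\mu\,a_\Omega(U,V)+\int_\Omega UV\,dx'$; $\|V\|_{\mu,\Omega}^2=a_{\mu,\Omega}(V,V)$. $\mathcal C=\Omega\times(0,\infty)$; $\mathring H^1_L(y^\alpha,\mathcal C)$: functions $w$ with $w,\nabla w\in L^2(\mathcal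 C;y^\alpha dx'dy)$ and $w=0$ on $\partial\Omega\times(0,\infty)$; $\operatorname{tr}$: trace on $\Omega\times\{0\}$; $a_{\mathcal C}(v,w)=\int_{\mathcal C}y^\alpha(A\nabla_{x'}v\cdot\nabla_{x'}w+\partial_yv\,\partial_yw+cvw)\,dx'dy$. $\mathcal U\in\mathring H^1_L(y^\alpha,\mathcal C)$ solves $a_{\mathcal C}(\mathcal U,v)=d_s\langle f,\operatorname{tr}v\rangle$ for all $v\in\mathring H^1_L(y^\alpha,\mathcal C)$. $S^{\boldsymbol r}_{\{\mathcal Y\}}((0,\mathcal Y),\mathcal G^M)$: continuous functions on $[0,\mathcal Y]$ that are polynomials of degree $\le r_m$ on the $m$-th interval of $\mathcal G^M$ and vanish at $\mathcal Y$. $S^q_0(\Omega,\mathcal T)$: continuous functions on $\overline\Omega$, piecewise polynomial of degree $q$ on the simplicial mesh $\mathcal T$, vanishing on $\partial\Omega$. Functions on $\Omega\times(0,\mathcal Y)$ in the tensor product spaces are extended by zero to $\mathcal C$. The semidiscrete solution $\mathcal U_M\in H^1_0(\Omega)\otimes S^{\boldsymbol r}_{\{\mathcal Y\}}$ and the Galerkin approximation $\mathcal U_{h,M}\in S^q_0(\Omega,\mathcal T)\otimes S^{\boldsymbol r}_{\{\mathcal Y\}}$ are the unique elements of the respective spaces with $a_{\mathcal C}(\cdot,\phi)=d_s\langle f,\operatorname{tr}\phi\rangle$ for all $\phi$ in the respective space. *)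

theory Defs
  imports "HOL-Analysis.Analysis" "HOL-Library.Function_Algebras"
begin

section \<open>Vector spaces of real functions\<close>

definition fun_scale :: "real \<Rightarrow> ('a \<Rightarrow> real) \<Rightarrow> 'a \<Rightarrow> real" where
  "fun_scale c f = (\<lambda>x. c * f x)"

global_interpretation fun_vs: vector_space "fun_scale :: real \<Rightarrow> ('a \<Rightarrow> real) \<Rightarrow> 'a \<Rightarrow> real"
  by unfold_locales (auto simp: fun_scale_def algebra_simps)

definition basis_family :: "nat \<Rightarrow> (nat \<Rightarrow> 'a \<Rightarrow> real) \<Rightarrow> ('a \<Rightarrow> real) set \<Rightarrow> bool" where
  "basis_family N v V \<longleftrightarrow>
     inj_on v {1..N} \<and> \<not> fun_vs.dependent (v ` {1..N}) \<and> fun_vs.span (v ` {1..N}) = V"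

text \<open>The algebraic tensor product, realised as functions of two variables.\<close>

definition tensor_space :: "('a \<Rightarrow> real) set \<Rightarrow> ('b \<Rightarrow> real) set \<Rightarrow> ('a \<times> 'b \<Rightarrow> real) set" where
  "tensor_space X S = fun_vs.span {\<lambda>z. u (fst z) * v (snd z) | u v. u \<in> X \<and> v \<in> S}"


section \<open>Sobolev spaces\<close>

text \<open>
  Elements of Lebesgue and Sobolev spaces on a set \<open>D\<close> are represented by functions on the
  ambient space, whose values outside \<open>D\<close> are irrelevant. Only Borel measurable representatives
  are used; every class of Lebesgue measurable functions has one.
\<close>

definition L2_space :: "('a::euclidean_space \<Rightarrow> real) \<Rightarrow> 'a set \<Rightarrow> ('a \<Rightarrow> 'b::euclidean_space) set" where
  "L2_space \<rho> D = {u. set_borel_measurable lborel D u \<and>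
                      set_integrable lborel D (\<lambda>x. \<rho> x * (norm (u x))\<^sup>2)}"

definition L2_inner :: "'a::euclidean_space set \<Rightarrow> ('a \<Rightarrow> real) \<Rightarrow> ('a \<Rightarrow> real) \<Rightarrow> real" where
  "L2_inner D u v = (LINT x:D|lborel. u x * v x)"

primrec cont_diff :: "nat \<Rightarrow> ('a::euclidean_space \<Rightarrow> real) \<Rightarrow> bool" where
  "cont_diff 0 f \<longleftrightarrow> continuous_on UNIV f"
| "cont_diff (Suc k) f \<longleftrightarrow>
     (\<forall>x. f differentiable (at x)) \<and>
     (\<forall>b\<in>Basis. cont_diff k (\<lambda>x. frechet_derivative f (at x) b))"

definition test_functions :: "'a::euclidean_space set \<Rightarrow> ('a \<Rightarrow> real) set" where
  "test_functions D = {\<phi>. (\<forall>k. cont_diff k \<phi>) \<and>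
                          (\<exists>K. compact K \<and> K \<subseteq> D \<and> (\<forall>x. x \<notin> K \<longrightarrow> \<phi> x = 0))}"

definition has_weak_gradient ::
  "'a::euclidean_space set \<Rightarrow> ('a \<Rightarrow> real) \<Rightarrow> ('a \<Rightarrow> 'a) \<Rightarrow> bool" where
  "has_weak_gradient D u g \<longleftrightarrow>
     (\<forall>K. compact K \<and> K \<subseteq> D \<longrightarrow> set_integrable lborel K u \<and> set_integrable lborel K g) \<and>
     (\<forall>\<phi>\<in>test_functions D. \<forall>b\<in>Basis.
        (LINT x:D|lborel. u x * frechet_derivative \<phi> (at x) b)
          = - (LINT x:D|lborel. (g x \<bullet> b) * \<phi> x))"

text \<open>Weak gradients on open sets are unique up to null sets, so the choice is immaterial.\<close>

definition weak_grad :: "'a::euclidean_space set \<Rightarrow> ('a \<Rightarrow> real) \<Rightarrow> 'a \<Rightarrow> 'a" where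
  "weak_grad D u = (SOME g. has_weak_gradient D u g)"

definition H1_space :: "('a::euclidean_space \<Rightarrow> real) \<Rightarrow> 'a set \<Rightarrow> ('a \<Rightarrow> real) set" where
  "H1_space \<rho> D = {u \<in> L2_space \<rho> D. \<exists>g. has_weak_gradient D u g \<and> g \<in> L2_space \<rho> D}"

definition H1_norm_sq :: "'a::euclidean_space set \<Rightarrow> ('a \<Rightarrow> real) \<Rightarrow> real" where
  "H1_norm_sq D u = (LINT x:D|lborel. (u x)\<^sup>2 + (norm (weak_grad D u x))\<^sup>2)"

text \<open>The closure of the test functions in \<open>H\<^sup>1(D)\<close>.\<close>

definition H10 :: "'a::euclidean_space set \<Rightarrow> ('a \<Rightarrow> real) set" where
  "H10 D = {u \<in> H1_space (\<lambda>_. 1) D.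
              \<forall>\<epsilon>>0. \<exists>\<phi>\<in>test_functions D. H1_norm_sq D (\<lambda>x. u x - \<phi> x) < \<epsilon>}"


section \<open>Domain, coefficients and spectral spaces\<close>

text \<open>
  Near each boundary point the domain is the epigraph of a Lipschitz function of the variables
  orthogonal to some unit vector \<open>n\<close>; \<open>\<gamma>\<close> is evaluated only on the hyperplane orthogonal to \<open>n\<close>.
\<close>

definition bounded_lipschitz_domain :: "'a::euclidean_space set \<Rightarrow> bool" where
  "bounded_lipschitz_domain \<Omega> \<longleftrightarrow>
     open \<Omega> \<and> connected \<Omega> \<and> \<Omega> \<noteq> {} \<and> bounded \<Omega> \<and>
     (\<forall>p\<in>frontier \<Omega>. \<exists>n \<gamma> L r. norm n = 1 \<and> L-lipschitz_on UNIV (\<gamma> :: 'a \<Rightarrow> real) \<and> 0 < r \<and>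
        (\<forall>x\<in>ball p r. x \<in> \<Omega> \<longleftrightarrow> \<gamma> (x - (x \<bullet> n) *\<^sub>R n) < x \<bullet> n))"

definition admissible_diffusion :: "(real^'d) set \<Rightarrow> (real^'d \<Rightarrow> real^'d^'d) \<Rightarrow> bool" where
  "admissible_diffusion \<Omega> A \<longleftrightarrow>
     set_borel_measurable lborel \<Omega> A \<and>
     (\<exists>C. AE x in lborel. x \<in> \<Omega> \<longrightarrow> norm (A x) \<le> C) \<and>
     (AE x in lborel. x \<in> \<Omega> \<longrightarrow> invertible (A x) \<and> transpose (A x) = A x) \<and>
     (\<exists>a0>0. AE x in lborel. x \<in> \<Omega> \<longrightarrow> (\<forall>\<xi>. a0 * (norm \<xi>)\<^sup>2 \<le> (A x *v \<xi>) \<bullet> \<xi>))"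

definition admissible_reaction :: "(real^'d) set \<Rightarrow> (real^'d \<Rightarrow> real) \<Rightarrow> bool" where
  "admissible_reaction \<Omega> c \<longleftrightarrow>
     set_borel_measurable lborel \<Omega> c \<and>
     (\<exists>C. AE x in lborel. x \<in> \<Omega> \<longrightarrow> \<bar>c x\<bar> \<le> C) \<and>
     (AE x in lborel. x \<in> \<Omega> \<longrightarrow> 0 \<le> c x)"

definition a_Omega ::
  "(real^'d) set \<Rightarrow> (real^'d \<Rightarrow> real^'d^'d) \<Rightarrow> (real^'d \<Rightarrow> real) \<Rightarrow>
   (real^'d \<Rightarrow> real) \<Rightarrow> (real^'d \<Rightarrow> real) \<Rightarrow> real" where
  "a_Omega \<Omega> A c w v =
     (LINT x:\<Omega>|lborel. (A x *v weak_grad \<Omega> w x) \<bullet> weak_grad \<Omega> v x + c x * w x * v x)"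

definition a_mu ::
  "(real^'d) set \<Rightarrow> (real^'d \<Rightarrow> real^'d^'d) \<Rightarrow> (real^'d \<Rightarrow> real) \<Rightarrow> real \<Rightarrow>
   (real^'d \<Rightarrow> real) \<Rightarrow> (real^'d \<Rightarrow> real) \<Rightarrow> real" where
  "a_mu \<Omega> A c \<mu> U V = \<mu> * a_Omega \<Omega> A c U V + L2_inner \<Omega> U V"

definition mu_norm_sq ::
  "(real^'d) set \<Rightarrow> (real^'d \<Rightarrow> real^'d^'d) \<Rightarrow> (real^'d \<Rightarrow> real) \<Rightarrow> real \<Rightarrow>
   (real^'d \<Rightarrow> real) \<Rightarrow> real" where
  "mu_norm_sq \<Omega> A c \<mu> V = a_mu \<Omega> A c \<mu> V V"

text \<open>
  The eigenpairs of the Dirichlet operator in weak form; the last conjunct states that the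
  eigenfunctions are complete in \<open>L\<^sup>2(\<Omega>)\<close>.
\<close>

definition eigensystem ::
  "(real^'d) set \<Rightarrow> (real^'d \<Rightarrow> real^'d^'d) \<Rightarrow> (real^'d \<Rightarrow> real) \<Rightarrow>
   (nat \<Rightarrow> real) \<Rightarrow> (nat \<Rightarrow> real^'d \<Rightarrow> real) \<Rightarrow> bool" where
  "eigensystem \<Omega> A c lam \<phi> \<longleftrightarrow>
     (\<forall>k. 0 < lam k \<and> \<phi> k \<in> H10 \<Omega> \<and>
          (\<forall>v\<in>H10 \<Omega>. a_Omega \<Omega> A c (\<phi> k) v = lam k * L2_inner \<Omega> (\<phi> k) v)) \<and>
     (\<forall>j k. L2_inner \<Omega> (\<phi> j) (\<phi> k) = (if j = k then 1 else 0)) \<and>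
     (\<forall>u\<in>L2_space (\<lambda>_. 1) \<Omega>. (\<forall>k. L2_inner \<Omega> u (\<phi> k) = 0) \<longrightarrow>
        (AE x in lborel. x \<in> \<Omega> \<longrightarrow> u x = 0))"

text \<open>
  An element \<open>\<Sum>k. w k \<phi>\<^sub>k\<close> of the spectral space of order \<open>r\<close> (a formal series if \<open>r < 0\<close>) is
  represented by its coefficient sequence. In the pairing, the second argument is a function in
  \<open>L\<^sup>2(\<Omega>)\<close>, which has the coefficients \<open>L2_inner \<Omega> g (\<phi> k)\<close>.
\<close>

definition spectral_space :: "(nat \<Rightarrow> real) \<Rightarrow> real \<Rightarrow> (nat \<Rightarrow> real) set" where
  "spectral_space lam r = {w. summable (\<lambda>k. lam k powr r * (w k)\<^sup>2)}"

definition dual_pairing ::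
  "(real^'d) set \<Rightarrow> (nat \<Rightarrow> real^'d \<Rightarrow> real) \<Rightarrow> (nat \<Rightarrow> real) \<Rightarrow> (real^'d \<Rightarrow> real) \<Rightarrow> real" where
  "dual_pairing \<Omega> \<phi> f g = (\<Sum>k. f k * L2_inner \<Omega> g (\<phi> k))"


section \<open>The extended problem on the cylinder\<close>

definition d_const :: "real \<Rightarrow> real" where
  "d_const s = 2 powr (1 - 2 * s) * Gamma (1 - s) / Gamma s"

definition cylinder :: "(real^'d) set \<Rightarrow> ((real^'d) \<times> real) set" where
  "cylinder \<Omega> = \<Omega> \<times> {0<..}"

text \<open>The vanishing lateral trace is expressed through almost every horizontal slice.\<close>

definition HL_space :: "(real^'d) set \<Rightarrow> real \<Rightarrow> ((real^'d) \<times> real \<Rightarrow> real) set" where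
  "HL_space \<Omega> \<alpha> = {w \<in> H1_space (\<lambda>z. snd z powr \<alpha>) (cylinder \<Omega>).
                       AE y in lborel. 0 < y \<longrightarrow> (\<lambda>x. w (x, y)) \<in> H10 \<Omega>}"

text \<open>
  The trace on \<open>\<Omega> \<times> {0}\<close> is the \<open>L\<^sup>2(\<Omega>)\<close> limit of \<open>w(\<cdot>,y)\<close> as \<open>y \<rightarrow> 0\<close>, taken in the mean over
  \<open>0 < y < h\<close> to be independent of the representative of \<open>w\<close>; it is unique up to null sets.
\<close>

definition has_trace :: "(real^'d) set \<Rightarrow> ((real^'d) \<times> real \<Rightarrow> real) \<Rightarrow> (real^'d \<Rightarrow> real) \<Rightarrow> bool" where
  "has_trace \<Omega> w g \<longleftrightarrow>
     g \<in> L2_space (\<lambda>_. 1) \<Omega> \<and>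
     (\<forall>\<^sub>F h in at_right 0.
        set_integrable lborel (\<Omega> \<times> {0<..<h}) (\<lambda>z. (w z - g (fst z))\<^sup>2)) \<and>
     ((\<lambda>h. (LINT z:\<Omega> \<times> {0<..<h}|lborel. (w z - g (fst z))\<^sup>2) / h) \<longlongrightarrow> 0) (at_right 0)"

definition tr :: "(real^'d) set \<Rightarrow> ((real^'d) \<times> real \<Rightarrow> real) \<Rightarrow> real^'d \<Rightarrow> real" where
  "tr \<Omega> w = (SOME g. has_trace \<Omega> w g)"

definition a_C ::
  "(real^'d) set \<Rightarrow> (real^'d \<Rightarrow> real^'d^'d) \<Rightarrow> (real^'d \<Rightarrow> real) \<Rightarrow> real \<Rightarrow>
   ((real^'d) \<times> real \<Rightarrow> real) \<Rightarrow> ((real^'d) \<times> real \<Rightarrow> real) \<Rightarrow> real" where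
  "a_C \<Omega> A c \<alpha> v w =
     (LINT z:cylinder \<Omega>|lborel. snd z powr \<alpha> *
        ((A (fst z) *v fst (weak_grad (cylinder \<Omega>) v z)) \<bullet> fst (weak_grad (cylinder \<Omega>) w z)
         + snd (weak_grad (cylinder \<Omega>) v z) * snd (weak_grad (cylinder \<Omega>) w z)
         + c (fst z) * v z * w z))"

text \<open>
  The problem \<open>a\<^sub>C(u, \<psi>) = d\<^sub>s \<langle>f, tr \<psi>\<rangle>\<close> with trial and test space \<open>X\<close>, which is the whole energy
  space, a semidiscrete space or a fully discrete space.
\<close>

definition extension_solution ::
  "(real^'d) set \<Rightarrow> (real^'d \<Rightarrow> real^'d^'d) \<Rightarrow> (real^'d \<Rightarrow> real) \<Rightarrow> (nat \<Rightarrow> real^'d \<Rightarrow> real) \<Rightarrow>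
   real \<Rightarrow> (nat \<Rightarrow> real) \<Rightarrow> ((real^'d) \<times> real \<Rightarrow> real) set \<Rightarrow> ((real^'d) \<times> real \<Rightarrow> real) \<Rightarrow> bool" where
  "extension_solution \<Omega> A c \<phi> s f X u \<longleftrightarrow>
     u \<in> X \<and>
     (\<forall>\<psi>\<in>X. a_C \<Omega> A c (1 - 2 * s) u \<psi> = d_const s * dual_pairing \<Omega> \<phi> f (tr \<Omega> \<psi>))"


section \<open>Discrete spaces\<close>

definition mesh_1d :: "real \<Rightarrow> nat \<Rightarrow> (nat \<Rightarrow> real) \<Rightarrow> bool" where
  "mesh_1d Y M G \<longleftrightarrow> G 0 = 0 \<and> G M = Y \<and> (\<forall>m<M. G m < G (Suc m))"

text \<open>The functions are extended by zero from \<open>[0,Y]\<close> to the real line.\<close>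

definition spline_space ::
  "real \<Rightarrow> nat \<Rightarrow> (nat \<Rightarrow> real) \<Rightarrow> (nat \<Rightarrow> nat) \<Rightarrow> (real \<Rightarrow> real) set" where
  "spline_space Y M G r =
     {v. continuous_on {0..Y} v \<and>
         (\<forall>m\<in>{1..M}. \<exists>p :: real poly. degree p \<le> r m \<and> (\<forall>y\<in>{G (m - 1)..G m}. v y = poly p y)) \<and>
         v Y = 0 \<and> (\<forall>y. y \<notin> {0..Y} \<longrightarrow> v y = 0)}"

definition simplicial_mesh :: "(real^'d) set \<Rightarrow> (real^'d) set set \<Rightarrow> bool" where
  "simplicial_mesh \<Omega> \<T> \<longleftrightarrow>
     triangulation \<T> \<and> (\<forall>K\<in>\<T>. int CARD('d) simplex K) \<and> \<Union>\<T> = closure \<Omega>"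

text \<open>Polynomial functions of total degree at most \<open>q\<close>, written as sums over multi-indices.\<close>

definition polynomial_fun :: "nat \<Rightarrow> (real^'d \<Rightarrow> real) \<Rightarrow> bool" where
  "polynomial_fun q p \<longleftrightarrow>
     (\<exists>a :: ('d \<Rightarrow> nat) \<Rightarrow> real. \<forall>x.
        p x = (\<Sum>\<beta> | (\<Sum>i\<in>UNIV. \<beta> i) \<le> q. a \<beta> * (\<Prod>i\<in>UNIV. (x $ i) ^ \<beta> i)))"

text \<open>
  The functions are extended by zero from \<open>closure \<Omega>\<close> to the whole space; as \<open>\<Omega>\<close> is open, the last
  condition contains the homogeneous boundary condition.
\<close>

definition fe_space :: "(real^'d) set \<Rightarrow> (real^'d) set set \<Rightarrow> nat \<Rightarrow> (real^'d \<Rightarrow> real) set" where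
  "fe_space \<Omega> \<T> q =
     {u. continuous_on (closure \<Omega>) u \<and>
         (\<forall>K\<in>\<T>. \<exists>p. polynomial_fun q p \<and> (\<forall>x\<in>K. u x = p x)) \<and>
         (\<forall>x. x \<notin> \<Omega> \<longrightarrow> u x = 0)}"

definition ritz_projector ::
  "(real^'d) set \<Rightarrow> (real^'d \<Rightarrow> real^'d^'d) \<Rightarrow> (real^'d \<Rightarrow> real) \<Rightarrow> real \<Rightarrow>
   (real^'d \<Rightarrow> real) set \<Rightarrow> ((real^'d \<Rightarrow> real) \<Rightarrow> (real^'d \<Rightarrow> real)) \<Rightarrow> bool" where
  "ritz_projector \<Omega> A c \<mu> S P \<longleftrightarrow>
     (\<forall>w\<in>H10 \<Omega>. P w \<in> S \<and> (\<forall>v\<in>S. a_mu \<Omega> A c \<mu> (\<lambda>x. w x - P w x) v = 0))"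

end

theory Submission
  imports Defs
begin

text \<open>
  Expanding in the basis \<open>v i\<close>, elements of the tensor product spaces are sums
  \<open>\<Sum>i. W i \<otimes> v i\<close>, whose weak gradient is \<open>\<Sum>i. (v i \<nabla>W i, (v i)' W i)\<close>. By Fubini and the two
  orthogonality relations, \<open>a_C\<close> decouples into \<open>\<Sum>i. a_mu (\<mu> i) (W i) (Z i)\<close>. Testing with
  \<open>V \<otimes> v j\<close>, whose trace is \<open>v j 0 * V\<close>, shows that the \<open>j\<close>-th components of the semidiscrete and
  of the Galerkin solution satisfy the equation of \<open>U j\<close> on \<open>H10\<close> and on the finite element space.
  The latter component is therefore the Ritz projection of \<open>U j\<close>, first almost everywhere and then
  everywhere by continuity. Since \<open>weak_grad\<close> is a choice, all this rests on the uniqueness of weak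
  gradients, that is, on the fundamental lemma of the calculus of variations.
\<close>

section \<open>Smooth bump functions\<close>

text \<open>The two factors trade roles in the decoupling: the mass integral of
  \<open>v i * v j\<close> multiplies \<open>a_Omega\<close>, while the stiffness integral of the
  derivatives multiplies the L2 product in x. Normalising the stiffness matrix to the identity
  therefore leaves \<open>\<mu> i * a_Omega + L2_inner\<close>, which is \<open>a_mu\<close>. The
  number \<open>\<mu> i\<close> is a weighted integral of a square, so \<open>a_mu\<close> dominates
  the L2 product, and this is the definiteness that identifies the Galerkin components. Two
  obstacles shape the rest. Gradients and traces are determined only up to null sets, and divergent
  integrals have a default value, so every identity between integrals compares integrands almost
  everywhere and brings its own measurability and integrability claims. The weight may be singular
  or degenerate at y = 0 and the splines have kinks, so the integrals in y are controlled by bounds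
  for \<open>v i\<close> and \<open>deriv (v i)\<close> together with \<alpha> > -1.\<close>

lemma cont_diff_SucI:
  assumes "\<And>x. (f has_derivative f' x) (at x)" "\<And>b. b \<in> Basis \<Longrightarrow> cont_diff k (\<lambda>x. f' x b)"
  shows "cont_diff (Suc k) f"
proof -
  have "frechet_derivative f (at x) = f' x" for x
    using frechet_derivative_at[OF assms(1)] by simp
  then show ?thesis
    using assms by (auto simp: differentiable_def)
qed

lemma cont_diff_SucD:
  "cont_diff (Suc k) f \<Longrightarrow> (f has_derivative frechet_derivative f (at x)) (at x)"
  by (simp add: frechet_derivative_works[symmetric])

lemma cont_diff_imp_continuous: "cont_diff k f \<Longrightarrow> continuous_on UNIV f"
  by (cases k) (auto intro!: continuous_at_imp_continuous_on differentiable_imp_continuous_within)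

lemma cont_diff_Suc_imp: "cont_diff (Suc k) f \<Longrightarrow> cont_diff k f"
proof (induction k arbitrary: f)
  case 0
  then show ?case using cont_diff_imp_continuous[of "Suc 0"] by simp
next
  case (Suc k)
  then show ?case by (metis cont_diff.simps(2))
qed

lemma cont_diff_const: "cont_diff k (\<lambda>x. a)"
  by (induction k arbitrary: a) (auto intro!: cont_diff_SucI derivative_eq_intros simp del: cont_diff.simps(2))

lemma cont_diff_add: "cont_diff k f \<Longrightarrow> cont_diff k g \<Longrightarrow> cont_diff k (\<lambda>x. f x + g x)"
proof (induction k arbitrary: f g)
  case 0
  then show ?case by (auto intro!: continuous_intros)
next
  case (Suc k)
  note d = Suc.prems[THEN cont_diff_SucD]
  show ?case
    by (rule cont_diff_SucI, rule has_derivative_add[OF d(1) d(2)], rule Suc.IH)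
      (use Suc.prems in auto)
qed

lemma cont_diff_mult: "cont_diff k f \<Longrightarrow> cont_diff k g \<Longrightarrow> cont_diff k (\<lambda>x. f x * g x)"
proof (induction k arbitrary: f g)
  case 0
  then show ?case by (auto intro!: continuous_intros)
next
  case (Suc k)
  note d = Suc.prems[THEN cont_diff_SucD]
  show ?case
    \<comment> \<open>The product rule pairs a derivative of order k with an undifferentiated
      factor, which \<open>cont_diff_Suc_imp\<close> lowers to order k.\<close>
    by (rule cont_diff_SucI, rule has_derivative_mult[OF d(1) d(2)], intro cont_diff_add Suc.IH)
      (use Suc.prems in \<open>auto dest: cont_diff_Suc_imp simp del: cont_diff.simps\<close>,
       use Suc.prems in \<open>auto simp: \<close>)
qed

lemma cont_diff_prod:
  "(\<And>i. i \<in> I \<Longrightarrow> cont_diff k (f i)) \<Longrightarrow> cont_diff k (\<lambda>x. \<Prod>i\<in>I. f i x)"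
  by (induction I rule: infinite_finite_induct) (auto intro: cont_diff_const cont_diff_mult)

section \<open>The flat function exp(-1/t) and its derivatives\<close>

text \<open>All derivatives of \<open>exp (- 1 / t)\<close> have this form.\<close>

definition flat :: "real poly \<Rightarrow> real \<Rightarrow> real" where
  "flat p t = (if t \<le> 0 then 0 else poly p (inverse t) * exp (- inverse t))"

lemma tendsto_poly_div_exp: "((\<lambda>x. poly p x / exp x) \<longlongrightarrow> (0::real)) at_top"
proof -
  have "((\<lambda>x. \<Sum>i\<le>degree p. coeff p i * (x ^ i / exp x)) \<longlongrightarrow> (\<Sum>i\<le>degree p. coeff p i * 0)) at_top"
    by (intro tendsto_intros tendsto_power_div_exp_0)
  then show ?thesis
    by (simp add: poly_altdef sum_divide_distrib)
qed

text \<open>Substituting x = 1/t turns the claim into the decay of p(x) / exp x at infinity.\<close>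

lemma flat_tendsto_0: "(flat p \<longlongrightarrow> 0) (at_right 0)"
proof (rule Lim_transform_eventually)
  show "((\<lambda>t. poly p (inverse t) / exp (inverse t)) \<longlongrightarrow> 0) (at_right 0)"
    by (rule filterlim_compose[OF tendsto_poly_div_exp filterlim_inverse_at_top_right])
  show "\<forall>\<^sub>F t in at_right 0. poly p (inverse t) / exp (inverse t) = flat p t"
    by (auto simp: flat_def eventually_at_filter exp_minus divide_inverse)
qed

text \<open>For t > 0 the chain rule gives t^(-2) (p - p')(1/t) exp(-1/t), and
  \<open>monom 1 2\<close> is the factor t^(-2). The family \<open>flat p\<close> is thus closed
  under differentiation, which turns smoothness into an induction over the order.\<close>

lemma flat_has_derivative:
  "(flat p has_real_derivative flat (monom 1 2 * (p - pderiv p)) t) (at t)"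
proof -
  consider "t < 0" | "t > 0" | "t = 0" by linarith
  then show ?thesis
  proof cases
    case 1
    then have "\<forall>\<^sub>F x in nhds t. flat p x = 0"
      by (intro eventually_nhds_in_open[of "{..<0}" t, THEN eventually_mono])
        (auto simp: flat_def)
    then show ?thesis
      using 1 by (subst DERIV_cong_ev[where g="\<lambda>_. 0"]) (auto simp: flat_def)
  next
    case 2
    have "((\<lambda>t. poly p (inverse t) * exp (- inverse t)) has_real_derivative
        flat (monom 1 2 * (p - pderiv p)) t) (at t)"
      using 2 by (auto intro!: derivative_eq_intros DERIV_chain'[OF _ poly_DERIV]
          simp: flat_def poly_monom field_simps power2_eq_square)
    moreover have "\<forall>\<^sub>F x in nhds t. flat p x = poly p (inverse x) * exp (- inverse x)"
      using 2 by (intro eventually_nhds_in_open[of "{0<..}" t, THEN eventually_mono])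
        (auto simp: flat_def)
    ultimately show ?thesis
      by (subst DERIV_cong_ev[OF refl _ refl]) auto
  next
    case 3
    have "((\<lambda>h. (flat p (0 + h) - flat p 0) / h) \<longlongrightarrow> 0) (at 0)"
    proof (rule filterlim_split_at)
      show "((\<lambda>h. (flat p (0 + h) - flat p 0) / h) \<longlongrightarrow> 0) (at_left 0)"
        by (rule Lim_transform_eventually[OF tendsto_const])
          (auto simp: flat_def eventually_at_filter)
      \<comment> \<open>The difference quotient at 0 is again of the form \<open>flat\<close>:
        dividing by h multiplies the polynomial in 1/h by its variable, whence
        \<open>pCons 0 p\<close>.\<close>
      show "((\<lambda>h. (flat p (0 + h) - flat p 0) / h) \<longlongrightarrow> 0) (at_right 0)"
        by (rule Lim_transform_eventually[OF flat_tendsto_0[of "pCons 0 p"]])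
          (auto simp: flat_def eventually_at_filter field_simps)
    qed
    then show ?thesis
      using 3 by (simp add: has_field_derivative_iff flat_def)
  qed
qed

text \<open>An affine argument covers all coordinate factors of a bump function at once; each
  partial derivative only brings a constant factor \<open>b \<bullet> d\<close>.\<close>

lemma cont_diff_flat: "cont_diff k (\<lambda>x. flat p (x \<bullet> d + a))"
proof (induction k arbitrary: p)
  case 0
  have "continuous_on UNIV (flat p)"
    by (intro continuous_at_imp_continuous_on ballI DERIV_isCont[OF flat_has_derivative])
  then show ?case
    unfolding cont_diff.simps by (rule continuous_on_compose2) (auto intro!: continuous_intros)
next
  case (Suc k)
  let ?q = "monom 1 2 * (p - pderiv p)"
  show ?case
  proof (rule cont_diff_SucI)
    show "((\<lambda>x. flat p (x \<bullet> d + a)) has_derivative (\<lambda>h. (h \<bullet> d) * flat ?q (x \<bullet> d + a))) (at x)" for x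
    proof -
      have "((\<lambda>x. x \<bullet> d + a) has_derivative (\<lambda>h. h \<bullet> d)) (at x)"
        by (auto intro!: derivative_eq_intros)
      from has_derivative_compose[OF this flat_has_derivative[unfolded has_field_derivative_def]]
      show ?thesis by (simp add: mult.commute)
    qed
    show "cont_diff k (\<lambda>x. (b \<bullet> d) * flat ?q (x \<bullet> d + a))" for b
      by (intro cont_diff_mult cont_diff_const Suc.IH)
  qed
qed

lemma flat_1_bounds: "0 \<le> flat 1 t" "flat 1 t \<le> 1"
  by (auto simp: flat_def)

text \<open>On t > 0 the value is exp(-1/(n t)), so stretching the argument sharpens the smooth step
  into the indicator of the open half line.\<close>

lemma flat_1_tendsto:
  "(\<lambda>n. flat 1 (real n * t)) \<longlonglongrightarrow> (if t > 0 then 1 else 0)"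
proof (cases "t > 0")
  case True
  have "(\<lambda>n. exp (- inverse t * inverse (real n))) \<longlonglongrightarrow> exp (- inverse t * 0)"
    by (intro tendsto_intros lim_inverse_n)
  moreover have "\<forall>\<^sub>F n in sequentially. exp (- inverse t * inverse (real n)) = flat 1 (real n * t)"
    using True by (intro eventually_sequentiallyI[of 1]) (auto simp: flat_def mult_le_0_iff)
  ultimately show ?thesis using True by (auto intro: Lim_transform_eventually)
next
  case False
  then have "flat 1 (real n * t) = 0" for n by (auto simp: flat_def mult_le_0_iff)
  then show ?thesis using False by simp
qed

text \<open>One smooth step for each face of the box. The products vanish off the closed box, which
  serves as compact support and explains the hypothesis on \<open>cbox\<close>; in the limit only
  the open box remains, as \<open>flat\<close> vanishes at 0.\<close>

lemma indicator_box_limit_test_functions: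
  fixes a b :: "'a::euclidean_space"
  assumes "cbox a b \<subseteq> D"
  obtains \<phi> where "\<And>n. \<phi> n \<in> test_functions D" "\<And>n x. 0 \<le> \<phi> n x" "\<And>n x. \<phi> n x \<le> 1"
    "\<And>n x. x \<notin> cbox a b \<Longrightarrow> \<phi> n x = 0" "\<And>x. (\<lambda>n. \<phi> n x) \<longlonglongrightarrow> indicator (box a b) x"
proof
  define \<phi> where "\<phi> n x = (\<Prod>e\<in>Basis. flat 1 (real n * (x \<bullet> e - a \<bullet> e)) * flat 1 (real n * (b \<bullet> e - x \<bullet> e)))"
    for n :: nat and x :: 'a
  show 0: "\<phi> n x = 0" if x: "x \<notin> cbox a b" for n x
  proof -
    obtain e where e: "e \<in> Basis" "x \<bullet> e < a \<bullet> e \<or> b \<bullet> e < x \<bullet> e"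
      using x by (auto simp: mem_box not_le)
    then have "flat 1 (real n * (x \<bullet> e - a \<bullet> e)) * flat 1 (real n * (b \<bullet> e - x \<bullet> e)) = 0"
      by (auto simp: flat_def mult_le_0_iff)
    then show ?thesis
      using e(1) unfolding \<phi>_def by (intro prod_zero) auto
  qed
  have "cont_diff k (\<phi> n)" for k n
  proof -
    have *: "real n * (x \<bullet> e - a \<bullet> e) = x \<bullet> (real n *\<^sub>R e) + - real n * (a \<bullet> e)"
      "real n * (b \<bullet> e - x \<bullet> e) = x \<bullet> (- real n *\<^sub>R e) + real n * (b \<bullet> e)" for x e
      by (simp_all add: algebra_simps)
    show ?thesis
      unfolding \<phi>_def * by (intro cont_diff_prod cont_diff_mult cont_diff_flat)
  qed
  then show "\<phi> n \<in> test_functions D" for n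
    using 0 assms compact_cbox[of a b] unfolding test_functions_def by blast
  show "0 \<le> \<phi> n x" for n x
    unfolding \<phi>_def by (intro prod_nonneg mult_nonneg_nonneg ballI flat_1_bounds)
  show "\<phi> n x \<le> 1" for n x
    unfolding \<phi>_def
    by (intro prod_le_1 conjI mult_nonneg_nonneg ballI flat_1_bounds mult_le_one)
  show "(\<lambda>n. \<phi> n x) \<longlonglongrightarrow> indicator (box a b) x" for x
  proof -
    have "(\<lambda>n. \<phi> n x) \<longlonglongrightarrow> (\<Prod>e\<in>Basis. (if x \<bullet> e - a \<bullet> e > 0 then 1 else 0) * (if b \<bullet> e - x \<bullet> e > 0 then 1 else 0))"
      unfolding \<phi>_def by (intro tendsto_prod tendsto_mult flat_1_tendsto)
    also have "(\<Prod>e\<in>Basis. (if x \<bullet> e - a \<bullet> e > 0 then 1 else 0) * (if b \<bullet> e - x \<bullet> e > 0 then 1 else 0))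
        = (indicator (box a b) x :: real)"
    proof (cases "x \<in> box a b")
      case True
      then show ?thesis by (auto simp: mem_box intro!: prod.neutral)
    next
      case False
      then obtain e where e: "e \<in> Basis" "\<not> (a \<bullet> e < x \<bullet> e \<and> x \<bullet> e < b \<bullet> e)"
        by (auto simp: mem_box)
      then show ?thesis
        using False by (subst prod_zero[OF finite_Basis]) (auto intro!: bexI[of _ e])
    qed
    finally show ?thesis .
  qed
qed

section \<open>The fundamental lemma of the calculus of variations\<close>

text \<open>The integrability clause of \<open>has_weak_gradient\<close>, separated because on an
  open set it already yields measurability and the pairing with test functions.\<close>

definition locally_integrable :: "'a::euclidean_space set \<Rightarrow> ('a \<Rightarrow> 'b::euclidean_space) \<Rightarrow> bool" where
  "locally_integrable D u \<longleftrightarrow> (\<forall>K. compact K \<and> K \<subseteq> D \<longrightarrow> set_integrable lborel K u)"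

lemma test_functionE:
  fixes \<phi> :: "'a::euclidean_space \<Rightarrow> real"
  assumes "\<phi> \<in> test_functions D"
  obtains K B where "compact K" "K \<subseteq> D" "\<And>x. x \<notin> K \<Longrightarrow> \<phi> x = 0" "\<And>x. \<bar>\<phi> x\<bar> \<le> B" "0 \<le> B"
proof -
  obtain K where K: "compact K" "K \<subseteq> D" "\<And>x. x \<notin> K \<Longrightarrow> \<phi> x = 0"
    using assms by (auto simp: test_functions_def)
  have "continuous_on UNIV \<phi>"
    using assms cont_diff_imp_continuous[of 0 \<phi>] by (auto simp: test_functions_def)
  then have "bounded (\<phi> ` K)"
    by (intro compact_imp_bounded compact_continuous_image) (auto intro: continuous_on_subset K)
  then obtain B where B: "\<And>x. x \<in> K \<Longrightarrow> \<bar>\<phi> x\<bar> \<le> B"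
    by (auto simp: bounded_iff)
  have "\<bar>\<phi> x\<bar> \<le> max B 0" for x
    using B[of x] K(3)[of x] by (cases "x \<in> K") auto
  then show thesis
    using that K by (meson max.cobounded2)
qed

lemma test_function_has_derivative:
  "\<phi> \<in> test_functions D \<Longrightarrow> (\<phi> has_derivative frechet_derivative \<phi> (at x)) (at x)"
  by (rule cont_diff_SucD[of 0]) (simp add: test_functions_def del: cont_diff.simps)

lemma test_function_borel [measurable_dest]:
  "\<phi> \<in> test_functions D \<Longrightarrow> \<phi> \<in> borel_measurable borel"
  by (rule borel_measurable_continuous_onI, rule cont_diff_imp_continuous[of 0])
    (simp add: test_functions_def del: cont_diff.simps)

lemma test_function_partial:
  assumes "\<phi> \<in> test_functions D" "b \<in> Basis"
  shows "(\<lambda>x. frechet_derivative \<phi> (at x) b) \<in> test_functions D"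
proof -
  obtain K where K: "compact K" "K \<subseteq> D" "\<And>x. x \<notin> K \<Longrightarrow> \<phi> x = 0"
    using assms by (auto simp: test_functions_def)
  have "frechet_derivative \<phi> (at x) b = 0" if "x \<notin> K" for x
  proof -
    have "(\<phi> has_derivative (\<lambda>_. 0)) (at x)"
      by (rule has_derivative_transform_within_open[of "\<lambda>_. 0" _ _ UNIV "- K"])
        (use K that compact_imp_closed in auto)
    from frechet_derivative_at[OF this] show ?thesis by metis
  qed
  moreover have "cont_diff k (\<lambda>x. frechet_derivative \<phi> (at x) b)" for k
  proof -
    have "cont_diff (Suc k) \<phi>"
      using assms unfolding test_functions_def by blast
    then show ?thesis using assms(2) by simp
  qed
  ultimately show ?thesis
    using K unfolding test_functions_def by blast
qed

lemma test_functions_mono: "D \<subseteq> E \<Longrightarrow> test_functions D \<subseteq> test_functions E"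
  unfolding test_functions_def by blast

lemma compact_borel: "compact K \<Longrightarrow> K \<in> sets borel" for K :: "'a::euclidean_space set"
  by (simp add: borel_closed compact_imp_closed)

text \<open>A test function is bounded and lives on a compact subset of \<open>D\<close>, so local
  integrability gives a genuine integral over \<open>D\<close>. This is what allows the equations
  defining weak gradients to be added up, as divergent integrals are 0 by default.\<close>

lemma locally_integrable_times_test:
  fixes u :: "'a::euclidean_space \<Rightarrow> real"
  assumes u: "locally_integrable D u" and \<phi>: "\<phi> \<in> test_functions D"
  shows "set_integrable lborel D (\<lambda>x. u x * \<phi> x)"
proof -
  note [measurable] = test_function_borel[OF \<phi>]
  obtain K B where K: "compact K" "K \<subseteq> D" "\<And>x. x \<notin> K \<Longrightarrow> \<phi> x = 0" "\<And>x. \<bar>\<phi> x\<bar> \<le> B" "0 \<le> B"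
    using test_functionE[OF \<phi>] by metis
  have i: "integrable lborel (\<lambda>x. indicator K x * u x)"
    using u K by (auto simp: locally_integrable_def set_integrable_def)
  have "integrable lborel (\<lambda>x. (indicator K x * u x) * \<phi> x)"
  proof (rule Bochner_Integration.integrable_bound)
    show "integrable lborel (\<lambda>x. B * (indicator K x * u x))"
      using i by simp
    show "(\<lambda>x. indicat_real K x * u x * \<phi> x) \<in> borel_measurable lborel"
      using borel_measurable_integrable[OF i] by measurable
    show "AE x in lborel. norm (indicat_real K x * u x * \<phi> x) \<le> norm (B * (indicat_real K x * u x))"
    proof (rule AE_I2)
      fix x
      show "norm (indicat_real K x * u x * \<phi> x) \<le> norm (B * (indicat_real K x * u x))"
        using mult_right_mono[OF K(4)[of x] abs_ge_zero[of "indicat_real K x * u x"]]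
        unfolding real_norm_def abs_mult[of B] abs_mult[of _ "\<phi> x"] abs_of_nonneg[OF K(5)]
        by (metis mult.commute)
    qed
  qed
  moreover have "(indicator K x * u x) * \<phi> x = indicator D x *\<^sub>R (u x * \<phi> x)" for x
    using K(2) K(3)[of x] by (cases "x \<in> K") (auto simp: indicator_def)
  ultimately show ?thesis
    by (simp add: set_integrable_def)
qed

text \<open>Boxes generate the Borel sets and are closed under intersection, so the vanishing
  extends from boxes to every Borel set, and a function with zero integral over every Borel set is
  zero almost everywhere.\<close>

lemma AE_zero_of_box_integrals:
  fixes G :: "'a::euclidean_space \<Rightarrow> real"
  assumes G: "integrable lborel G" and box: "\<And>a b. (LINT x:box a b|lborel. G x) = 0"
  shows "AE x in lborel. G x = 0"
proof (rule sigma_finite_measure.density_zero[OF sigma_finite_lborel G])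
  let ?E = "range (\<lambda>(a, b). box a b :: 'a set)"
  have si: "set_integrable lborel A G" if "A \<in> sets lborel" for A
    using integrable_mult_indicator[OF that G] by (simp add: set_integrable_def)
  \<comment> \<open>The complement step of the induction subtracts from the integral over the whole
    space, which is a limit over growing boxes.\<close>
  have all: "integral\<^sup>L lborel G = 0"
  proof -
    have "(\<lambda>n. LINT x|lborel. indicator (box (- real n *\<^sub>R One) (real n *\<^sub>R One)) x *\<^sub>R G x)
        \<longlonglongrightarrow> integral\<^sup>L lborel G"
    proof (rule integral_dominated_convergence[where w="\<lambda>x. norm (G x)"])
      show "AE x in lborel. (\<lambda>n. indicat_real (box (- real n *\<^sub>R One) (real n *\<^sub>R One)) x *\<^sub>R G x) \<longlonglongrightarrow> G x"
      proof (rule AE_I2)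
        fix x :: 'a
        obtain m :: nat where m: "norm x < real m"
          using reals_Archimedean2 by blast
        have "x \<in> box (- real n *\<^sub>R One) (real n *\<^sub>R One)" if "n \<ge> m" for n
        proof -
          have "\<bar>x \<bullet> e\<bar> < real n" if "e \<in> Basis" for e
            using Basis_le_norm[OF that, of x] m \<open>n \<ge> m\<close> by linarith
          then show ?thesis by (force simp: mem_box abs_less_iff)
        qed
        then have "\<forall>\<^sub>F n in sequentially. G x = indicat_real (box (- real n *\<^sub>R One) (real n *\<^sub>R One)) x *\<^sub>R G x"
          by (intro eventually_sequentiallyI[of m]) simp
        then show "(\<lambda>n. indicat_real (box (- real n *\<^sub>R One) (real n *\<^sub>R One)) x *\<^sub>R G x) \<longlonglongrightarrow> G x"
          by (rule Lim_transform_eventually[OF tendsto_const])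
      qed
    qed (use G in \<open>auto simp: indicator_def\<close>)
    moreover have "(LINT x|lborel. indicator (box (- real n *\<^sub>R One) (real n *\<^sub>R One)) x *\<^sub>R G x) = 0" for n
      using box[of "- real n *\<^sub>R One" "real n *\<^sub>R One"] by (simp add: set_lebesgue_integral_def)
    ultimately show ?thesis
      by (simp add: LIMSEQ_const_iff)
  qed
  fix A :: "'a set" assume "A \<in> sets lborel"
  moreover have sets: "sets (lborel :: 'a measure) = sigma_sets UNIV ?E"
    by (simp add: borel_eq_box)
  ultimately have "A \<in> sigma_sets UNIV ?E" by simp
  then show "set_lebesgue_integral lborel A G = 0"
  proof (rule sigma_sets_induct_disjoint[rotated 2])
    show "Int_stable ?E"
      by (auto simp: Int_stable_def box_Int_box)
    fix A assume "A \<in> sigma_sets UNIV ?E" and z: "set_lebesgue_integral lborel A G = 0"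
    then have A: "A \<in> sets lborel" using sets by simp
    have "(LINT x|lborel. G x - indicator A x *\<^sub>R G x) = 0"
      using all z si[OF A] G by (simp add: set_lebesgue_integral_def set_integrable_def)
    moreover have "G x - indicator A x *\<^sub>R G x = indicator (UNIV - A) x *\<^sub>R G x" for x
      by (auto simp: indicator_def)
    ultimately show "set_lebesgue_integral lborel (UNIV - A) G = 0"
      by (simp add: set_lebesgue_integral_def)
  next
    fix A :: "nat \<Rightarrow> 'a set"
    assume A: "disjoint_family A" "range A \<subseteq> sigma_sets UNIV ?E"
      and z: "\<And>i. set_lebesgue_integral lborel (A i) G = 0"
    have m: "A i \<in> sets lborel" for i using A(2) sets by auto
    have "set_lebesgue_integral lborel (\<Union>i. A i) G = (\<Sum>i. set_lebesgue_integral lborel (A i) G)"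
      by (rule lebesgue_integral_countable_add)
        (use A(1) m in \<open>auto simp: disjoint_family_on_def intro!: si\<close>)
    then show "set_lebesgue_integral lborel (\<Union>i. A i) G = 0"
      using z by simp
  qed (auto simp: box, simp add: set_lebesgue_integral_def)
qed

text \<open>Bump functions converge boundedly to the indicator of a box, so \<open>u\<close> has
  zero integral over every box whose closed box lies in \<open>D\<close>. Cut off to one such box,
  \<open>u\<close> is integrable on the whole space and the criterion by box integrals
  applies.\<close>

lemma fundamental_lemma:
  fixes u :: "'a::euclidean_space \<Rightarrow> real"
  assumes D: "open D" and u: "locally_integrable D u"
    and z: "\<And>\<phi>. \<phi> \<in> test_functions D \<Longrightarrow> (LINT x:D|lborel. u x * \<phi> x) = 0"
  shows "AE x in lborel. x \<in> D \<longrightarrow> u x = 0"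
proof -
  have si: "integrable lborel (\<lambda>x. indicator (cbox a b) x *\<^sub>R u x)" if "cbox a b \<subseteq> D" for a b
    using u that by (simp add: locally_integrable_def set_integrable_def)
  have box0: "(LINT x:box a b|lborel. u x) = 0" if ab: "cbox a b \<subseteq> D" for a b
  proof -
    obtain \<phi> where \<phi>: "\<And>n. \<phi> n \<in> test_functions D" "\<And>n x. 0 \<le> \<phi> n x" "\<And>n x. \<phi> n x \<le> 1"
      "\<And>n x. x \<notin> cbox a b \<Longrightarrow> \<phi> n x = 0" "\<And>x. (\<lambda>n. \<phi> n x) \<longlonglongrightarrow> indicator (box a b) x"
      using indicator_box_limit_test_functions[OF ab] by metis
    let ?u = "\<lambda>x. indicator (cbox a b) x *\<^sub>R u x"
    have [measurable]: "\<phi> n \<in> borel_measurable borel" for n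
      using test_function_borel[OF \<phi>(1)] .
    have [measurable]: "?u \<in> borel_measurable lborel"
      using si[OF ab] by (rule borel_measurable_integrable)
    have "(\<lambda>n. LINT x|lborel. ?u x * \<phi> n x) \<longlonglongrightarrow> (LINT x|lborel. ?u x * indicator (box a b) x)"
    proof (rule integral_dominated_convergence[where w="\<lambda>x. norm (?u x)"])
      show "AE x in lborel. (\<lambda>n. ?u x * \<phi> n x) \<longlonglongrightarrow> ?u x * indicator (box a b) x"
        by (intro AE_I2 tendsto_intros \<phi>)
      show "AE x in lborel. norm (?u x * \<phi> n x) \<le> norm (?u x)" for n
      proof (rule AE_I2)
        fix x
        show "norm (?u x * \<phi> n x) \<le> norm (?u x)"
          using mult_left_mono[OF \<phi>(3)[of n x], of "\<bar>?u x\<bar>"] \<phi>(2)[of n x] by (simp add: abs_mult)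
      qed
    qed (use si[OF ab] in simp_all)
    moreover have "(LINT x|lborel. ?u x * \<phi> n x) = (LINT x:D|lborel. u x * \<phi> n x)" for n
      unfolding set_lebesgue_integral_def
      by (rule Bochner_Integration.integral_cong) (use ab \<phi>(4) in \<open>auto simp: indicator_def\<close>)
    ultimately have "(LINT x|lborel. ?u x * indicator (box a b) x) = 0"
      using z[OF \<phi>(1)] by (simp add: LIMSEQ_const_iff)
    also have "(LINT x|lborel. ?u x * indicator (box a b) x) = (LINT x:box a b|lborel. u x)"
      unfolding set_lebesgue_integral_def
      by (rule Bochner_Integration.integral_cong)
        (use box_subset_cbox[of a b] in \<open>auto simp: indicator_def\<close>)
    finally show ?thesis .
  qed
  have AE_box: "AE x in lborel. x \<in> box a b \<longrightarrow> u x = 0" if ab: "cbox a b \<subseteq> D" for a b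
  proof -
    have "AE x in lborel. indicator (box a b) x *\<^sub>R u x = 0"
    proof (rule AE_zero_of_box_integrals)
      have "integrable lborel (\<lambda>x. indicator (box a b) x *\<^sub>R (indicator (cbox a b) x *\<^sub>R u x))"
        by (rule integrable_mult_indicator[OF _ si[OF ab]]) simp
      moreover have "(\<lambda>x. indicat_real (box a b) x *\<^sub>R (indicat_real (cbox a b) x *\<^sub>R u x))
          = (\<lambda>x. indicat_real (box a b) x *\<^sub>R u x)"
        by (intro ext) (use box_subset_cbox[of a b] in \<open>auto simp: indicator_def\<close>)
      ultimately show "integrable lborel (\<lambda>x. indicator (box a b) x *\<^sub>R u x)"
        by (simp only:)
      fix c d :: 'a
      \<comment> \<open>Two boxes meet in a box; if it is nonempty, its closed box lies in
        \<open>cbox a b\<close>, so \<open>box0\<close> applies to it.\<close>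
      obtain a' b' where I: "box c d \<inter> box a b = box a' b'"
        by (simp add: box_Int_box)
      have "(LINT x:box c d|lborel. indicator (box a b) x *\<^sub>R u x) = (LINT x:box a' b'|lborel. u x)"
        unfolding set_lebesgue_integral_def I[symmetric]
        by (simp add: indicator_inter_arith mult.assoc)
      also have "\<dots> = 0"
      proof (cases "box a' b' = {}")
        case False
        then have "closure (box a' b') = cbox a' b'" by (rule closure_box)
        moreover have "closure (box a' b') \<subseteq> cbox a b"
          using I box_subset_cbox[of a b] by (intro closure_minimal) auto
        ultimately show ?thesis using ab by (intro box0) auto
      qed (simp add: set_lebesgue_integral_def)
      finally show "(LINT x:box c d|lborel. indicator (box a b) x *\<^sub>R u x) = 0" .
    qed
    then show ?thesis by (auto elim!: eventually_mono split: split_indicator_asm)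
  qed
  \<comment> \<open>Lindelof's theorem makes the cover of \<open>D\<close> by such boxes countable,
    so that the exceptional null sets can be united.\<close>
  define \<B> where "\<B> = {box a b |a b. cbox a b \<subseteq> D}"
  obtain \<D> where \<D>: "\<D> \<subseteq> \<B>" "countable \<D>" "\<Union>\<D> = \<Union>\<B>"
    by (rule Lindelof[of \<B>]) (auto simp: \<B>_def open_box)
  have "\<exists>X\<in>\<B>. x \<in> X" if "x \<in> D" for x
    using open_contains_cbox[OF D that] by (metis (mono_tags, lifting) \<B>_def mem_Collect_eq)
  then have "D \<subseteq> \<Union>\<D>" using \<D>(3) by blast
  moreover have "AE x in lborel. \<forall>X\<in>\<D>. x \<in> X \<longrightarrow> u x = 0"
    unfolding AE_ball_countable[OF \<D>(2)]
  proof
    fix X assume "X \<in> \<D>"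
    then obtain a b where "X = box a b" "cbox a b \<subseteq> D"
      using \<D>(1) by (auto simp: \<B>_def)
    then show "AE x in lborel. x \<in> X \<longrightarrow> u x = 0"
      using AE_box by simp
  qed
  ultimately show ?thesis
    by (auto elim!: eventually_mono)
qed

section \<open>Weak gradients\<close>

lemma locally_integrable_component: "locally_integrable D g \<Longrightarrow> locally_integrable D (\<lambda>x. g x \<bullet> b)"
  unfolding locally_integrable_def set_integrable_def
  by (auto simp flip: inner_scaleR_left intro!: integrable_inner_left)

lemma locally_integrable_lincomb:
  assumes "locally_integrable D g" "locally_integrable D h"
  shows "locally_integrable D (\<lambda>x. p *\<^sub>R g x + q *\<^sub>R h x)"
  unfolding locally_integrable_def set_integrable_def
proof (intro allI impI)
  fix K assume "compact K \<and> K \<subseteq> D"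
  then have "integrable lborel (\<lambda>x. p *\<^sub>R (indicator K x *\<^sub>R g x) + q *\<^sub>R (indicator K x *\<^sub>R h x))"
    using assms by (intro Bochner_Integration.integrable_add integrable_scaleR_right)
      (auto simp: locally_integrable_def set_integrable_def)
  then show "integrable lborel (\<lambda>x. indicat_real K x *\<^sub>R (p *\<^sub>R g x + q *\<^sub>R h x))"
    by (simp add: algebra_simps)
qed

text \<open>Along a compact exhaustion of \<open>D\<close> the cut-off functions are integrable,
  hence measurable, and converge pointwise. This is how the arbitrary choice behind
  \<open>weak_grad\<close> becomes measurable.\<close>

lemma locally_integrable_measurable:
  assumes "open D" "locally_integrable D g"
  shows "set_borel_measurable lborel D g"
proof -
  obtain C :: "nat \<Rightarrow> 'a set" where C: "\<And>n. compact (C n)" "\<And>n. C n \<subseteq> D"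
    "\<And>n. C n \<subseteq> interior (C (Suc n))" "\<Union>(range C) = D"
    using open_Union_compact_subsets[OF assms(1)] by metis
  have mono: "C m \<subseteq> C n" if "m \<le> n" for m n
    by (rule lift_Suc_mono_le[of C, OF _ that]) (rule order_trans[OF C(3) interior_subset])
  show ?thesis
    unfolding set_borel_measurable_def
  proof (rule borel_measurable_LIMSEQ_metric)
    show "(\<lambda>x. indicat_real (C n) x *\<^sub>R g x) \<in> borel_measurable lborel" for n
      using assms(2) C(1,2)[of n] borel_measurable_integrable unfolding locally_integrable_def set_integrable_def
      by blast
    show "(\<lambda>n. indicat_real (C n) x *\<^sub>R g x) \<longlonglongrightarrow> indicat_real D x *\<^sub>R g x" for x
    proof (cases "x \<in> D")
      case True
      then obtain m where "x \<in> C m" using C(4) by auto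
      then have "\<forall>\<^sub>F n in sequentially. indicat_real D x *\<^sub>R g x = indicat_real (C n) x *\<^sub>R g x"
        using subsetD[OF mono] True by (intro eventually_sequentiallyI[of m]) simp
      then show ?thesis by (rule Lim_transform_eventually[OF tendsto_const])
    next
      case False
      then have "x \<notin> C n" for n using C(2) by blast
      then show ?thesis using False by simp
    qed
  qed
qed

lemma has_weak_gradient_altdef:
  "has_weak_gradient D u g \<longleftrightarrow> locally_integrable D u \<and> locally_integrable D g \<and>
     (\<forall>\<phi>\<in>test_functions D. \<forall>b\<in>Basis.
        (LINT x:D|lborel. u x * frechet_derivative \<phi> (at x) b)
          = - (LINT x:D|lborel. (g x \<bullet> b) * \<phi> x))"
  by (auto simp: has_weak_gradient_def locally_integrable_def)

text \<open>Both gradients satisfy the same integration by parts identity, so every component of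
  their difference is annihilated by all test functions.\<close>

lemma has_weak_gradient_unique:
  assumes D: "open D" and g: "has_weak_gradient D u g" and h: "has_weak_gradient D u h"
  shows "AE x in lborel. x \<in> D \<longrightarrow> g x = h x"
proof -
  have "AE x in lborel. x \<in> D \<longrightarrow> (g x - h x) \<bullet> b = 0" if b: "b \<in> Basis" for b
  proof (rule fundamental_lemma[OF D])
    have l: "locally_integrable D (\<lambda>x. g x \<bullet> b)" "locally_integrable D (\<lambda>x. h x \<bullet> b)"
      using g h by (auto simp: has_weak_gradient_altdef intro: locally_integrable_component)
    show "locally_integrable D (\<lambda>x. (g x - h x) \<bullet> b)"
      using locally_integrable_lincomb[OF l, of 1 "- 1"] by (simp add: inner_diff_left)
    fix \<phi> :: "'a \<Rightarrow> real" assume \<phi>: "\<phi> \<in> test_functions D"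
    have "(LINT x:D|lborel. (g x - h x) \<bullet> b * \<phi> x)
        = (LINT x:D|lborel. g x \<bullet> b * \<phi> x) - (LINT x:D|lborel. h x \<bullet> b * \<phi> x)"
      using set_integral_diff(2)[OF l[THEN locally_integrable_times_test[OF _ \<phi>]]]
      by (simp add: inner_diff_left left_diff_distrib)
    also have "\<dots> = 0"
      using g h \<phi> b by (force simp: has_weak_gradient_altdef)
    finally show "(LINT x:D|lborel. (g x - h x) \<bullet> b * \<phi> x) = 0" .
  qed
  then have "AE x in lborel. \<forall>b\<in>Basis. x \<in> D \<longrightarrow> (g x - h x) \<bullet> b = 0"
    by (intro AE_finite_allI) auto
  then show ?thesis
    by (rule eventually_mono) (auto intro: euclidean_eqI simp: inner_diff_left)
qed

lemma has_weak_gradient_lincomb: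
  assumes u: "has_weak_gradient D u g" and w: "has_weak_gradient D w h"
  shows "has_weak_gradient D (\<lambda>x. p * u x + q * w x) (\<lambda>x. p *\<^sub>R g x + q *\<^sub>R h x)"
  unfolding has_weak_gradient_altdef
proof (intro conjI ballI)
  have l: "locally_integrable D u" "locally_integrable D w" "locally_integrable D g" "locally_integrable D h"
    using u w by (auto simp: has_weak_gradient_altdef)
  show "locally_integrable D (\<lambda>x. p * u x + q * w x)"
    using locally_integrable_lincomb[OF l(1,2), of p q] by simp
  show "locally_integrable D (\<lambda>x. p *\<^sub>R g x + q *\<^sub>R h x)"
    by (rule locally_integrable_lincomb[OF l(3,4)])
  fix \<phi> :: "'a \<Rightarrow> real" and b :: 'a assume \<phi>: "\<phi> \<in> test_functions D" and b: "b \<in> Basis"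
  have *: "(LINT x:D|lborel. (p * f x + q * k x) * \<psi> x)
      = p * (LINT x:D|lborel. f x * \<psi> x) + q * (LINT x:D|lborel. k x * \<psi> x)"
    if "locally_integrable D f" "locally_integrable D k" "\<psi> \<in> test_functions D" for f k \<psi>
    using set_integral_add(2)[of lborel D "\<lambda>x. p * (f x * \<psi> x)" "\<lambda>x. q * (k x * \<psi> x)"]
      locally_integrable_times_test[OF that(1,3)] locally_integrable_times_test[OF that(2,3)]
    by (simp add: distrib_right mult.assoc)
  show "(LINT x:D|lborel. (p * u x + q * w x) * frechet_derivative \<phi> (at x) b)
      = - (LINT x:D|lborel. (p *\<^sub>R g x + q *\<^sub>R h x) \<bullet> b * \<phi> x)"
    using u w \<phi> b
    by (simp add: inner_add_left *[OF l(1,2) test_function_partial[OF \<phi> b]]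
        *[OF l(3,4)[THEN locally_integrable_component] \<phi>] has_weak_gradient_altdef)
qed

lemma has_weak_gradient_zero: "has_weak_gradient D (\<lambda>_. 0) (\<lambda>_. 0)"
  by (auto simp: has_weak_gradient_def set_integrable_def)

lemma has_weak_gradient_sum:
  assumes "finite I" "\<And>i. i \<in> I \<Longrightarrow> has_weak_gradient D (u i) (g i)"
  shows "has_weak_gradient D (\<lambda>x. \<Sum>i\<in>I. u i x) (\<lambda>x. \<Sum>i\<in>I. g i x)"
  using assms
proof (induction I rule: finite_induct)
  case (insert i I)
  then show ?case
    using has_weak_gradient_lincomb[of D "u i" "g i" "\<lambda>x. \<Sum>i\<in>I. u i x" "\<lambda>x. \<Sum>i\<in>I. g i x" 1 1]
    by simp
qed (simp add: has_weak_gradient_zero)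

lemma has_weak_gradient_weak_grad:
  "has_weak_gradient D u g \<Longrightarrow> has_weak_gradient D u (weak_grad D u)"
  using someI[of "has_weak_gradient D u" g] by (simp add: weak_grad_def)

text \<open>This lets any explicit weak gradient stand in for the chosen one under an integral over
  \<open>D\<close>.\<close>

lemma weak_grad_AE:
  assumes "open D" "has_weak_gradient D u g"
  shows "AE x in lborel. x \<in> D \<longrightarrow> weak_grad D u x = g x"
  using has_weak_gradient_unique[OF assms(1) has_weak_gradient_weak_grad[OF assms(2)] assms(2)] .

lemma weak_grad_measurable:
  assumes "open D" "has_weak_gradient D u g"
  shows "set_borel_measurable lborel D (weak_grad D u)"
  using has_weak_gradient_weak_grad[OF assms(2)] assms(1)
  by (auto simp: has_weak_gradient_altdef intro: locally_integrable_measurable)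

section \<open>Integration by parts for test functions\<close>

lemma locally_integrable_continuous:
  assumes "continuous_on UNIV u"
  shows "locally_integrable D u"
  unfolding locally_integrable_def set_integrable_def
  by (intro allI impI borel_integrable_compact) (auto intro: continuous_on_subset[OF assms])

lemma test_function_integrable:
  assumes "\<phi> \<in> test_functions D"
  shows "integrable lborel \<phi>"
  using locally_integrable_times_test[OF locally_integrable_continuous[OF continuous_on_const[of _ "1::real"]], of \<phi> UNIV]
    assms test_functions_mono[of D UNIV]
  by (auto simp: set_integrable_def)

text \<open>By translation invariance, the difference quotients of \<open>F\<close> integrate to zero.\<close>

lemma integral_partial_test_function:
  fixes F :: "'a::euclidean_space \<Rightarrow> real"
  assumes F: "F \<in> test_functions UNIV" and b: "b \<in> Basis"
  shows "(LINT x|lborel. frechet_derivative F (at x) b) = 0"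
proof -
  note [measurable] = test_function_borel[OF F]
  obtain K where K: "compact K" "\<And>x. x \<notin> K \<Longrightarrow> F x = 0"
    using test_functionE[OF F] by metis
  obtain R where R: "\<And>x. x \<in> K \<Longrightarrow> norm x \<le> R"
    using compact_imp_bounded[OF K(1)] by (auto simp: bounded_iff)
  obtain C where C: "\<And>x. \<bar>frechet_derivative F (at x) b\<bar> \<le> C" "0 \<le> C"
    using test_functionE[OF test_function_partial[OF F b]] by metis
  have intF: "integrable lborel F"
    by (rule test_function_integrable[OF F])
  \<comment> \<open>Steps of length at most 1 keep the shifted support within the ball of radius R +
    1. There the mean value theorem bounds the quotients by C, and outside they vanish; this gives
    the dominating function below.\<close>
  define t where "t n = inverse (real (Suc n))" for n
  have t: "0 < t n" "t n \<le> 1" for n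
    by (auto simp: t_def inverse_le_1_iff)
  have t0: "t \<longlonglongrightarrow> 0"
    unfolding t_def by (rule LIMSEQ_inverse_real_of_nat)
  have deriv: "((\<lambda>r. F (x + r *\<^sub>R b)) has_real_derivative frechet_derivative F (at (x + r *\<^sub>R b)) b) (at r)" for x r
  proof -
    have "((\<lambda>r. x + r *\<^sub>R b) has_derivative (\<lambda>h. h *\<^sub>R b)) (at r)"
      by (auto intro!: derivative_eq_intros)
    from has_derivative_compose[OF this test_function_has_derivative[OF F]]
    have "((\<lambda>r. F (x + r *\<^sub>R b)) has_derivative (\<lambda>h. frechet_derivative F (at (x + r *\<^sub>R b)) (h *\<^sub>R b))) (at r)" .
    moreover have "frechet_derivative F (at (x + r *\<^sub>R b)) (h *\<^sub>R b) = frechet_derivative F (at (x + r *\<^sub>R b)) b * h" for h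
      using linear_scale[OF linear_frechet_derivative, of F "at (x + r *\<^sub>R b)" h b]
        test_function_has_derivative[OF F] by (auto simp: differentiable_def mult.commute)
    ultimately show ?thesis by (simp add: has_field_derivative_def)
  qed
  have int: "integrable lborel (\<lambda>x. F (x + c))" and eq: "(LINT x|lborel. F (x + c)) = (LINT x|lborel. F x)" for c
  proof -
    have "integrable (distr lborel borel ((+) c)) F"
      using intF by (simp add: lborel_distr_plus)
    then show "integrable lborel (\<lambda>x. F (x + c))"
      by (subst (asm) integrable_distr_eq) (auto simp: add.commute)
    have "(LINT x|distr lborel borel ((+) c). F x) = (LINT x|lborel. F (x + c))"
      by (subst integral_distr) (auto simp: add.commute)
    then show "(LINT x|lborel. F (x + c)) = (LINT x|lborel. F x)"
      by (simp add: lborel_distr_plus)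
  qed
  have "(\<lambda>n. LINT x|lborel. (F (x + t n *\<^sub>R b) - F x) / t n) \<longlonglongrightarrow> (LINT x|lborel. frechet_derivative F (at x) b)"
  proof (rule integral_dominated_convergence[where w="\<lambda>x. C * indicator (cball 0 (R + 1)) x"])
    have "integrable lborel (indicator (cball (0::'a) (R + 1)) :: 'a \<Rightarrow> real)"
      using emeasure_bounded_finite[OF bounded_cball] by (intro integrable_real_indicator) auto
    then show "integrable lborel (\<lambda>x. C * indicator (cball (0::'a) (R + 1)) x)"
      by simp
    show "AE x in lborel. norm ((F (x + t n *\<^sub>R b) - F x) / t n) \<le> C * indicator (cball 0 (R + 1)) x" for n
    proof (rule AE_I2)
      fix x
      show "norm ((F (x + t n *\<^sub>R b) - F x) / t n) \<le> C * indicator (cball 0 (R + 1)) x"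
      proof (cases "x \<in> cball 0 (R + 1)")
        case True
        obtain z where "F (x + t n *\<^sub>R b) - F (x + 0 *\<^sub>R b) = (t n - 0) * frechet_derivative F (at (x + z *\<^sub>R b)) b"
          using MVT2[OF t(1)[of n] deriv] by metis
        then show ?thesis
          using True C(1) t[of n] by (simp add: abs_mult)
      next
        case False
        then have x: "norm x > R + 1" by simp
        moreover have "norm (x + t n *\<^sub>R b) \<ge> norm x - 1"
          using norm_triangle_ineq2[of x "- (t n *\<^sub>R b)"] t[of n] b by simp
        ultimately have "F x = 0" "F (x + t n *\<^sub>R b) = 0"
          using R K(2) by force+
        then show ?thesis using C(2) by simp
      qed
    qed
    show "AE x in lborel. (\<lambda>n. (F (x + t n *\<^sub>R b) - F x) / t n) \<longlonglongrightarrow> frechet_derivative F (at x) b"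
    proof (rule AE_I2)
      fix x
      have "((\<lambda>h. (F (x + h *\<^sub>R b) - F x) / h) \<longlongrightarrow> frechet_derivative F (at x) b) (at 0)"
        using deriv[of x 0] by (simp add: has_field_derivative_iff)
      moreover have "filterlim t (at 0) sequentially"
        using t0 t(1) by (auto simp: filterlim_at less_imp_neq[symmetric] intro!: always_eventually)
      ultimately show "(\<lambda>n. (F (x + t n *\<^sub>R b) - F x) / t n) \<longlonglongrightarrow> frechet_derivative F (at x) b"
        by (rule filterlim_compose)
    qed
    show "(\<lambda>x. frechet_derivative F (at x) b) \<in> borel_measurable lborel"
      using test_function_borel[OF test_function_partial[OF F b]] by simp
  qed measurable
  moreover have "(LINT x|lborel. (F (x + t n *\<^sub>R b) - F x) / t n) = 0" for n
    using int[of "t n *\<^sub>R b"] intF eq[of "t n *\<^sub>R b"] by simp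
  ultimately show ?thesis
    by (simp only: LIMSEQ_const_iff)
qed

lemma test_functions_mult:
  assumes "\<phi> \<in> test_functions D" "\<psi> \<in> test_functions D"
  shows "(\<lambda>x. \<phi> x * \<psi> x) \<in> test_functions D"
proof -
  obtain K where "compact K" "K \<subseteq> D" "\<And>x. x \<notin> K \<Longrightarrow> \<phi> x = 0"
    using assms(1) by (auto simp: test_functions_def)
  then have "\<exists>K. compact K \<and> K \<subseteq> D \<and> (\<forall>x. x \<notin> K \<longrightarrow> \<phi> x * \<psi> x = 0)"
    by auto
  then show ?thesis
    using assms by (simp add: test_functions_def cont_diff_mult del: cont_diff.simps)
qed

lemma locally_integrable_test_function:
  assumes "\<phi> \<in> test_functions D"
  shows "locally_integrable D \<phi>"
proof -
  have "continuous_on UNIV \<phi>"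
    using assms cont_diff_imp_continuous[of 0 \<phi>] by (auto simp: test_functions_def)
  then show ?thesis by (rule locally_integrable_continuous)
qed

definition gradient :: "('a::euclidean_space \<Rightarrow> real) \<Rightarrow> 'a \<Rightarrow> 'a" where
  "gradient \<phi> x = (\<Sum>b\<in>Basis. frechet_derivative \<phi> (at x) b *\<^sub>R b)"

text \<open>By the Leibniz rule, integration by parts is the vanishing integral of a partial
  derivative of the test function \<phi> * \<psi>. The result places the approximants in the
  definition of \<open>H10\<close> in H1, so that norms of differences can be estimated.\<close>

lemma has_weak_gradient_test_function:
  assumes \<phi>: "\<phi> \<in> test_functions D"
  shows "has_weak_gradient D \<phi> (gradient \<phi>)"
  unfolding has_weak_gradient_altdef
proof (intro conjI ballI)
  show "locally_integrable D \<phi>" by (rule locally_integrable_test_function[OF \<phi>])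
  have "locally_integrable D (\<lambda>x. frechet_derivative \<phi> (at x) b)" if "b \<in> Basis" for b
    by (rule locally_integrable_test_function[OF test_function_partial[OF \<phi> that]])
  then show "locally_integrable D (gradient \<phi>)"
    unfolding locally_integrable_def set_integrable_def gradient_def scaleR_sum_right scaleR_scaleR
    by (auto intro!: Bochner_Integration.integrable_sum integrable_scaleR_left)
  fix \<psi> :: "'a \<Rightarrow> real" and b :: 'a assume \<psi>: "\<psi> \<in> test_functions D" and b: "b \<in> Basis"
  let ?d = "\<lambda>f x. frechet_derivative f (at x) b"
  have d: "?d (\<lambda>x. \<phi> x * \<psi> x) x = \<phi> x * ?d \<psi> x + ?d \<phi> x * \<psi> x" for x
    using frechet_derivative_at[OF has_derivative_mult[OF test_function_has_derivative[OF \<phi>] test_function_has_derivative[OF \<psi>]], of x]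
    by (metis (no_types, lifting))
  have z: "(LINT x|lborel. ?d (\<lambda>x. \<phi> x * \<psi> x) x) = 0"
    using integral_partial_test_function[OF _ b] test_functions_mult[OF \<phi> \<psi>] test_functions_mono[of D UNIV]
    by blast
  have s: "set_integrable lborel D (\<lambda>x. \<phi> x * ?d \<psi> x)" "set_integrable lborel D (\<lambda>x. ?d \<phi> x * \<psi> x)"
    by (rule locally_integrable_times_test[OF locally_integrable_test_function[OF \<phi>] test_function_partial[OF \<psi> b]],
        rule locally_integrable_times_test[OF locally_integrable_test_function[OF test_function_partial[OF \<phi> b]] \<psi>])
  have "(LINT x:D|lborel. \<phi> x * ?d \<psi> x) + (LINT x:D|lborel. ?d \<phi> x * \<psi> x)
      = (LINT x:D|lborel. ?d (\<lambda>x. \<phi> x * \<psi> x) x)"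
    using set_integral_add(2)[OF s] d by simp
  also have "\<dots> = (LINT x|lborel. ?d (\<lambda>x. \<phi> x * \<psi> x) x)"
  proof -
    have "?d (\<lambda>x. \<phi> x * \<psi> x) x = 0" if "x \<notin> D" for x
      using test_functionE[OF test_function_partial[OF test_functions_mult[OF \<phi> \<psi>] b]] that
      by (metis subsetD)
    then show ?thesis
      unfolding set_lebesgue_integral_def
      by (intro Bochner_Integration.integral_cong) (auto simp: indicator_def)
  qed
  finally have "(LINT x:D|lborel. \<phi> x * ?d \<psi> x) = - (LINT x:D|lborel. ?d \<phi> x * \<psi> x)"
    using z by simp
  moreover have "gradient \<phi> x \<bullet> b = ?d \<phi> x" for x
    using b unfolding gradient_def by (simp add: inner_sum_left inner_Basis if_distrib sum.delta cong: if_cong)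
  ultimately show "(LINT x:D|lborel. \<phi> x * ?d \<psi> x) = - (LINT x:D|lborel. gradient \<phi> x \<bullet> b * \<psi> x)"
    by simp
qed

section \<open>The Sobolev spaces \<open>H\<^sup>1\<close> and \<open>H\<^sup>1\<^sub>0\<close>\<close>

abbreviation L2 :: "'a::euclidean_space set \<Rightarrow> ('a \<Rightarrow> 'b::euclidean_space) set" where
  "L2 D \<equiv> L2_space (\<lambda>_. 1) D"

text \<open>All conditions are moved onto the truncated function
  \<open>indicator D x *\<^sub>R u x\<close>, which is Borel on the whole space, whereas
  \<open>u\<close> itself is arbitrary off \<open>D\<close>.\<close>

lemma L2_iff:
  "u \<in> L2 D \<longleftrightarrow> (\<lambda>x. indicator D x *\<^sub>R u x) \<in> borel_measurable borel \<and>
     integrable lborel (\<lambda>x. (norm (indicator D x *\<^sub>R u x))\<^sup>2)"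
proof -
  have "(norm (indicator D x *\<^sub>R u x))\<^sup>2 = indicator D x *\<^sub>R (1 * (norm (u x))\<^sup>2)" for x
    by (simp add: indicator_def)
  then show ?thesis
    by (simp add: L2_space_def set_borel_measurable_def set_integrable_def)
qed

text \<open>The factor 2 comes from 2ab \<le> a^2 + b^2. This squared triangle inequality serves L2,
  \<open>H1_norm_sq\<close> and the traces alike.\<close>

lemma norm_lincomb_sq_le:
  fixes x y :: "'a::real_normed_vector"
  shows "(norm (p *\<^sub>R x + q *\<^sub>R y))\<^sup>2 \<le> 2 * p\<^sup>2 * (norm x)\<^sup>2 + 2 * q\<^sup>2 * (norm y)\<^sup>2"
proof -
  have "(norm (p *\<^sub>R x + q *\<^sub>R y))\<^sup>2 \<le> (norm (p *\<^sub>R x) + norm (q *\<^sub>R y))\<^sup>2"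
    by (intro power_mono norm_triangle_ineq) simp
  also have "\<dots> \<le> 2 * (norm (p *\<^sub>R x))\<^sup>2 + 2 * (norm (q *\<^sub>R y))\<^sup>2"
    using zero_le_power2[of "norm (p *\<^sub>R x) - norm (q *\<^sub>R y)"] by (simp add: power2_sum power2_diff)
  finally show ?thesis by (simp add: power_mult_distrib)
qed

lemma L2_lincomb:
  assumes "u \<in> L2 D" "w \<in> L2 D"
  shows "(\<lambda>x. p *\<^sub>R u x + q *\<^sub>R w x) \<in> L2 D"
proof -
  let ?u = "\<lambda>x. indicator D x *\<^sub>R u x" and ?w = "\<lambda>x. indicator D x *\<^sub>R w x"
  have [measurable]: "?u \<in> borel_measurable borel" "?w \<in> borel_measurable borel"
    and i: "integrable lborel (\<lambda>x. (norm (?u x))\<^sup>2)" "integrable lborel (\<lambda>x. (norm (?w x))\<^sup>2)"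
    using assms by (auto simp: L2_iff)
  have e: "indicator D x *\<^sub>R (p *\<^sub>R u x + q *\<^sub>R w x) = p *\<^sub>R ?u x + q *\<^sub>R ?w x" for x
    by (simp add: algebra_simps)
  have "integrable lborel (\<lambda>x. (norm (p *\<^sub>R ?u x + q *\<^sub>R ?w x))\<^sup>2)"
  proof (rule Bochner_Integration.integrable_bound)
    show "integrable lborel (\<lambda>x. 2 * p\<^sup>2 * (norm (?u x))\<^sup>2 + 2 * q\<^sup>2 * (norm (?w x))\<^sup>2)"
      using i by (intro Bochner_Integration.integrable_add integrable_mult_right) auto
    show "AE x in lborel. norm ((norm (p *\<^sub>R ?u x + q *\<^sub>R ?w x))\<^sup>2) \<le>
        norm (2 * p\<^sup>2 * (norm (?u x))\<^sup>2 + 2 * q\<^sup>2 * (norm (?w x))\<^sup>2)"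
    proof (rule AE_I2)
      fix x
      show "norm ((norm (p *\<^sub>R ?u x + q *\<^sub>R ?w x))\<^sup>2) \<le>
        norm (2 * p\<^sup>2 * (norm (?u x))\<^sup>2 + 2 * q\<^sup>2 * (norm (?w x))\<^sup>2)"
        using norm_lincomb_sq_le[of p "?u x" q "?w x"] by simp
    qed
  qed measurable
  moreover have "(\<lambda>x. p *\<^sub>R ?u x + q *\<^sub>R ?w x) \<in> borel_measurable borel"
    by measurable
  ultimately show ?thesis
    unfolding L2_iff e by blast
qed

lemma L2_AE_cong:
  assumes "u \<in> L2 D" "set_borel_measurable lborel D w" "AE x in lborel. x \<in> D \<longrightarrow> w x = u x"
  shows "w \<in> L2 D"
proof -
  have [measurable]: "(\<lambda>x. indicator D x *\<^sub>R u x) \<in> borel_measurable borel"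
    "(\<lambda>x. indicator D x *\<^sub>R w x) \<in> borel_measurable borel"
    using assms(1,2) by (auto simp: L2_iff set_borel_measurable_def)
  have "AE x in lborel. (norm (indicator D x *\<^sub>R w x))\<^sup>2 = (norm (indicator D x *\<^sub>R u x))\<^sup>2"
    using assms(3) by (rule eventually_mono) (auto simp: indicator_def)
  moreover have "(\<lambda>x. (norm (indicator D x *\<^sub>R w x))\<^sup>2) \<in> borel_measurable lborel"
    "(\<lambda>x. (norm (indicator D x *\<^sub>R u x))\<^sup>2) \<in> borel_measurable lborel"
    by measurable
  ultimately have "integrable lborel (\<lambda>x. (norm (indicator D x *\<^sub>R w x))\<^sup>2)"
    using assms(1) integrable_cong_AE unfolding L2_iff by blast
  then show ?thesis
    by (simp add: L2_iff)
qed

lemma L2_test_function: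
  assumes "open D" "\<phi> \<in> test_functions D"
  shows "\<phi> \<in> L2 D"
proof -
  note [measurable] = test_function_borel[OF assms(2)] borel_open[OF assms(1)]
  have "integrable lborel (\<lambda>x. indicator D x *\<^sub>R (\<phi> x * \<phi> x))"
    using integrable_mult_indicator[OF _ test_function_integrable[OF test_functions_mult[OF assms(2,2)]]]
    by simp
  moreover have "(norm (indicator D x *\<^sub>R \<phi> x))\<^sup>2 = indicator D x *\<^sub>R (\<phi> x * \<phi> x)" for x
    by (simp add: indicator_def power2_eq_square)
  ultimately show ?thesis
    unfolding L2_iff by simp
qed

text \<open>The existential gradient can be taken to be the chosen one: it agrees almost everywhere
  with the L2 witness, and its measurability comes from local integrability.\<close>

lemma H1_altdef: "open D \<Longrightarrow> u \<in> H1_space (\<lambda>_. 1) D \<longleftrightarrow>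
  u \<in> L2 D \<and> weak_grad D u \<in> L2 D \<and> has_weak_gradient D u (weak_grad D u)"
  unfolding H1_space_def
  by (auto dest: has_weak_gradient_weak_grad
      intro: L2_AE_cong[OF _ weak_grad_measurable weak_grad_AE])

lemma H1I: "u \<in> L2 D \<Longrightarrow> has_weak_gradient D u g \<Longrightarrow> g \<in> L2 D \<Longrightarrow> u \<in> H1_space (\<lambda>_. 1) D"
  unfolding H1_space_def by auto

lemma H1_lincomb:
  assumes D: "open D" and u: "u \<in> H1_space (\<lambda>_. 1) D" and w: "w \<in> H1_space (\<lambda>_. 1) D"
  shows "(\<lambda>x. p * u x + q * w x) \<in> H1_space (\<lambda>_. 1) D"
    and "AE x in lborel. x \<in> D \<longrightarrow>
      weak_grad D (\<lambda>x. p * u x + q * w x) x = p *\<^sub>R weak_grad D u x + q *\<^sub>R weak_grad D w x"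
proof -
  have h: "has_weak_gradient D (\<lambda>x. p * u x + q * w x) (\<lambda>x. p *\<^sub>R weak_grad D u x + q *\<^sub>R weak_grad D w x)"
    using u w by (intro has_weak_gradient_lincomb) (simp_all add: H1_altdef[OF D])
  show "(\<lambda>x. p * u x + q * w x) \<in> H1_space (\<lambda>_. 1) D"
    using L2_lincomb[of u D w p q] u w by (intro H1I[OF _ h] L2_lincomb) (auto simp: H1_altdef[OF D])
  show "AE x in lborel. x \<in> D \<longrightarrow>
      weak_grad D (\<lambda>x. p * u x + q * w x) x = p *\<^sub>R weak_grad D u x + q *\<^sub>R weak_grad D w x"
    by (rule weak_grad_AE[OF D h])
qed

lemma H1_test_function:
  assumes D: "open D" and \<phi>: "\<phi> \<in> test_functions D"
  shows "\<phi> \<in> H1_space (\<lambda>_. 1) D"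
proof (rule H1I[OF L2_test_function[OF assms] has_weak_gradient_test_function[OF \<phi>]])
  have z: "(\<lambda>_. 0) \<in> L2 D" by (simp add: L2_iff)
  have c: "(\<lambda>x. frechet_derivative \<phi> (at x) b *\<^sub>R b) \<in> L2 D" if b: "b \<in> Basis" for b
  proof -
    have "norm (indicat_real D x *\<^sub>R frechet_derivative \<phi> (at x) b *\<^sub>R b)
        = norm (indicat_real D x *\<^sub>R frechet_derivative \<phi> (at x) b)" for x
      using b by simp
    then show ?thesis
      using L2_test_function[OF D test_function_partial[OF \<phi> b]]
      unfolding L2_iff scaleR_scaleR[symmetric] by (auto simp del: norm_scaleR)
  qed
  have "(\<lambda>x. \<Sum>b\<in>I. frechet_derivative \<phi> (at x) b *\<^sub>R b) \<in> L2 D" if "I \<subseteq> Basis" "finite I" for I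
    using that(2,1)
  proof (induction I rule: finite_induct)
    case (insert b I)
    then show ?case
      using L2_lincomb[OF c[of b] insert.IH, of 1 1] by simp
  qed (simp add: z)
  then show "gradient \<phi> \<in> L2 D"
    unfolding gradient_def by simp
qed

lemma H1_norm_sq_integrable:
  assumes "open D" "u \<in> H1_space (\<lambda>_. 1) D"
  shows "set_integrable lborel D (\<lambda>x. (u x)\<^sup>2 + (norm (weak_grad D u x))\<^sup>2)"
  using assms by (intro set_integral_add) (auto simp: H1_altdef L2_space_def)

text \<open>A squared triangle inequality up to a factor, which suffices for the closure defining
  \<open>H10\<close> to be a subspace.\<close>

lemma H1_norm_sq_lincomb_le:
  assumes D: "open D" and u: "u \<in> H1_space (\<lambda>_. 1) D" and w: "w \<in> H1_space (\<lambda>_. 1) D"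
  shows "H1_norm_sq D (\<lambda>x. p * u x + q * w x) \<le> 2 * p\<^sup>2 * H1_norm_sq D u + 2 * q\<^sup>2 * H1_norm_sq D w"
proof -
  note i = H1_norm_sq_integrable[OF D]
  have le: "AE x in lborel. x \<in> D \<longrightarrow> (p * u x + q * w x)\<^sup>2 + (norm (weak_grad D (\<lambda>x. p * u x + q * w x) x))\<^sup>2
      \<le> 2 * p\<^sup>2 * ((u x)\<^sup>2 + (norm (weak_grad D u x))\<^sup>2) + 2 * q\<^sup>2 * ((w x)\<^sup>2 + (norm (weak_grad D w x))\<^sup>2)"
    using H1_lincomb(2)[OF assms, of p q]
  proof (rule eventually_mono, intro impI)
    fix x assume "x \<in> D \<longrightarrow> weak_grad D (\<lambda>x. p * u x + q * w x) x = p *\<^sub>R weak_grad D u x + q *\<^sub>R weak_grad D w x" "x \<in> D"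
    then show "(p * u x + q * w x)\<^sup>2 + (norm (weak_grad D (\<lambda>x. p * u x + q * w x) x))\<^sup>2
      \<le> 2 * p\<^sup>2 * ((u x)\<^sup>2 + (norm (weak_grad D u x))\<^sup>2) + 2 * q\<^sup>2 * ((w x)\<^sup>2 + (norm (weak_grad D w x))\<^sup>2)"
      using norm_lincomb_sq_le[of p "u x" q "w x"] norm_lincomb_sq_le[of p "weak_grad D u x" q "weak_grad D w x"]
      by (simp add: distrib_left)
  qed
  have "H1_norm_sq D (\<lambda>x. p * u x + q * w x)
      \<le> (LINT x:D|lborel. 2 * p\<^sup>2 * ((u x)\<^sup>2 + (norm (weak_grad D u x))\<^sup>2) + 2 * q\<^sup>2 * ((w x)\<^sup>2 + (norm (weak_grad D w x))\<^sup>2))"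
    unfolding H1_norm_sq_def
    by (intro set_integral_mono_AE i H1_lincomb(1) assms set_integral_add set_integrable_mult_right le)
  also have "\<dots> = 2 * p\<^sup>2 * H1_norm_sq D u + 2 * q\<^sup>2 * H1_norm_sq D w"
    unfolding H1_norm_sq_def using i[OF u] i[OF w]
    by (subst set_integral_add) (simp_all del: distrib_left_numeral)
  finally show ?thesis .
qed

lemma test_functions_lincomb:
  assumes "\<phi> \<in> test_functions D" "\<psi> \<in> test_functions D"
  shows "(\<lambda>x. p * \<phi> x + q * \<psi> x) \<in> test_functions D"
proof -
  obtain K where "compact K" "K \<subseteq> D" "\<And>x. x \<notin> K \<Longrightarrow> \<phi> x = 0"
    using assms(1) by (auto simp: test_functions_def)
  moreover obtain L where "compact L" "L \<subseteq> D" "\<And>x. x \<notin> L \<Longrightarrow> \<psi> x = 0"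
    using assms(2) by (auto simp: test_functions_def)
  ultimately have "compact (K \<union> L) \<and> K \<union> L \<subseteq> D \<and> (\<forall>x. x \<notin> K \<union> L \<longrightarrow> p * \<phi> x + q * \<psi> x = 0)"
    by auto
  then have "\<exists>K. compact K \<and> K \<subseteq> D \<and> (\<forall>x. x \<notin> K \<longrightarrow> p * \<phi> x + q * \<psi> x = 0)"
    by (rule exI)
  then show ?thesis
    using assms by (simp add: test_functions_def cont_diff_mult cont_diff_add cont_diff_const del: cont_diff.simps)
qed

lemma H10_H1: "u \<in> H10 D \<Longrightarrow> u \<in> H1_space (\<lambda>_. 1) D"
  by (simp add: H10_def)

lemma H10_lincomb:
  assumes D: "open D" and u: "u \<in> H10 D" and w: "w \<in> H10 D"
  shows "(\<lambda>x. p * u x + q * w x) \<in> H10 D"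
  unfolding H10_def
proof (intro CollectI conjI allI impI)
  show "(\<lambda>x. p * u x + q * w x) \<in> H1_space (\<lambda>_. 1) D"
    using u w by (intro H1_lincomb(1) D) (auto simp: H10_def)
  fix \<epsilon> :: real assume \<epsilon>: "0 < \<epsilon>"
  \<comment> \<open>The summand 1 keeps the denominator positive for p = q = 0 and makes the final
    estimate strict.\<close>
  define \<delta> where "\<delta> = \<epsilon> / (2 * p\<^sup>2 + 2 * q\<^sup>2 + 1)"
  have pq: "0 < 2 * p\<^sup>2 + 2 * q\<^sup>2 + 1"
    using zero_le_power2[of p] zero_le_power2[of q] by linarith
  then have \<delta>: "0 < \<delta>" using \<epsilon> by (simp add: \<delta>_def)
  obtain \<phi> where \<phi>: "\<phi> \<in> test_functions D" "H1_norm_sq D (\<lambda>x. u x - \<phi> x) < \<delta>"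
    using u \<delta> by (auto simp: H10_def)
  obtain \<psi> where \<psi>: "\<psi> \<in> test_functions D" "H1_norm_sq D (\<lambda>x. w x - \<psi> x) < \<delta>"
    using w \<delta> by (auto simp: H10_def)
  have d: "(\<lambda>x. u x - \<phi> x) \<in> H1_space (\<lambda>_. 1) D" "(\<lambda>x. w x - \<psi> x) \<in> H1_space (\<lambda>_. 1) D"
    using H1_lincomb(1)[OF D H10_H1[OF u] H1_test_function[OF D \<phi>(1)], of 1 "-1"]
      H1_lincomb(1)[OF D H10_H1[OF w] H1_test_function[OF D \<psi>(1)], of 1 "-1"] by simp_all
  have "H1_norm_sq D (\<lambda>x. p * u x + q * w x - (p * \<phi> x + q * \<psi> x))
      = H1_norm_sq D (\<lambda>x. p * (u x - \<phi> x) + q * (w x - \<psi> x))"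
    by (simp add: algebra_simps)
  also have "\<dots> \<le> 2 * p\<^sup>2 * H1_norm_sq D (\<lambda>x. u x - \<phi> x) + 2 * q\<^sup>2 * H1_norm_sq D (\<lambda>x. w x - \<psi> x)"
    by (rule H1_norm_sq_lincomb_le[OF D d])
  also have "\<dots> \<le> 2 * p\<^sup>2 * \<delta> + 2 * q\<^sup>2 * \<delta>"
    using \<phi>(2) \<psi>(2) by (intro add_mono mult_left_mono) auto
  also have "\<dots> < (2 * p\<^sup>2 + 2 * q\<^sup>2 + 1) * \<delta>"
    using \<delta> by (simp add: algebra_simps)
  also have "\<dots> = \<epsilon>"
    using pq by (simp add: \<delta>_def)
  finally show "\<exists>\<phi>\<in>test_functions D. H1_norm_sq D (\<lambda>x. p * u x + q * w x - \<phi> x) < \<epsilon>"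
    using test_functions_lincomb[OF \<phi>(1) \<psi>(1), of p q]
    by (rule bexI[where x="\<lambda>x. p * \<phi> x + q * \<psi> x"])
qed

lemma H10_zero:
  assumes D: "open D"
  shows "(\<lambda>_. 0) \<in> H10 D"
proof -
  have z: "(\<lambda>_. 0) \<in> test_functions D"
    by (auto simp: test_functions_def cont_diff_const simp del: cont_diff.simps intro!: exI[of _ "{}"])
  have h: "(\<lambda>_. 0) \<in> H1_space (\<lambda>_. 1) D" by (rule H1_test_function[OF D z])
  \<comment> \<open>The chosen weak gradient of 0 vanishes only almost everywhere; the estimate with
    p = q = 0 absorbs this.\<close>
  have "H1_norm_sq D (\<lambda>x. 0) \<le> 0"
    using H1_norm_sq_lincomb_le[OF D h h, of 0 0] by simp
  then show ?thesis
    using z h by (auto simp: H10_def intro!: bexI[OF _ z])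
qed

lemma H10_subspace:
  assumes D: "open D"
  shows "fun_vs.subspace (H10 D)"
  unfolding fun_vs.subspace_def
proof (intro conjI ballI allI)
  show "0 \<in> H10 D" using H10_zero[OF D] by (simp add: zero_fun_def)
  show "u + w \<in> H10 D" if "u \<in> H10 D" "w \<in> H10 D" for u w
    using H10_lincomb[OF D that, of 1 1] by (simp add: plus_fun_def)
  show "fun_scale c u \<in> H10 D" if "u \<in> H10 D" for c u
    using H10_lincomb[OF D that that, of c 0] by (simp add: fun_scale_def)
qed

section \<open>Tensor products and splines\<close>

text \<open>Both orders are provided because integrating by parts in one variable requires that
  variable in the inner integral.\<close>

lemma set_integral_Times:
  fixes F :: "'a::euclidean_space \<times> 'b::euclidean_space \<Rightarrow> real"
  assumes F: "set_integrable lborel (D \<times> I) F"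
  shows set_integral_Times_fst: "(LINT z:D \<times> I|lborel. F z) = (LINT x:D|lborel. LINT y:I|lborel. F (x, y))"
    and set_integral_Times_snd: "(LINT z:D \<times> I|lborel. F z) = (LINT y:I|lborel. LINT x:D|lborel. F (x, y))"
proof -
  have ind: "indicator (D \<times> I) (x, y) * F (x, y) = indicator D x * (indicator I y * F (x, y))" for x y
    by (simp add: indicator_times)
  have i: "integrable (lborel \<Otimes>\<^sub>M lborel) (\<lambda>z. indicator (D \<times> I) z *\<^sub>R F z)"
    using F by (simp add: set_integrable_def lborel_prod)
  have "(LINT z:D \<times> I|lborel. F z) = (LINT x|lborel. LINT y|lborel. indicator (D \<times> I) (x, y) *\<^sub>R F (x, y))"
    unfolding set_lebesgue_integral_def by (subst lborel_pair.integral_fst'[OF i]) (simp add: lborel_prod)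
  then show "(LINT z:D \<times> I|lborel. F z) = (LINT x:D|lborel. LINT y:I|lborel. F (x, y))"
    by (simp add: ind set_lebesgue_integral_def)
  have "(LINT z:D \<times> I|lborel. F z) = (LINT y|lborel. LINT x|lborel. indicator (D \<times> I) (x, y) *\<^sub>R F (x, y))"
    unfolding set_lebesgue_integral_def
    by (subst lborel_pair.integral_snd) (use i in \<open>simp_all add: lborel_prod split_def\<close>)
  then show "(LINT z:D \<times> I|lborel. F z) = (LINT y:I|lborel. LINT x:D|lborel. F (x, y))"
    by (simp add: ind mult.left_commute[of "indicator D _"] set_lebesgue_integral_def)
qed

lemma set_integrable_tensor:
  fixes f :: "'a::euclidean_space \<Rightarrow> real" and g :: "'b::euclidean_space \<Rightarrow> real"
  assumes f: "set_integrable lborel D f" and g: "set_integrable lborel I g"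
  shows "set_integrable lborel (D \<times> I) (\<lambda>z. f (fst z) * g (snd z))"
    and "(LINT z:D \<times> I|lborel. f (fst z) * g (snd z)) = (LINT x:D|lborel. f x) * (LINT y:I|lborel. g y)"
proof -
  let ?f = "\<lambda>x. indicator D x *\<^sub>R f x" and ?g = "\<lambda>x. indicator I x *\<^sub>R g x"
  have i: "integrable lborel ?f" "integrable lborel ?g"
    using f g by (auto simp: set_integrable_def)
  have [measurable]: "?f \<in> borel_measurable lborel" "?g \<in> borel_measurable lborel"
    using i by auto
  have "integrable (lborel \<Otimes>\<^sub>M lborel) (\<lambda>z. ?f (fst z) * ?g (snd z))"
  proof (rule lborel_pair.Fubini_integrable)
    show "(\<lambda>z. ?f (fst z) * ?g (snd z)) \<in> borel_measurable (lborel \<Otimes>\<^sub>M lborel)"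
      by measurable
    have "(LINT y|lborel. norm (?f (fst (x, y)) * ?g (snd (x, y)))) = norm (?f x) * (LINT y|lborel. norm (?g y))" for x
      by (simp add: abs_mult)
    then show "integrable lborel (\<lambda>x. LINT y|lborel. norm (?f (fst (x, y)) * ?g (snd (x, y))))"
      using integrable_norm[OF i(1)] by simp
    show "AE x in lborel. integrable lborel (\<lambda>y. ?f (fst (x, y)) * ?g (snd (x, y)))"
      using i(2) by simp
  qed
  then show *: "set_integrable lborel (D \<times> I) (\<lambda>z. f (fst z) * g (snd z))"
    unfolding set_integrable_def lborel_prod by (simp add: indicator_times mult.assoc mult.left_commute)
  show "(LINT z:D \<times> I|lborel. f (fst z) * g (snd z)) = (LINT x:D|lborel. f x) * (LINT y:I|lborel. g y)"
    by (subst set_integral_Times_fst[OF *]) simp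
qed

lemma locally_integrableI_components:
  assumes "\<And>b. b \<in> Basis \<Longrightarrow> locally_integrable D (\<lambda>x. g x \<bullet> b)"
  shows "locally_integrable D g"
  unfolding locally_integrable_def set_integrable_def
proof (intro allI impI)
  fix K assume K: "compact K \<and> K \<subseteq> D"
  have "integrable lborel (\<lambda>x. \<Sum>b\<in>Basis. (indicator K x *\<^sub>R (g x \<bullet> b)) *\<^sub>R b)"
    using assms K by (intro Bochner_Integration.integrable_sum integrable_scaleR_left)
      (simp add: locally_integrable_def set_integrable_def)
  also have "(\<lambda>x. \<Sum>b\<in>Basis. (indicator K x *\<^sub>R (g x \<bullet> b)) *\<^sub>R b) = (\<lambda>x. indicator K x *\<^sub>R g x)"
    unfolding real_scaleR_def scaleR_scaleR[symmetric] scaleR_sum_right[symmetric]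
    by (simp add: euclidean_representation)
  finally show "integrable lborel (\<lambda>x. indicator K x *\<^sub>R g x)" .
qed

text \<open>A compact subset of the product is contained in the product of its two projections,
  which are compact subsets of the factors.\<close>

lemma locally_integrable_tensor:
  fixes f :: "'a::euclidean_space \<Rightarrow> real" and g :: "'b::euclidean_space \<Rightarrow> real"
  assumes "locally_integrable D f" "locally_integrable I g"
  shows "locally_integrable (D \<times> I) (\<lambda>z. f (fst z) * g (snd z))"
  unfolding locally_integrable_def
proof (intro allI impI)
  fix K :: "('a \<times> 'b) set" assume K: "compact K \<and> K \<subseteq> D \<times> I"
  have "compact (fst ` K)" "compact (snd ` K)"
    using K by (auto intro!: compact_continuous_image continuous_intros)
  moreover have "fst ` K \<subseteq> D" "snd ` K \<subseteq> I" using K by auto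
  ultimately have "set_integrable lborel (fst ` K \<times> snd ` K) (\<lambda>z. f (fst z) * g (snd z))"
    using assms by (intro set_integrable_tensor(1)) (auto simp: locally_integrable_def)
  then show "set_integrable lborel K (\<lambda>z. f (fst z) * g (snd z))"
    by (rule set_integrable_subset) (use K in \<open>auto simp: compact_borel intro: rev_image_eqI\<close>)
qed

lemma cont_diff_slice:
  fixes \<phi> :: "'a::euclidean_space \<times> 'b::euclidean_space \<Rightarrow> real"
  shows "cont_diff k \<phi> \<Longrightarrow> cont_diff k (\<lambda>x. \<phi> (x, y))" "cont_diff k \<phi> \<Longrightarrow> cont_diff k (\<lambda>y. \<phi> (x, y))"
proof (induction k arbitrary: \<phi>)
  case 0
  {
    case 1
    then show ?case by (auto intro!: continuous_intros continuous_on_compose2[of UNIV \<phi>])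
  next
    case 2
    then show ?case by (auto intro!: continuous_intros continuous_on_compose2[of UNIV \<phi>])
  }
next
  case (Suc k)
  {
    case 1
    show ?case
    proof (rule cont_diff_SucI)
      show "((\<lambda>x. \<phi> (x, y)) has_derivative (\<lambda>h. frechet_derivative \<phi> (at (x, y)) (h, 0))) (at x)" for x
        by (rule has_derivative_compose[OF _ cont_diff_SucD[OF 1]]) (auto intro!: derivative_eq_intros)
      show "cont_diff k (\<lambda>x. frechet_derivative \<phi> (at (x, y)) (b, 0))" if "b \<in> Basis" for b
        using Suc(1)[of "\<lambda>z. frechet_derivative \<phi> (at z) (b, 0)"] 1 that by (simp add: Basis_prod_def)
    qed
  next
    case 2
    show ?case
    proof (rule cont_diff_SucI)
      show "((\<lambda>y. \<phi> (x, y)) has_derivative (\<lambda>h. frechet_derivative \<phi> (at (x, y)) (0, h))) (at y)" for y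
        by (rule has_derivative_compose[OF _ cont_diff_SucD[OF 2]]) (auto intro!: derivative_eq_intros)
      show "cont_diff k (\<lambda>y. frechet_derivative \<phi> (at (x, y)) (0, b))" if "b \<in> Basis" for b
        using Suc(2)[of "\<lambda>z. frechet_derivative \<phi> (at z) (0, b)"] 2 that by (simp add: Basis_prod_def)
    qed
  }
qed

text \<open>The projections of the support are compact. With the other variable frozen, a test
  function thus becomes admissible in the weak formulation of a single factor.\<close>

lemma test_function_slice:
  fixes \<phi> :: "'a::euclidean_space \<times> 'b::euclidean_space \<Rightarrow> real"
  assumes \<phi>: "\<phi> \<in> test_functions (D \<times> I)"
  shows "(\<lambda>x. \<phi> (x, y)) \<in> test_functions D" "(\<lambda>y. \<phi> (x, y)) \<in> test_functions I"
proof -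
  obtain K where K: "compact K" "K \<subseteq> D \<times> I" "\<And>z. z \<notin> K \<Longrightarrow> \<phi> z = 0"
    using \<phi> by (auto simp: test_functions_def)
  have c: "cont_diff k \<phi>" for k
    using \<phi> by (simp add: test_functions_def del: cont_diff.simps)
  have "compact (fst ` K)" "compact (snd ` K)"
    using K by (auto intro!: compact_continuous_image continuous_intros)
  moreover have "fst ` K \<subseteq> D" "snd ` K \<subseteq> I" using K by auto
  moreover have "\<phi> (x, y) = 0" if "x \<notin> fst ` K" for x y
    using that K(3)[of "(x, y)"] by (force intro: rev_image_eqI)
  moreover have "\<phi> (x, y) = 0" if "y \<notin> snd ` K" for x y
    using that K(3)[of "(x, y)"] by (force intro: rev_image_eqI)
  ultimately have "\<exists>K. compact K \<and> K \<subseteq> D \<and> (\<forall>x. x \<notin> K \<longrightarrow> \<phi> (x, y) = 0)"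
    "\<exists>K. compact K \<and> K \<subseteq> I \<and> (\<forall>y. y \<notin> K \<longrightarrow> \<phi> (x, y) = 0)"
    by meson+
  then show "(\<lambda>x. \<phi> (x, y)) \<in> test_functions D" "(\<lambda>y. \<phi> (x, y)) \<in> test_functions I"
    using cont_diff_slice[OF c] by (simp_all add: test_functions_def del: cont_diff.simps)
qed

lemma frechet_derivative_slice:
  fixes \<phi> :: "'a::euclidean_space \<times> 'b::euclidean_space \<Rightarrow> real"
  assumes \<phi>: "\<phi> \<in> test_functions D"
  shows "frechet_derivative \<phi> (at (x, y)) (a, 0) = frechet_derivative (\<lambda>x. \<phi> (x, y)) (at x) a"
    and "frechet_derivative \<phi> (at (x, y)) (0, b) = frechet_derivative (\<lambda>y. \<phi> (x, y)) (at y) b"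
proof -
  have "((\<lambda>x. \<phi> (x, y)) has_derivative (\<lambda>h. frechet_derivative \<phi> (at (x, y)) (h, 0))) (at x)"
    by (rule has_derivative_compose[OF _ test_function_has_derivative[OF \<phi>]]) (auto intro!: derivative_eq_intros)
  from frechet_derivative_at[OF this]
  show "frechet_derivative \<phi> (at (x, y)) (a, 0) = frechet_derivative (\<lambda>x. \<phi> (x, y)) (at x) a" by metis
  have "((\<lambda>y. \<phi> (x, y)) has_derivative (\<lambda>h. frechet_derivative \<phi> (at (x, y)) (0, h))) (at y)"
    by (rule has_derivative_compose[OF _ test_function_has_derivative[OF \<phi>]]) (auto intro!: derivative_eq_intros)
  from frechet_derivative_at[OF this]
  show "frechet_derivative \<phi> (at (x, y)) (0, b) = frechet_derivative (\<lambda>y. \<phi> (x, y)) (at y) b" by metis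
qed

text \<open>Each coordinate direction differentiates one factor only. Fubini puts that variable
  inside, where the other factor is a constant, and the sliced test function is inserted into the
  identity for the differentiated factor.\<close>

lemma has_weak_gradient_tensor:
  fixes V :: "'a::euclidean_space \<Rightarrow> real" and v :: "'b::euclidean_space \<Rightarrow> real"
  assumes V: "has_weak_gradient D V g" and v: "has_weak_gradient I v h"
  shows "has_weak_gradient (D \<times> I) (\<lambda>z. V (fst z) * v (snd z))
           (\<lambda>z. (v (snd z) *\<^sub>R g (fst z), V (fst z) *\<^sub>R h (snd z)))"
proof -
  let ?G = "\<lambda>z. (v (snd z) *\<^sub>R g (fst z), V (fst z) *\<^sub>R h (snd z))"
  have l: "locally_integrable D V" "locally_integrable D g" "locally_integrable I v" "locally_integrable I h"
    using V v by (auto simp: has_weak_gradient_altdef)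
  have lV: "locally_integrable (D \<times> I) (\<lambda>z. V (fst z) * v (snd z))"
    by (rule locally_integrable_tensor[OF l(1,3)])
  have lG: "locally_integrable (D \<times> I) ?G"
  proof (rule locally_integrableI_components)
    fix b :: "'a \<times> 'b" assume "b \<in> Basis"
    then consider a where "b = (a, 0)" | c where "b = (0, c)"
      by (auto simp: Basis_prod_def)
    then show "locally_integrable (D \<times> I) (\<lambda>z. ?G z \<bullet> b)"
    proof cases
      case 1
      then show ?thesis
        using locally_integrable_tensor[OF locally_integrable_component[OF l(2), of a] l(3)] by (simp add: mult.commute)
    next
      case 2
      then show ?thesis
        using locally_integrable_tensor[OF l(1) locally_integrable_component[OF l(4), of c]] by simp
    qed
  qed
  show ?thesis
    unfolding has_weak_gradient_altdef
  proof (intro conjI ballI lV lG)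
    fix \<phi> :: "'a \<times> 'b \<Rightarrow> real" and b :: "'a \<times> 'b"
    assume \<phi>: "\<phi> \<in> test_functions (D \<times> I)" and b: "b \<in> Basis"
    note i = locally_integrable_times_test[OF lV test_function_partial[OF \<phi> b]]
      locally_integrable_times_test[OF locally_integrable_component[OF lG] \<phi>, of b]
    consider a where "b = (a, 0)" "a \<in> Basis" | c where "b = (0, c)" "c \<in> Basis"
      using b by (auto simp: Basis_prod_def)
    then show "(LINT z:D \<times> I|lborel. V (fst z) * v (snd z) * frechet_derivative \<phi> (at z) b)
        = - (LINT z:D \<times> I|lborel. ?G z \<bullet> b * \<phi> z)"
    proof cases
      case 1
      have "(LINT z:D \<times> I|lborel. V (fst z) * v (snd z) * frechet_derivative \<phi> (at z) b)
          = (LINT y:I|lborel. v y * (LINT x:D|lborel. V x * frechet_derivative (\<lambda>x. \<phi> (x, y)) (at x) a))"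
        unfolding set_integral_Times_snd[OF i(1)] set_integral_mult_right[symmetric]
        by (simp add: 1 frechet_derivative_slice[OF \<phi>] mult_ac del: set_integral_mult_right)
      also have "\<dots> = (LINT y:I|lborel. - (v y * (LINT x:D|lborel. g x \<bullet> a * \<phi> (x, y))))"
        using V 1(2) test_function_slice(1)[OF \<phi>] by (simp add: has_weak_gradient_altdef)
      also have "\<dots> = - (LINT z:D \<times> I|lborel. ?G z \<bullet> b * \<phi> z)"
        unfolding set_integral_Times_snd[OF i(2)]
        by (simp add: 1 mult.assoc set_lebesgue_integral_def)
      finally show ?thesis .
    next
      case 2
      have "(LINT z:D \<times> I|lborel. V (fst z) * v (snd z) * frechet_derivative \<phi> (at z) b)
          = (LINT x:D|lborel. V x * (LINT y:I|lborel. v y * frechet_derivative (\<lambda>y. \<phi> (x, y)) (at y) c))"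
        unfolding set_integral_Times_fst[OF i(1)] set_integral_mult_right[symmetric]
        by (simp add: 2 frechet_derivative_slice[OF \<phi>] mult_ac del: set_integral_mult_right)
      also have "\<dots> = (LINT x:D|lborel. - (V x * (LINT y:I|lborel. h y \<bullet> c * \<phi> (x, y))))"
        using v 2(2) test_function_slice(2)[OF \<phi>] by (simp add: has_weak_gradient_altdef)
      also have "\<dots> = - (LINT z:D \<times> I|lborel. ?G z \<bullet> b * \<phi> z)"
        unfolding set_integral_Times_fst[OF i(2)]
        by (simp add: 2 mult.assoc set_lebesgue_integral_def)
      finally show ?thesis .
    qed
  qed
qed

section \<open>Splines on the half line\<close>

lemma spline_continuous_on_Ici:
  assumes "v \<in> spline_space Y M G r" "0 < Y"
  shows "continuous_on {0..} v"
proof -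
  have "continuous_on ({0..Y} \<union> {Y..}) v"
  proof (rule continuous_on_closed_Un)
    \<comment> \<open>The value 0 at Y glues to the extension by zero. At y = 0 that extension may
      jump, so continuity is claimed on \<open>{0..}\<close> only.\<close>
    have "v y = 0" if "y \<in> {Y..}" for y
      using assms that by (cases "y = Y") (auto simp: spline_space_def)
    then show "continuous_on {Y..} v"
      by (intro continuous_on_eq[OF continuous_on_const[of _ 0]]) simp
  qed (use assms in \<open>auto simp: spline_space_def\<close>)
  also have "{0..Y} \<union> {Y..} = {0..}" using assms by auto
  finally show ?thesis .
qed

lemma spline_borel:
  assumes "v \<in> spline_space Y M G r"
  shows "v \<in> borel_measurable borel"
proof -
  have "(\<lambda>y. indicator {0..Y} y *\<^sub>R v y) \<in> borel_measurable borel"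
    using assms by (intro borel_measurable_continuous_on_indicator) (auto simp: spline_space_def)
  also have "(\<lambda>y. indicator {0..Y} y *\<^sub>R v y) = v"
    using assms by (auto simp: spline_space_def indicator_def fun_eq_iff)
  finally show ?thesis .
qed

lemma spline_bounded:
  assumes "v \<in> spline_space Y M G r"
  obtains B where "0 \<le> B" "\<And>y. \<bar>v y\<bar> \<le> B"
proof -
  have "bounded (v ` {0..Y})"
    using assms by (intro compact_imp_bounded compact_continuous_image) (auto simp: spline_space_def)
  then obtain B where B: "\<And>y. y \<in> {0..Y} \<Longrightarrow> \<bar>v y\<bar> \<le> B"
    unfolding bounded_iff by (metis imageI real_norm_def)
  have "\<bar>v y\<bar> \<le> max B 0" for y
    using B[of y] assms by (cases "y \<in> {0..Y}") (auto simp: spline_space_def)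
  then show thesis using that by (meson max.cobounded2)
qed

lemma deriv_spline_beyond:
  assumes "v \<in> spline_space Y M G r" "Y < y"
  shows "(v has_real_derivative 0) (at y)" "deriv v y = 0"
proof -
  have "\<forall>\<^sub>F x in nhds y. v x = 0"
    using assms by (intro eventually_nhds_in_open[of "{Y<..}" y, THEN eventually_mono])
      (auto simp: spline_space_def)
  then show "(v has_real_derivative 0) (at y)"
    by (subst DERIV_cong_ev[where g="\<lambda>_. 0"]) auto
  then show "deriv v y = 0" by (rule DERIV_imp_deriv)
qed

lemma spline_deriv:
  assumes v: "v \<in> spline_space Y M G r" and mesh: "mesh_1d Y M G" and Y: "0 < Y"
  obtains X B where "finite X" "\<And>y. 0 < y \<Longrightarrow> y \<notin> X \<Longrightarrow> (v has_real_derivative deriv v y) (at y)"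
    "\<And>y. 0 < y \<Longrightarrow> \<bar>deriv v y\<bar> \<le> B" "0 \<le> B"
proof -
  have "\<exists>p. \<forall>y\<in>{G (m - 1)..G m}. v y = poly p y" if "m \<in> {1..M}" for m
    using v that unfolding spline_space_def by blast
  then obtain p where p: "\<And>m y. m \<in> {1..M} \<Longrightarrow> y \<in> {G (m - 1)..G m} \<Longrightarrow> v y = poly (p m) y"
    by metis
  have "bounded (poly (pderiv (p m)) ` {G (m - 1)..G m})" for m
    by (intro compact_imp_bounded compact_continuous_image continuous_intros) auto
  then have "\<exists>B. \<forall>y\<in>{G (m - 1)..G m}. \<bar>poly (pderiv (p m)) y\<bar> \<le> B" for m
    by (auto simp: bounded_iff)
  then obtain b where b: "\<And>m y. y \<in> {G (m - 1)..G m} \<Longrightarrow> \<bar>poly (pderiv (p m)) y\<bar> \<le> b m"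
    by metis
  define X where "X = G ` {0..M}"
  \<comment> \<open>The first sum bounds the derivative inside the mesh intervals. The second adds
    the value of \<open>deriv v\<close> at every mesh point, where it may be an arbitrary default,
    so that the bound holds for all y > 0.\<close>
  define B where "B = (\<Sum>m\<in>{1..M}. \<bar>b m\<bar>) + (\<Sum>y\<in>X. \<bar>deriv v y\<bar>)"
  have X: "finite X" by (simp add: X_def)
  have d: "(v has_real_derivative deriv v y) (at y) \<and> \<bar>deriv v y\<bar> \<le> B" if y: "0 < y" "y \<notin> X" for y
  proof (cases "y < Y")
    case True
    \<comment> \<open>\<open>m\<close> numbers the mesh interval around y:
      \<open>G (m - 1) < y\<close> follows from minimality and because y is no mesh point, and m > 0
      because G 0 = 0 < y.\<close>
    define m where "m = (LEAST m. y < G m)"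
    have GM: "y < G M" using True mesh by (simp add: mesh_1d_def)
    have ym: "y < G m" unfolding m_def using GM by (rule LeastI)
    have mM: "m \<le> M" unfolding m_def using GM by (rule Least_le)
    have m0: "m \<noteq> 0" using ym y mesh by (auto simp: mesh_1d_def intro: gr0I)
    have "\<not> y < G (m - 1)"
      using not_less_Least[of "m - 1" "\<lambda>m. y < G m"] m0 by (simp add: m_def)
    moreover have "y \<noteq> G (m - 1)" using y(2) mM by (auto simp: X_def)
    ultimately have ym': "G (m - 1) < y" by simp
    have m: "m \<in> {1..M}" using m0 mM by auto
    have "\<forall>\<^sub>F x in nhds y. v x = poly (p m) x"
      using ym ym' m by (intro eventually_nhds_in_open[of "{G (m - 1)<..<G m}" y, THEN eventually_mono])
        (auto intro!: p)
    then have D: "(v has_real_derivative poly (pderiv (p m)) y) (at y)"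
      by (subst DERIV_cong_ev[where g="poly (p m)"]) (auto intro: poly_DERIV)
    have "\<bar>poly (pderiv (p m)) y\<bar> \<le> \<bar>b m\<bar>"
      using b[of y m] ym ym' by auto
    also have "\<dots> \<le> (\<Sum>m\<in>{1..M}. \<bar>b m\<bar>)"
      using member_le_sum[OF m, of "\<lambda>m. \<bar>b m\<bar>"] by simp
    also have "\<dots> \<le> B"
      by (simp add: B_def sum_nonneg)
    finally show ?thesis using D DERIV_imp_deriv[OF D] by simp
  next
    case False
    moreover have "Y \<in> X" using mesh by (auto simp: X_def mesh_1d_def)
    ultimately have "Y < y" using y(2) by (metis not_less_iff_gr_or_eq)
    then show ?thesis
      using deriv_spline_beyond[OF v] by (auto simp: B_def intro!: add_nonneg_nonneg sum_nonneg)
  qed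
  have "\<bar>deriv v y\<bar> \<le> B" if "0 < y" for y
  proof (cases "y \<in> X")
    case True
    have "\<bar>deriv v y\<bar> \<le> (\<Sum>y\<in>X. \<bar>deriv v y\<bar>)"
      using member_le_sum[OF True, of "\<lambda>y. \<bar>deriv v y\<bar>"] X by simp
    also have "\<dots> \<le> B"
      by (simp add: B_def sum_nonneg)
    finally show ?thesis .
  qed (use d that in auto)
  moreover have "0 \<le> B" by (auto simp: B_def intro!: add_nonneg_nonneg sum_nonneg)
  ultimately show thesis using that X d by blast
qed

text \<open>Off the mesh points the derivative is a pointwise limit of difference quotients of the
  Borel function \<open>v\<close>; changing the values at finitely many points preserves
  measurability.\<close>

lemma deriv_spline_measurable:
  assumes v: "v \<in> spline_space Y M G r" and mesh: "mesh_1d Y M G" and Y: "0 < Y"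
  shows "(\<lambda>y. indicator {0<..} y * deriv v y) \<in> borel_measurable borel"
proof -
  note [measurable] = spline_borel[OF v]
  obtain X where X: "finite X" "\<And>y. 0 < y \<Longrightarrow> y \<notin> X \<Longrightarrow> (v has_real_derivative deriv v y) (at y)"
    using spline_deriv[OF assms] by metis
  have [measurable]: "X \<in> sets borel" using X(1) by (simp add: borel_closed finite_imp_closed)
  define t where "t n = inverse (real (Suc n))" for n
  have t: "filterlim t (at 0) sequentially"
    unfolding t_def using LIMSEQ_inverse_real_of_nat by (simp add: filterlim_at)
  have "(\<lambda>y. if 0 < y \<and> y \<notin> X then deriv v y else 0) \<in> borel_measurable borel"
  proof (rule borel_measurable_LIMSEQ_real)
    fix y :: real
    show "(\<lambda>n. if 0 < y \<and> y \<notin> X then (v (y + t n) - v y) / t n else 0)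
        \<longlonglongrightarrow> (if 0 < y \<and> y \<notin> X then deriv v y else 0)"
      using X(2)[of y] filterlim_compose[OF _ t] by (auto simp: DERIV_def)
  qed measurable
  then show ?thesis
    by (rule measurable_discrete_difference[where X=X])
      (use X(1) in \<open>auto intro: countable_finite simp: indicator_def\<close>)
qed

lemma set_integrable_bounded_compact:
  fixes f :: "'a::euclidean_space \<Rightarrow> real"
  assumes "compact K" "set_borel_measurable lborel K f" "\<And>x. x \<in> K \<Longrightarrow> \<bar>f x\<bar> \<le> B"
  shows "set_integrable lborel K f"
proof (rule set_integrable_bound)
  show "set_integrable lborel K (\<lambda>_. B)"
    using emeasure_bounded_finite[OF compact_imp_bounded[OF assms(1)]] assms(1)
    by (auto simp: set_integrable_def compact_borel intro!: integrable_mult_left integrable_real_indicator)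
qed (use assms in force)+

text \<open>A spline has no jumps on the half line, so its classical derivative off the mesh points
  is also the weak one. The fundamental theorem of calculus with a finite exceptional set is applied
  to \<open>v * \<phi>\<close>, which vanishes at both ends of \<open>{0..T}\<close>.\<close>

lemma has_weak_gradient_spline:
  assumes v: "v \<in> spline_space Y M G r" and mesh: "mesh_1d Y M G" and Y: "0 < Y"
  shows "has_weak_gradient {0<..} v (deriv v)"
proof -
  note [measurable] = spline_borel[OF v] deriv_spline_measurable[OF assms]
  obtain X B where X: "finite X" "\<And>y. 0 < y \<Longrightarrow> y \<notin> X \<Longrightarrow> (v has_real_derivative deriv v y) (at y)"
    and B: "\<And>y. 0 < y \<Longrightarrow> \<bar>deriv v y\<bar> \<le> B"
    using spline_deriv[OF assms] by metis
  obtain C where C: "\<And>y. \<bar>v y\<bar> \<le> C" using spline_bounded[OF v] by metis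
  have lv: "locally_integrable {0<..} v"
    unfolding locally_integrable_def
  proof (intro allI impI)
    fix K :: "real set" assume K: "compact K \<and> K \<subseteq> {0<..}"
    then have [measurable]: "K \<in> sets borel" by (simp add: compact_borel)
    show "set_integrable lborel K v"
      using K C by (intro set_integrable_bounded_compact[where B=C]) (auto simp: set_borel_measurable_def)
  qed
  have ld: "locally_integrable {0<..} (deriv v)"
    unfolding locally_integrable_def
  proof (intro allI impI)
    fix K :: "real set" assume K: "compact K \<and> K \<subseteq> {0<..}"
    then have [measurable]: "K \<in> sets borel" by (simp add: compact_borel)
    have "(\<lambda>y. indicator K y * (indicator {0<..} y * deriv v y)) \<in> borel_measurable borel"
      by measurable
    also have "(\<lambda>y. indicator K y * (indicator {0<..} y * deriv v y)) = (\<lambda>y. indicator K y * deriv v y)"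
      using K by (intro ext) (auto simp: indicator_def)
    finally show "set_integrable lborel K (deriv v)"
      using K B by (intro set_integrable_bounded_compact[where B=B]) (auto simp: set_borel_measurable_def)
  qed
  show ?thesis
    unfolding has_weak_gradient_altdef
  proof (intro conjI ballI lv ld)
    fix \<phi> :: "real \<Rightarrow> real" and b :: real
    assume \<phi>: "\<phi> \<in> test_functions {0<..}" and "b \<in> Basis"
    then have b: "b = 1" by simp
    let ?d = "\<lambda>y. frechet_derivative \<phi> (at y) 1"
    have \<phi>': "?d \<in> test_functions {0<..}"
      by (rule test_function_partial[OF \<phi>]) simp
    obtain K where K: "compact K" "K \<subseteq> {0<..}" "\<And>y. y \<notin> K \<Longrightarrow> \<phi> y = 0"
      using test_functionE[OF \<phi>] by metis
    obtain K' where K': "compact K'" "K' \<subseteq> {0<..}" "\<And>y. y \<notin> K' \<Longrightarrow> ?d y = 0"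
      using test_functionE[OF \<phi>'] by metis
    obtain R where R: "\<And>y. y \<in> K \<union> K' \<Longrightarrow> \<bar>y\<bar> \<le> R"
      using compact_imp_bounded[OF compact_Un[OF K(1) K'(1)]] unfolding bounded_iff by auto
    \<comment> \<open>T lies beyond the supports of \<phi> and of its derivative; the absolute value
      makes it positive even if both are empty.\<close>
    define T where "T = \<bar>R\<bar> + 1"
    have "T \<notin> K"
    proof
      assume "T \<in> K"
      then have "\<bar>T\<bar> \<le> R" using R by blast
      then show False unfolding T_def by linarith
    qed
    moreover have "0 \<notin> K" using K(2) by blast
    ultimately
    have T: "0 < T" "\<phi> 0 = 0" "\<phi> T = 0"
      using K(3) by (auto simp: T_def)
    have D: "(\<phi> has_real_derivative ?d y) (at y)" for y
    proof -
      have "frechet_derivative \<phi> (at y) h = ?d y * h" for h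
        using linear_scale[OF linear_frechet_derivative, of \<phi> "at y" h 1]
          test_function_has_derivative[OF \<phi>] by (auto simp: differentiable_def mult.commute)
      then have eq: "frechet_derivative \<phi> (at y) = (*) (?d y)"
        by (intro ext)
      show ?thesis
        using test_function_has_derivative[OF \<phi>, of y] unfolding has_field_derivative_def
        by (subst (asm) eq)
    qed
    have hi: "((\<lambda>y. v y * ?d y + deriv v y * \<phi> y) has_integral (v T * \<phi> T - v 0 * \<phi> 0)) {0..T}"
    proof (rule fundamental_theorem_of_calculus_interior_strong[OF X(1)])
      show "continuous_on {0..T} (\<lambda>y. v y * \<phi> y)"
        by (intro continuous_intros continuous_on_subset[OF spline_continuous_on_Ici[OF v Y]]
            DERIV_continuous_on[OF DERIV_subset[OF D]]) auto
      show "((\<lambda>y. v y * \<phi> y) has_vector_derivative v y * ?d y + deriv v y * \<phi> y) (at y)"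
        if "y \<in> {0<..<T} - X" for y
        using that X(2)[of y] D[of y] unfolding has_real_derivative_iff_has_vector_derivative[symmetric]
        by (auto intro!: derivative_eq_intros)
    qed (use T in auto)
    have i: "set_integrable lborel {0<..} (\<lambda>y. v y * ?d y)" "set_integrable lborel {0<..} (\<lambda>y. deriv v y * \<phi> y)"
      by (rule locally_integrable_times_test[OF lv \<phi>'], rule locally_integrable_times_test[OF ld \<phi>])
    have i': "set_integrable lborel {0<..T} (\<lambda>y. v y * ?d y + deriv v y * \<phi> y)"
      by (rule set_integrable_subset[OF set_integral_add(1)[OF i]]) auto
    have "(LINT y:{0<..}|lborel. v y * ?d y) + (LINT y:{0<..}|lborel. deriv v y * \<phi> y)
        = (LINT y:{0<..}|lborel. v y * ?d y + deriv v y * \<phi> y)"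
      using set_integral_add(2)[OF i] by simp
    also have "\<dots> = (LINT y:{0<..T}|lborel. v y * ?d y + deriv v y * \<phi> y)"
    proof -
      have "\<phi> y = 0 \<and> ?d y = 0" if "T < y" for y
        using K(3)[of y] K'(3)[of y] R[of y] that by (cases "y \<in> K \<union> K'") (auto simp: T_def)
      then show ?thesis
        unfolding set_lebesgue_integral_def
        by (intro Bochner_Integration.integral_cong) (auto simp: indicator_def)
    qed
    also have "\<dots> = integral {0<..T} (\<lambda>y. v y * ?d y + deriv v y * \<phi> y)"
      by (rule set_borel_integral_eq_integral(2)[OF i'])
    also have "\<dots> = integral {0..T} (\<lambda>y. v y * ?d y + deriv v y * \<phi> y)"
      by (rule integral_spike_set; rule negligible_subset[of "{0}"]) auto
    also have "\<dots> = 0"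
      using integral_unique[OF hi] T by simp
    finally show "(LINT y:{0<..}|lborel. v y * frechet_derivative \<phi> (at y) b)
        = - (LINT y:{0<..}|lborel. deriv v y \<bullet> b * \<phi> y)"
      using b by simp
  qed
qed

section \<open>Traces of tensor products\<close>

lemma L2_borel: "u \<in> L2 D \<Longrightarrow> (\<lambda>x. indicator D x *\<^sub>R u x) \<in> borel_measurable borel"
  by (simp add: L2_iff)

lemma set_integrable_const_interval: "set_integrable lborel {0<..<h::real} (\<lambda>_. c::real)"
proof (rule set_integrable_subset)
  show "set_integrable lborel {0..h} (\<lambda>_. c)"
    by (rule set_integrable_bounded_compact[where B="\<bar>c\<bar>"]) (auto simp: set_borel_measurable_def)
qed auto

lemma L2_times_integrable:
  fixes u w :: "'a::euclidean_space \<Rightarrow> real"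
  assumes "u \<in> L2 D" "w \<in> L2 D"
  shows "set_integrable lborel D (\<lambda>x. u x * w x)"
proof -
  note [measurable] = L2_borel[OF assms(1)] L2_borel[OF assms(2)]
  let ?u = "\<lambda>x. indicator D x *\<^sub>R u x" and ?w = "\<lambda>x. indicator D x *\<^sub>R w x"
  have "integrable lborel (\<lambda>x. ?u x * ?w x)"
  proof (rule Bochner_Integration.integrable_bound)
    show "integrable lborel (\<lambda>x. (norm (?u x))\<^sup>2 + (norm (?w x))\<^sup>2)"
      using assms by (intro Bochner_Integration.integrable_add) (auto simp: L2_iff)
    show "AE x in lborel. norm (?u x * ?w x) \<le> norm ((norm (?u x))\<^sup>2 + (norm (?w x))\<^sup>2)"
    proof (rule AE_I2)
      have "\<bar>a * b\<bar> \<le> \<bar>\<bar>a\<bar>\<^sup>2 + \<bar>b\<bar>\<^sup>2\<bar>" for a b :: real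
        using sum_squares_bound[of "\<bar>a\<bar>" "\<bar>b\<bar>"] mult_nonneg_nonneg[of "\<bar>a\<bar>" "\<bar>b\<bar>"]
        by (simp only: abs_mult abs_of_nonneg[OF sum_power2_ge_zero]) linarith
      then show "norm (?u x * ?w x) \<le> norm ((norm (?u x))\<^sup>2 + (norm (?w x))\<^sup>2)" for x
        by (simp only: real_norm_def)
    qed
  qed measurable
  moreover have "(\<lambda>x. ?u x * ?w x) = (\<lambda>x. indicator D x *\<^sub>R (u x * w x))"
    by (intro ext) (simp add: indicator_def)
  ultimately show ?thesis
    by (simp only: set_integrable_def)
qed

lemma set_integral_zero_AE:
  fixes f :: "'a::euclidean_space \<Rightarrow> real"
  assumes "set_integrable lborel D f" "\<And>x. 0 \<le> f x" "(LINT x:D|lborel. f x) \<le> 0"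
  shows "AE x in lborel. x \<in> D \<longrightarrow> f x = 0"
proof -
  have "0 \<le> (LINT x:D|lborel. f x)"
    unfolding set_lebesgue_integral_def by (rule integral_nonneg_AE) (simp add: assms(2))
  then have "(LINT x|lborel. indicator D x *\<^sub>R f x) = 0"
    using assms(3) by (simp add: set_lebesgue_integral_def)
  then have "AE x in lborel. indicator D x *\<^sub>R f x = 0"
    using assms(1,2) by (subst (asm) integral_nonneg_eq_0_iff_AE) (auto simp: set_integrable_def)
  then show ?thesis by (rule eventually_mono) (auto simp: indicator_def)
qed

text \<open>By Fubini, h times the squared L2 distance of the two traces is an integral over the
  slab of height h, and it is at most twice the sum of both slab errors. Dividing by h and letting h
  tend to 0 leaves distance zero.\<close>

lemma has_trace_unique:
  assumes "open \<Omega>" and g: "has_trace \<Omega> w g" and k: "has_trace \<Omega> w k"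
  shows "AE x in lborel. x \<in> \<Omega> \<longrightarrow> g x = k x"
proof -
  have L: "(\<lambda>x. g x - k x) \<in> L2 \<Omega>"
    using L2_lincomb[of g \<Omega> k 1 "-1"] g k by (simp add: has_trace_def)
  have i: "set_integrable lborel \<Omega> (\<lambda>x. (g x - k x)\<^sup>2)"
    using L2_times_integrable[OF L L] by (simp add: power2_eq_square)
  let ?J = "LINT x:\<Omega>|lborel. (g x - k x)\<^sup>2"
  let ?a = "\<lambda>g h. (LINT z:\<Omega> \<times> {0<..<h}|lborel. (w z - g (fst z))\<^sup>2)"
  have "\<forall>\<^sub>F h in at_right 0. 0 < h \<and> set_integrable lborel (\<Omega> \<times> {0<..<h}) (\<lambda>z. (w z - g (fst z))\<^sup>2)
      \<and> set_integrable lborel (\<Omega> \<times> {0<..<h}) (\<lambda>z. (w z - k (fst z))\<^sup>2)"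
    using g k unfolding has_trace_def by (auto intro!: eventually_conj eventually_at_right_less)
  then have "\<forall>\<^sub>F h in at_right 0. ?J \<le> 2 * (?a g h / h) + 2 * (?a k h / h)"
  proof (rule eventually_mono)
    fix h :: real
    assume h: "0 < h \<and> set_integrable lborel (\<Omega> \<times> {0<..<h}) (\<lambda>z. (w z - g (fst z))\<^sup>2)
      \<and> set_integrable lborel (\<Omega> \<times> {0<..<h}) (\<lambda>z. (w z - k (fst z))\<^sup>2)"
    note T = set_integrable_tensor[OF i set_integrable_const_interval[of h 1]]
    have "h * ?J = (LINT z:\<Omega> \<times> {0<..<h}|lborel. (g (fst z) - k (fst z))\<^sup>2)"
      using T(2) h by (simp add: set_lebesgue_integral_def)
    also have "\<dots> \<le> (LINT z:\<Omega> \<times> {0<..<h}|lborel. 2 * (w z - g (fst z))\<^sup>2 + 2 * (w z - k (fst z))\<^sup>2)"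
    proof (rule set_integral_mono)
      show "(g (fst z) - k (fst z))\<^sup>2 \<le> 2 * (w z - g (fst z))\<^sup>2 + 2 * (w z - k (fst z))\<^sup>2" for z
        using norm_lincomb_sq_le[of "- 1" "w z - g (fst z)" 1 "w z - k (fst z)"] by simp
    qed (use T(1) h in \<open>auto intro!: set_integral_add\<close>)
    also have "\<dots> = 2 * ?a g h + 2 * ?a k h"
      using h by (subst set_integral_add) auto
    finally show "?J \<le> 2 * (?a g h / h) + 2 * (?a k h / h)"
      using h by (simp add: field_simps)
  qed
  moreover have "((\<lambda>h. 2 * (?a g h / h) + 2 * (?a k h / h)) \<longlongrightarrow> 2 * 0 + 2 * 0) (at_right 0)"
    using g k unfolding has_trace_def by (intro tendsto_intros) auto
  ultimately have "?J \<le> 2 * 0 + 2 * 0"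
    by (intro tendsto_lowerbound) auto
  then have "AE x in lborel. x \<in> \<Omega> \<longrightarrow> (g x - k x)\<^sup>2 = 0"
    by (intro set_integral_zero_AE[OF i]) auto
  then show ?thesis by (rule eventually_mono) auto
qed

text \<open>The slab error divided by h factors into the squared L2 norm of \<open>V\<close> and the
  mean of (v y - v 0)^2 over (0,h). The mean tends to 0 by right continuity of \<open>v\<close> at
  0.\<close>

lemma has_trace_tensor:
  assumes V: "V \<in> L2 \<Omega>" and v: "v \<in> borel_measurable borel" "\<And>y. \<bar>v y\<bar> \<le> B" "continuous_on {0..} v"
  shows "has_trace \<Omega> (\<lambda>z. V (fst z) * v (snd z)) (\<lambda>x. v 0 * V x)"
proof -
  note [measurable] = v(1)
  have i: "set_integrable lborel \<Omega> (\<lambda>x. (V x)\<^sup>2)"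
    using L2_times_integrable[OF V V] by (simp add: power2_eq_square)
  have b: "(v y - v 0)\<^sup>2 \<le> (2 * B)\<^sup>2" for y
  proof -
    have "\<bar>v y - v 0\<bar> \<le> 2 * B" using v(2)[of y] v(2)[of 0] by linarith
    then show ?thesis using power_mono[of "\<bar>v y - v 0\<bar>" "2 * B" 2] by simp
  qed
  note one = set_integrable_const_interval
  have iv: "set_integrable lborel {0<..<h} (\<lambda>y. (v y - v 0)\<^sup>2)" for h
    by (rule set_integrable_bound[OF one[of h "(2 * B)\<^sup>2"]]) (use b in \<open>auto simp: set_borel_measurable_def\<close>)
  have sq: "(V (fst z) * v (snd z) - v 0 * V (fst z))\<^sup>2 = (V (fst z))\<^sup>2 * (v (snd z) - v 0)\<^sup>2" for z
    by (simp add: power2_eq_square algebra_simps)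
  let ?J = "LINT x:\<Omega>|lborel. (V x)\<^sup>2"
  have J: "0 \<le> ?J" unfolding set_lebesgue_integral_def by (rule integral_nonneg_AE) simp
  let ?k = "\<lambda>h. (LINT y:{0<..<h}|lborel. (v y - v 0)\<^sup>2) / h"
  have "(?k \<longlongrightarrow> 0) (at_right 0)"
  proof (rule tendstoI)
    fix e :: real assume e: "0 < e"
    have "(v \<longlongrightarrow> v 0) (at 0 within {0..})"
      using v(3) by (auto simp: continuous_on_def)
    then have "((\<lambda>y. (v y - v 0)\<^sup>2) \<longlongrightarrow> (v 0 - v 0)\<^sup>2) (at 0 within {0..})"
      by (intro tendsto_intros)
    then have "\<forall>\<^sub>F y in at 0 within {0..}. (v y - v 0)\<^sup>2 < e / 2"
      by (rule order_tendstoD(2)) (use e in simp)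
    then obtain d where d: "0 < d" "\<And>y. 0 < y \<Longrightarrow> y < d \<Longrightarrow> (v y - v 0)\<^sup>2 < e / 2"
      by (auto simp: eventually_at dist_real_def)
    show "\<forall>\<^sub>F h in at_right 0. dist (?k h) 0 < e"
      unfolding eventually_at_right_field
    proof (intro exI[of _ d] conjI allI impI d(1))
      fix h assume h: "0 < h" "h < d"
      have "(LINT y:{0<..<h}|lborel. (v y - v 0)\<^sup>2) \<le> (LINT y:{0<..<h}|lborel. e / 2)"
        by (rule set_integral_mono[OF iv one]) (use d(2) h in \<open>auto intro: less_imp_le\<close>)
      also have "\<dots> = h * (e / 2)"
        using h by (simp add: set_lebesgue_integral_def)
      finally have "?k h \<le> e / 2"
        using h by (simp add: divide_le_eq mult.commute)
      moreover have "0 \<le> (LINT y:{0<..<h}|lborel. (v y - v 0)\<^sup>2)"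
        unfolding set_lebesgue_integral_def by (rule integral_nonneg_AE) simp
      then have "0 \<le> ?k h"
        using h by simp
      ultimately show "dist (?k h) 0 < e"
        using e unfolding dist_real_def by linarith
    qed
  qed
  then have "((\<lambda>h. ?J * ?k h) \<longlongrightarrow> ?J * 0) (at_right 0)"
    by (intro tendsto_intros)
  then show ?thesis
    unfolding has_trace_def sq set_integrable_tensor(2)[OF i iv]
    using L2_lincomb[OF V V, of "v 0" 0] set_integrable_tensor(1)[OF i iv] by auto
qed

text \<open>\<open>tr\<close> is a choice, but the pairing sees its argument only through L2
  products with the \<open>\<phi> k\<close>, which ignore null sets.\<close>

lemma dual_pairing_tr_tensor:
  assumes "open \<Omega>" and V: "V \<in> L2 \<Omega>" and v: "v \<in> borel_measurable borel" "\<And>y. \<bar>v y\<bar> \<le> B" "continuous_on {0..} v"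
    and \<phi>: "\<And>k. \<phi> k \<in> L2 \<Omega>"
  shows "dual_pairing \<Omega> \<phi> f (tr \<Omega> (\<lambda>z. V (fst z) * v (snd z))) = dual_pairing \<Omega> \<phi> f (\<lambda>x. v 0 * V x)"
proof -
  let ?w = "\<lambda>z. V (fst z) * v (snd z)"
  have h: "has_trace \<Omega> ?w (\<lambda>x. v 0 * V x)"
    by (rule has_trace_tensor[OF V v])
  then have t: "has_trace \<Omega> ?w (tr \<Omega> ?w)"
    unfolding tr_def by (rule someI[of "has_trace \<Omega> ?w"])
  have "L2_inner \<Omega> (tr \<Omega> ?w) (\<phi> k) = L2_inner \<Omega> (\<lambda>x. v 0 * V x) (\<phi> k)" for k
  proof -
    have "set_integrable lborel \<Omega> (\<lambda>x. tr \<Omega> ?w x * \<phi> k x)" "set_integrable lborel \<Omega> (\<lambda>x. v 0 * V x * \<phi> k x)"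
      using h t \<phi> by (auto intro!: L2_times_integrable simp: has_trace_def)
    then show ?thesis
      unfolding L2_inner_def set_lebesgue_integral_def set_integrable_def
      by (intro integral_cong_AE borel_measurable_integrable
          eventually_mono[OF has_trace_unique[OF assms(1) t h]]) auto
  qed
  then show ?thesis by (simp add: dual_pairing_def)
qed

section \<open>The bilinear forms\<close>

lemma bounded_bilinear_matrix_vector_mult:
  "bounded_bilinear ((*v) :: real^'n^'m \<Rightarrow> real^'n \<Rightarrow> real^'m)"
proof -
  have "bilinear ((*v) :: real^'n^'m \<Rightarrow> real^'n \<Rightarrow> real^'m)"
    unfolding bilinear_def
    by (auto intro!: linearI simp: matrix_vector_right_distrib matrix_vector_mult_add_rdistrib
        vec_eq_iff matrix_vector_mult_def sum_distrib_left sum.distrib distrib_left mult_ac)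
  then show ?thesis by (simp add: bilinear_conv_bounded_bilinear)
qed

lemma borel_measurable_matrix_vector_mult [measurable (raw)]:
  fixes f :: "'a \<Rightarrow> real^'n^'m"
  assumes "f \<in> borel_measurable M" "g \<in> borel_measurable M"
  shows "(\<lambda>x. f x *v g x) \<in> borel_measurable M"
  by (rule borel_measurable_continuous_Pair[OF assms])
    (intro bounded_bilinear.continuous_on[OF bounded_bilinear_matrix_vector_mult] continuous_intros)

lemma diffusion_integrable:
  assumes A: "admissible_diffusion \<Omega> A" and g: "g \<in> L2 \<Omega>" and h: "h \<in> L2 \<Omega>"
  shows "set_integrable lborel \<Omega> (\<lambda>x. (A x *v g x) \<bullet> h x)"
proof -
  let ?A = "\<lambda>x. indicator \<Omega> x *\<^sub>R A x" and ?g = "\<lambda>x. indicator \<Omega> x *\<^sub>R g x" and ?h = "\<lambda>x. indicator \<Omega> x *\<^sub>R h x"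
  have [measurable]: "?A \<in> borel_measurable borel" "?g \<in> borel_measurable borel" "?h \<in> borel_measurable borel"
    using A g h by (auto simp: admissible_diffusion_def set_borel_measurable_def L2_iff)
  obtain C where C: "AE x in lborel. x \<in> \<Omega> \<longrightarrow> norm (A x) \<le> C"
    using A by (auto simp: admissible_diffusion_def)
  obtain K where K: "0 < K" "\<And>(M::real^'a^'a) x. norm (M *v x) \<le> norm M * norm x * K"
    using bounded_bilinear.pos_bounded[OF bounded_bilinear_matrix_vector_mult] by blast
  have "integrable lborel (\<lambda>x. (?A x *v ?g x) \<bullet> ?h x)"
  proof (rule Bochner_Integration.integrable_bound)
    show "integrable lborel (\<lambda>x. \<bar>C\<bar> * K * ((norm (?g x))\<^sup>2 + (norm (?h x))\<^sup>2))"
      using g h by (intro integrable_mult_right Bochner_Integration.integrable_add) (auto simp: L2_iff)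
    show "AE x in lborel. norm ((?A x *v ?g x) \<bullet> ?h x) \<le> norm (\<bar>C\<bar> * K * ((norm (?g x))\<^sup>2 + (norm (?h x))\<^sup>2))"
      using C
    proof (rule eventually_mono)
      fix x assume x: "x \<in> \<Omega> \<longrightarrow> norm (A x) \<le> C"
      \<comment> \<open>The absolute value covers points off \<Omega>, where the truncated matrix is
        0 while C carries no sign.\<close>
      then have Ax: "norm (?A x) \<le> \<bar>C\<bar>"
        by (cases "x \<in> \<Omega>") auto
      have "norm ((?A x *v ?g x) \<bullet> ?h x) \<le> norm (?A x *v ?g x) * norm (?h x)"
        unfolding real_norm_def by (rule Cauchy_Schwarz_ineq2)
      also have "\<dots> \<le> norm (?A x) * norm (?g x) * K * norm (?h x)"
        by (intro mult_right_mono K) auto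
      also have "\<dots> \<le> \<bar>C\<bar> * norm (?g x) * K * norm (?h x)"
        using K(1) Ax by (intro mult_right_mono) auto
      also have "\<dots> = \<bar>C\<bar> * K * (norm (?g x) * norm (?h x))"
        by (simp only: ac_simps)
      also have "\<dots> \<le> \<bar>C\<bar> * K * ((norm (?g x))\<^sup>2 + (norm (?h x))\<^sup>2)"
      proof (rule mult_left_mono)
        show "norm (?g x) * norm (?h x) \<le> (norm (?g x))\<^sup>2 + (norm (?h x))\<^sup>2"
          using sum_squares_bound[of "norm (?g x)" "norm (?h x)"]
            mult_nonneg_nonneg[OF norm_ge_zero[of "?g x"] norm_ge_zero[of "?h x"]] by linarith
      qed (use K(1) in simp)
      finally show "norm ((?A x *v ?g x) \<bullet> ?h x) \<le> norm (\<bar>C\<bar> * K * ((norm (?g x))\<^sup>2 + (norm (?h x))\<^sup>2))"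
        unfolding real_norm_def by (rule order_trans[OF _ abs_ge_self])
    qed
  qed measurable
  moreover have "(\<lambda>x. (?A x *v ?g x) \<bullet> ?h x) = (\<lambda>x. indicator \<Omega> x *\<^sub>R ((A x *v g x) \<bullet> h x))"
    by (intro ext) (auto simp: indicator_def)
  ultimately show ?thesis
    by (simp only: set_integrable_def)
qed

lemma reaction_integrable:
  assumes c: "admissible_reaction \<Omega> c" and u: "u \<in> L2 \<Omega>" and w: "w \<in> L2 \<Omega>"
  shows "set_integrable lborel \<Omega> (\<lambda>x. c x * u x * w x)"
proof -
  obtain C where C: "AE x in lborel. x \<in> \<Omega> \<longrightarrow> \<bar>c x\<bar> \<le> C"
    using c by (auto simp: admissible_reaction_def)
  let ?c = "\<lambda>x. indicator \<Omega> x *\<^sub>R c x" and ?p = "\<lambda>x. indicator \<Omega> x *\<^sub>R (u x * w x)"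
  have i: "integrable lborel ?p"
    using L2_times_integrable[OF u w] by (simp add: set_integrable_def)
  have [measurable]: "?p \<in> borel_measurable lborel" "?c \<in> borel_measurable lborel"
    using i c by (auto simp: admissible_reaction_def set_borel_measurable_def simp del: real_scaleR_def)
  have "integrable lborel (\<lambda>x. ?c x * ?p x)"
  proof (rule Bochner_Integration.integrable_bound)
    show "integrable lborel (\<lambda>x. C * ?p x)" using i by simp
    show "AE x in lborel. norm (?c x * ?p x) \<le> norm (C * ?p x)"
      using C
    proof (rule eventually_mono)
      fix x assume "x \<in> \<Omega> \<longrightarrow> \<bar>c x\<bar> \<le> C"
      then show "norm (?c x * ?p x) \<le> norm (C * ?p x)"
        by (cases "x \<in> \<Omega>") (auto simp: abs_mult mult.assoc intro!: mult_right_mono)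
    qed
  qed measurable
  moreover have "(\<lambda>x. ?c x * ?p x) = (\<lambda>x. indicator \<Omega> x *\<^sub>R (c x * u x * w x))"
    by (intro ext) (auto simp: indicator_def)
  ultimately show ?thesis
    by (simp only: set_integrable_def)
qed

lemma H10_L2:
  assumes "open \<Omega>" "u \<in> H10 \<Omega>"
  shows "u \<in> L2 \<Omega>" "weak_grad \<Omega> u \<in> L2 \<Omega>" "has_weak_gradient \<Omega> u (weak_grad \<Omega> u)"
  using H10_H1[OF assms(2)] by (auto simp: H1_altdef[OF assms(1)])

lemma set_integral_eq_AE:
  fixes f g :: "'a::euclidean_space \<Rightarrow> real"
  assumes "set_integrable lborel D f" "set_integrable lborel D g" "AE x in lborel. x \<in> D \<longrightarrow> f x = g x"
  shows "(LINT x:D|lborel. f x) = (LINT x:D|lborel. g x)"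
  unfolding set_lebesgue_integral_def
  by (intro integral_cong_AE eventually_mono[OF assms(3)])
    (use assms(1,2) in \<open>auto simp: set_integrable_def simp del: real_scaleR_def\<close>)

locale reaction_diffusion =
  fixes \<Omega> :: "(real^'d) set" and A :: "real^'d \<Rightarrow> real^'d^'d" and c :: "real^'d \<Rightarrow> real"
  assumes open_Omega: "open \<Omega>"
    and diffusion: "admissible_diffusion \<Omega> A"
    and reaction: "admissible_reaction \<Omega> c"
begin

lemma a_Omega_integrable:
  assumes "u \<in> H10 \<Omega>" "w \<in> H10 \<Omega>"
  shows "set_integrable lborel \<Omega> (\<lambda>x. (A x *v weak_grad \<Omega> u x) \<bullet> weak_grad \<Omega> w x + c x * u x * w x)"
  using assms
  by (intro set_integral_add diffusion_integrable[OF diffusion] reaction_integrable[OF reaction])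
    (auto intro: H10_L2 open_Omega)

text \<open>\<open>weak_grad\<close> is linear only almost everywhere, so the gradient part is
  compared through \<open>set_integral_eq_AE\<close>, with both integrands integrable.\<close>

lemma a_mu_lincomb_left:
  assumes u: "u \<in> H10 \<Omega>" and w: "w \<in> H10 \<Omega>" and z: "z \<in> H10 \<Omega>"
  shows "a_mu \<Omega> A c m (\<lambda>x. p * u x + q * w x) z = p * a_mu \<Omega> A c m u z + q * a_mu \<Omega> A c m w z"
proof -
  let ?i = "\<lambda>u z x. (A x *v weak_grad \<Omega> u x) \<bullet> weak_grad \<Omega> z x + c x * u x * z x"
  note i = a_Omega_integrable[OF u z] a_Omega_integrable[OF w z]
  have "a_Omega \<Omega> A c (\<lambda>x. p * u x + q * w x) z = (LINT x:\<Omega>|lborel. p * ?i u z x + q * ?i w z x)"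
    unfolding a_Omega_def
  proof (rule set_integral_eq_AE[OF a_Omega_integrable[OF H10_lincomb[OF open_Omega u w] z]])
    show "set_integrable lborel \<Omega> (\<lambda>x. p * ?i u z x + q * ?i w z x)"
      by (rule set_integral_add(1)[OF set_integrable_mult_right set_integrable_mult_right]; rule i)
    show "AE x in lborel. x \<in> \<Omega> \<longrightarrow> ?i (\<lambda>x. p * u x + q * w x) z x = p * ?i u z x + q * ?i w z x"
      using H1_lincomb(2)[OF open_Omega u[THEN H10_H1] w[THEN H10_H1], of p q]
      by (rule eventually_mono)
        (simp add: matrix_vector_right_distrib scaleR_matrix_vector_assoc[symmetric] matrix_vector_mult_scaleR
          inner_add_left algebra_simps)
  qed
  also have "\<dots> = p * a_Omega \<Omega> A c u z + q * a_Omega \<Omega> A c w z"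
    unfolding a_Omega_def using i
    by (subst set_integral_add(2)[OF set_integrable_mult_right set_integrable_mult_right])
      (simp_all only: set_integral_mult_right)
  finally have "a_Omega \<Omega> A c (\<lambda>x. p * u x + q * w x) z = p * a_Omega \<Omega> A c u z + q * a_Omega \<Omega> A c w z" .
  moreover have "L2_inner \<Omega> (\<lambda>x. p * u x + q * w x) z = p * L2_inner \<Omega> u z + q * L2_inner \<Omega> w z"
  proof -
    have j: "set_integrable lborel \<Omega> (\<lambda>x. u x * z x)" "set_integrable lborel \<Omega> (\<lambda>x. w x * z x)"
      using u w z by (auto intro!: L2_times_integrable H10_L2 open_Omega)
    have "L2_inner \<Omega> (\<lambda>x. p * u x + q * w x) z = (LINT x:\<Omega>|lborel. p * (u x * z x) + q * (w x * z x))"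
      unfolding L2_inner_def by (simp add: distrib_right mult.assoc)
    also have "\<dots> = p * L2_inner \<Omega> u z + q * L2_inner \<Omega> w z"
      unfolding L2_inner_def using j
      by (subst set_integral_add(2)[OF set_integrable_mult_right set_integrable_mult_right])
        (simp_all only: set_integral_mult_right)
    finally show ?thesis .
  qed
  ultimately show ?thesis
    by (simp add: a_mu_def algebra_simps)
qed

text \<open>\<open>A x\<close> is symmetric for almost every x, which suffices under the integral.
  Symmetry later carries linearity over to the second argument.\<close>

lemma a_mu_sym:
  assumes u: "u \<in> H10 \<Omega>" and w: "w \<in> H10 \<Omega>"
  shows "a_mu \<Omega> A c m u w = a_mu \<Omega> A c m w u"
proof -
  have sym: "(M *v x) \<bullet> y = (M *v y) \<bullet> x" if "transpose M = M" for M :: "real^'d^'d" and x y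
    using dot_lmul_matrix[of y M x] that
    by (metis inner_commute transpose_matrix_vector)
  have T: "AE x in lborel. x \<in> \<Omega> \<longrightarrow> transpose (A x) = A x"
    using diffusion unfolding admissible_diffusion_def by (elim conjE) (rule eventually_mono, blast+)
  have "a_Omega \<Omega> A c u w = a_Omega \<Omega> A c w u"
    unfolding a_Omega_def
    by (rule set_integral_eq_AE[OF a_Omega_integrable[OF u w] a_Omega_integrable[OF w u]])
      (use T in \<open>rule eventually_mono, simp add: sym mult.assoc mult.commute[of "u _"]\<close>)
  then show ?thesis
    by (simp add: a_mu_def L2_inner_def mult.commute)
qed

text \<open>The integrand is nonnegative almost everywhere for arbitrary \<open>u\<close>. Its
  integral is then nonnegative even if the integrand fails to be integrable, where the default value
  is 0.\<close>

lemma a_Omega_nonneg: "0 \<le> a_Omega \<Omega> A c u u"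
proof -
  obtain a0 where a0: "0 < a0" "AE x in lborel. x \<in> \<Omega> \<longrightarrow> (\<forall>\<xi>. a0 * (norm \<xi>)\<^sup>2 \<le> (A x *v \<xi>) \<bullet> \<xi>)"
    using diffusion by (auto simp: admissible_diffusion_def)
  have c: "AE x in lborel. x \<in> \<Omega> \<longrightarrow> 0 \<le> c x"
    using reaction by (simp add: admissible_reaction_def)
  show ?thesis
    unfolding a_Omega_def set_lebesgue_integral_def
  proof (rule integral_nonneg_AE)
    show "AE x in lborel. 0 \<le> indicat_real \<Omega> x *\<^sub>R ((A x *v weak_grad \<Omega> u x) \<bullet> weak_grad \<Omega> u x + c x * u x * u x)"
      using a0(2) c
    proof eventually_elim
      case (elim x)
      show ?case
      proof (cases "x \<in> \<Omega>")
        case True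
        have "0 \<le> a0 * (norm (weak_grad \<Omega> u x))\<^sup>2" using a0(1) by simp
        also have "\<dots> \<le> (A x *v weak_grad \<Omega> u x) \<bullet> weak_grad \<Omega> u x" using elim True by blast
        finally show ?thesis using elim True by (simp add: mult.assoc)
      qed simp
    qed
  qed
qed

end

section \<open>Weighted integrals in y and the energy of a tensor sum\<close>

lemma set_integrable_powr:
  assumes "-1 < (\<alpha>::real)" "0 \<le> Y"
  shows "set_integrable lborel {0<..Y} (\<lambda>y. y powr \<alpha>)"
proof -
  have "(\<lambda>y. y powr \<alpha>) absolutely_integrable_on {0<..Y}"
    using integrable_on_powr_from_0'[OF assms] by (intro nonnegative_absolutely_integrable_1) auto
  then show ?thesis
    unfolding set_integrable_def by (subst (asm) integrable_completion) auto
qed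

text \<open>Boundedness of \<open>g\<close> and its vanishing beyond Y give a multiple of the weight
  on (0,Y] as majorant, integrable at 0 because \<alpha> > -1. The second claim links the cylinder,
  where y > 0, with the mass and stiffness integrals over \<open>{0..Y}\<close>.\<close>

lemma weighted_integrable:
  assumes \<alpha>: "-1 < (\<alpha>::real)" and Y: "0 < Y"
    and g: "(\<lambda>y. indicator {0<..} y * g y) \<in> borel_measurable borel"
      "\<And>y. 0 < y \<Longrightarrow> \<bar>g y\<bar> \<le> B" "\<And>y. Y < y \<Longrightarrow> g y = 0"
  shows "set_integrable lborel {0<..} (\<lambda>y. y powr \<alpha> * g y)"
    and "(LINT y:{0<..}|lborel. y powr \<alpha> * g y) = (LINT y:{0..Y}|lborel. y powr \<alpha> * g y)"
proof -
  note [measurable] = g(1)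
  have i: "integrable lborel (\<lambda>y. B * (indicator {0<..Y} y * y powr \<alpha>))"
    using set_integrable_powr[OF \<alpha>, of Y] Y by (simp add: set_integrable_def)
  have "integrable lborel (\<lambda>y. y powr \<alpha> * (indicator {0<..} y * g y))"
  proof (rule Bochner_Integration.integrable_bound[OF i])
    show "AE y in lborel. norm (y powr \<alpha> * (indicator {0<..} y * g y)) \<le> norm (B * (indicator {0<..Y} y * y powr \<alpha>))"
    proof (rule AE_I2)
      fix y
      show "norm (y powr \<alpha> * (indicator {0<..} y * g y)) \<le> norm (B * (indicator {0<..Y} y * y powr \<alpha>))"
      proof (cases "0 < y \<and> y \<le> Y")
        case True
        then have "\<bar>g y\<bar> \<le> \<bar>B\<bar>" using g(2)[of y] by linarith
        then show ?thesis
          using True by (simp add: abs_mult mult.commute mult_right_mono)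
      qed (use g(3)[of y] in \<open>auto simp: indicator_def\<close>)
    qed
  qed measurable
  then show "set_integrable lborel {0<..} (\<lambda>y. y powr \<alpha> * g y)"
    by (simp add: set_integrable_def mult.left_commute)
  \<comment> \<open>At y = 0 both sides vanish because \<open>0 powr \<alpha> = 0\<close>.\<close>
  have "indicator {0<..} y * (y powr \<alpha> * g y) = indicator {0..Y} y * (y powr \<alpha> * g y)" for y
    using g(3)[of y] Y by (cases "y = 0") (auto simp: indicator_def)
  then show "(LINT y:{0<..}|lborel. y powr \<alpha> * g y) = (LINT y:{0..Y}|lborel. y powr \<alpha> * g y)"
    unfolding set_lebesgue_integral_def real_scaleR_def by (rule Bochner_Integration.integral_cong[OF refl])
qed

lemma matrix_sum_inner_sum:
  fixes M :: "real^'n^'n"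
  shows "(M *v (\<Sum>i\<in>I. p i *\<^sub>R g i)) \<bullet> (\<Sum>j\<in>J. q j *\<^sub>R h j)
    = (\<Sum>i\<in>I. \<Sum>j\<in>J. ((M *v g i) \<bullet> h j) * (p i * q j))"
proof -
  have "M *v (\<Sum>i\<in>I. p i *\<^sub>R g i) = (\<Sum>i\<in>I. p i *\<^sub>R (M *v g i))"
    by (simp add: linear_sum[OF matrix_vector_mul_linear] matrix_vector_mult_scaleR)
  then have "(M *v (\<Sum>i\<in>I. p i *\<^sub>R g i)) \<bullet> (\<Sum>j\<in>J. q j *\<^sub>R h j)
      = (\<Sum>i\<in>I. (p i *\<^sub>R (M *v g i)) \<bullet> (\<Sum>j\<in>J. q j *\<^sub>R h j))"
    by (simp only: inner_sum_left)
  also have "\<dots> = (\<Sum>i\<in>I. \<Sum>j\<in>J. ((M *v g i) \<bullet> h j) * (p i * q j))"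
    by (simp add: inner_sum_right sum_distrib_left mult_ac)
  finally show ?thesis .
qed

lemma set_integral_sum:
  fixes f :: "'i \<Rightarrow> 'a \<Rightarrow> real"
  assumes "\<And>i. i \<in> I \<Longrightarrow> set_integrable M D (f i)"
  shows "set_integrable M D (\<lambda>x. \<Sum>i\<in>I. f i x)"
    and "(LINT x:D|M. \<Sum>i\<in>I. f i x) = (\<Sum>i\<in>I. LINT x:D|M. f i x)"
  using assms unfolding set_integrable_def set_lebesgue_integral_def scaleR_sum_right
  by (auto intro!: Bochner_Integration.integral_sum)

context reaction_diffusion
begin

lemma cylinder_open: "open (cylinder \<Omega>)"
  using open_Omega by (simp add: cylinder_def open_Times)

text \<open>With the explicit gradient of a tensor sum the integrand is a double sum of terms in
  which x and y separate: \<open>v i * v j\<close> accompanies the diffusion and reaction terms, the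
  product of the derivatives accompanies \<open>W i * Z j\<close>. Fubini then factors every
  term.\<close>

lemma a_C_tensor:
  fixes v :: "'i \<Rightarrow> real \<Rightarrow> real"
  assumes fin: "finite I" and \<alpha>: "-1 < \<alpha>" and mesh: "mesh_1d Y M G" and Y: "0 < Y"
    and v: "\<And>i. i \<in> I \<Longrightarrow> v i \<in> spline_space Y M G r"
    and W: "\<And>i. i \<in> I \<Longrightarrow> W i \<in> H10 \<Omega>" and Z: "\<And>i. i \<in> I \<Longrightarrow> Z i \<in> H10 \<Omega>"
  shows "a_C \<Omega> A c \<alpha> (\<lambda>z. \<Sum>i\<in>I. W i (fst z) * v i (snd z)) (\<lambda>z. \<Sum>i\<in>I. Z i (fst z) * v i (snd z))
    = (\<Sum>i\<in>I. \<Sum>j\<in>I. a_Omega \<Omega> A c (W i) (Z j) * (LINT y:{0..Y}|lborel. y powr \<alpha> * v i y * v j y)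
        + L2_inner \<Omega> (W i) (Z j) * (LINT y:{0..Y}|lborel. y powr \<alpha> * deriv (v i) y * deriv (v j) y))"
proof -
  let ?T = "\<lambda>W z. \<Sum>i\<in>I. W i (fst z) * v i (snd z)"
  let ?G = "\<lambda>W z. \<Sum>i\<in>I. (v i (snd z) *\<^sub>R weak_grad \<Omega> (W i) (fst z), W i (fst z) *\<^sub>R deriv (v i) (snd z))"
  let ?C = "cylinder \<Omega>"
  let ?P = "\<lambda>i j x. (A x *v weak_grad \<Omega> (W i) x) \<bullet> weak_grad \<Omega> (Z j) x + c x * W i x * Z j x"
  let ?Q = "\<lambda>i j x. W i x * Z j x"
  let ?m = "\<lambda>i j y. y powr \<alpha> * (v i y * v j y)"
  let ?k = "\<lambda>i j y. y powr \<alpha> * (deriv (v i) y * deriv (v j) y)"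
  let ?S = "\<lambda>z. \<Sum>i\<in>I. \<Sum>j\<in>I. ?P i j (fst z) * ?m i j (snd z) + ?Q i j (fst z) * ?k i j (snd z)"
  let ?F = "\<lambda>z. snd z powr \<alpha> * ((A (fst z) *v fst (weak_grad ?C (?T W) z)) \<bullet> fst (weak_grad ?C (?T Z) z)
         + snd (weak_grad ?C (?T W) z) * snd (weak_grad ?C (?T Z) z) + c (fst z) * ?T W z * ?T Z z)"
  have hG: "has_weak_gradient ?C (?T W) (?G W)" if "\<And>i. i \<in> I \<Longrightarrow> W i \<in> H10 \<Omega>" for W
    unfolding cylinder_def
    by (intro has_weak_gradient_sum[OF fin] has_weak_gradient_tensor has_weak_gradient_spline[OF v mesh Y]
        H10_L2(3)[OF open_Omega that])
  have hW: "has_weak_gradient ?C (?T W) (?G W)" by (rule hG) (rule W)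
  have hZ: "has_weak_gradient ?C (?T Z) (?G Z)" by (rule hG) (rule Z)
  have im: "set_integrable lborel {0<..} (?m i j)"
      "(LINT y:{0<..}|lborel. ?m i j y) = (LINT y:{0..Y}|lborel. y powr \<alpha> * v i y * v j y)"
    and ik: "set_integrable lborel {0<..} (?k i j)"
      "(LINT y:{0<..}|lborel. ?k i j y) = (LINT y:{0..Y}|lborel. y powr \<alpha> * deriv (v i) y * deriv (v j) y)"
    if ij: "i \<in> I" "j \<in> I" for i j
  proof -
    note [measurable] = spline_borel[OF v[OF ij(1)]] spline_borel[OF v[OF ij(2)]]
      deriv_spline_measurable[OF v[OF ij(1)] mesh Y] deriv_spline_measurable[OF v[OF ij(2)] mesh Y]
    obtain B C where B: "0 \<le> B" "\<And>y. \<bar>v i y\<bar> \<le> B" and C: "0 \<le> C" "\<And>y. \<bar>v j y\<bar> \<le> C"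
      using spline_bounded[OF v[OF ij(1)]] spline_bounded[OF v[OF ij(2)]] by metis
    have m: "(\<lambda>y. indicator {0<..} y * (v i y * v j y)) \<in> borel_measurable borel"
      by measurable
    have b: "\<bar>v i y * v j y\<bar> \<le> B * C" for y
      unfolding abs_mult by (intro mult_mono B C) auto
    have z: "v i y * v j y = 0" if "Y < y" for y
      using v[OF ij(1)] that by (simp add: spline_space_def)
    note w = weighted_integrable[OF \<alpha> Y m b z]
    show "set_integrable lborel {0<..} (?m i j)" by (rule w(1))
    show "(LINT y:{0<..}|lborel. ?m i j y) = (LINT y:{0..Y}|lborel. y powr \<alpha> * v i y * v j y)"
      using w(2) by (simp add: mult.assoc)
    obtain B' where B': "\<And>y. 0 < y \<Longrightarrow> \<bar>deriv (v i) y\<bar> \<le> B'" "0 \<le> B'"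
      using spline_deriv[OF v[OF ij(1)] mesh Y] by metis
    obtain C' where C': "\<And>y. 0 < y \<Longrightarrow> \<bar>deriv (v j) y\<bar> \<le> C'" "0 \<le> C'"
      using spline_deriv[OF v[OF ij(2)] mesh Y] by metis
    \<comment> \<open>Measurability of \<open>deriv (v i)\<close> is available on the positive half
      line, so each factor carries its own indicator before the two are merged.\<close>
    have "(\<lambda>y. (indicator {0<..} y * deriv (v i) y) * (indicator {0<..} y * deriv (v j) y)) \<in> borel_measurable borel"
      by measurable
    also have "(\<lambda>y. (indicator {0<..} y * deriv (v i) y) * (indicator {0<..} y * deriv (v j) y))
        = (\<lambda>y. indicator {0<..} y * (deriv (v i) y * deriv (v j) y))"
      by (intro ext) (simp add: indicator_def)
    finally have m: "(\<lambda>y. indicator {0<..} y * (deriv (v i) y * deriv (v j) y)) \<in> borel_measurable borel" .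
    have b: "\<bar>deriv (v i) y * deriv (v j) y\<bar> \<le> B' * C'" if "0 < y" for y
      unfolding abs_mult using that by (intro mult_mono B' C') auto
    have z: "deriv (v i) y * deriv (v j) y = 0" if "Y < y" for y
      using deriv_spline_beyond(2)[OF v[OF ij(1)] that] by simp
    note w = weighted_integrable[OF \<alpha> Y m b z]
    show "set_integrable lborel {0<..} (?k i j)" by (rule w(1))
    show "(LINT y:{0<..}|lborel. ?k i j y) = (LINT y:{0..Y}|lborel. y powr \<alpha> * deriv (v i) y * deriv (v j) y)"
      using w(2) by (simp add: mult.assoc)
  qed
  have iP: "set_integrable lborel \<Omega> (?P i j)" and iQ: "set_integrable lborel \<Omega> (?Q i j)" if "i \<in> I" "j \<in> I" for i j
    using a_Omega_integrable[OF W[OF that(1)] Z[OF that(2)]]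
      L2_times_integrable[OF H10_L2(1)[OF open_Omega W[OF that(1)]] H10_L2(1)[OF open_Omega Z[OF that(2)]]]
    by simp_all
  have iS: "set_integrable lborel ?C (\<lambda>z. ?P i j (fst z) * ?m i j (snd z) + ?Q i j (fst z) * ?k i j (snd z))"
    and S: "(LINT z:?C|lborel. ?P i j (fst z) * ?m i j (snd z) + ?Q i j (fst z) * ?k i j (snd z))
      = a_Omega \<Omega> A c (W i) (Z j) * (LINT y:{0..Y}|lborel. y powr \<alpha> * v i y * v j y)
        + L2_inner \<Omega> (W i) (Z j) * (LINT y:{0..Y}|lborel. y powr \<alpha> * deriv (v i) y * deriv (v j) y)"
    if ij: "i \<in> I" "j \<in> I" for i j
  proof -
    note 1 = set_integrable_tensor[OF iP[OF ij] im(1)[OF ij]] and 2 = set_integrable_tensor[OF iQ[OF ij] ik(1)[OF ij]]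
    show "set_integrable lborel ?C (\<lambda>z. ?P i j (fst z) * ?m i j (snd z) + ?Q i j (fst z) * ?k i j (snd z))"
      unfolding cylinder_def by (rule set_integral_add(1)[OF 1(1) 2(1)])
    show "(LINT z:?C|lborel. ?P i j (fst z) * ?m i j (snd z) + ?Q i j (fst z) * ?k i j (snd z))
      = a_Omega \<Omega> A c (W i) (Z j) * (LINT y:{0..Y}|lborel. y powr \<alpha> * v i y * v j y)
        + L2_inner \<Omega> (W i) (Z j) * (LINT y:{0..Y}|lborel. y powr \<alpha> * deriv (v i) y * deriv (v j) y)"
      unfolding cylinder_def set_integral_add(2)[OF 1(1) 2(1)] 1(2) 2(2) im(2)[OF ij] ik(2)[OF ij]
        a_Omega_def L2_inner_def ..
  qed
  have pointwise: "snd z powr \<alpha> * ((A (fst z) *v fst (?G W z)) \<bullet> fst (?G Z z)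
         + snd (?G W z) * snd (?G Z z) + c (fst z) * ?T W z * ?T Z z) = ?S z" for z
  proof -
    have 1: "(\<Sum>i\<in>I. W i (fst z) * deriv (v i) (snd z)) * (\<Sum>j\<in>I. Z j (fst z) * deriv (v j) (snd z))
        = (\<Sum>i\<in>I. \<Sum>j\<in>I. (W i (fst z) * deriv (v i) (snd z)) * (Z j (fst z) * deriv (v j) (snd z)))"
      by (rule sum_product)
    have 2: "c (fst z) * ?T W z * ?T Z z
        = (\<Sum>i\<in>I. \<Sum>j\<in>I. c (fst z) * ((W i (fst z) * v i (snd z)) * (Z j (fst z) * v j (snd z))))"
      unfolding mult.assoc[of "c (fst z)"] sum_product by (simp only: sum_distrib_left)
    show ?thesis
      unfolding fst_sum snd_sum fst_conv snd_conv matrix_sum_inner_sum real_scaleR_def 1 2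
      unfolding sum.distrib[symmetric] sum_distrib_left
      by (intro sum.cong refl) (simp add: algebra_simps)
  qed
  have AE: "AE z in lborel. indicator ?C z *\<^sub>R ?F z = indicator ?C z *\<^sub>R ?S z"
    using weak_grad_AE[OF cylinder_open hW] weak_grad_AE[OF cylinder_open hZ]
  proof eventually_elim
    case (elim z)
    show ?case
    proof (cases "z \<in> ?C")
      case True
      have 1: "weak_grad ?C (?T W) z = ?G W z" and 2: "weak_grad ?C (?T Z) z = ?G Z z"
        using elim True by blast+
      show ?thesis unfolding 1 2 pointwise ..
    qed simp
  qed
  \<comment> \<open>Here the integrand still contains the chosen gradients, and \<open>A\<close> and
    \<open>c\<close> are given as measurable on \<Omega> only. Hence every factor is truncated
    separately, which does not change the truncated integrand.\<close>
  have F: "(\<lambda>z. indicator ?C z *\<^sub>R ?F z) \<in> borel_measurable lborel"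
  proof -
    let ?A = "\<lambda>x. indicator \<Omega> x *\<^sub>R A x" and ?c = "\<lambda>x. indicator \<Omega> x *\<^sub>R c x"
    let ?I = "\<lambda>u z. indicator ?C z *\<^sub>R u z"
    have [measurable]: "?A \<in> borel_measurable borel" "?c \<in> borel_measurable borel"
      using diffusion reaction
      by (auto simp: admissible_diffusion_def admissible_reaction_def set_borel_measurable_def)
    have [measurable]: "?I (weak_grad ?C (?T W)) \<in> borel_measurable borel" "?I (weak_grad ?C (?T Z)) \<in> borel_measurable borel"
      using weak_grad_measurable[OF cylinder_open hW] weak_grad_measurable[OF cylinder_open hZ]
      by (auto simp: set_borel_measurable_def)
    have [measurable]: "?I (?T W) \<in> borel_measurable borel" "?I (?T Z) \<in> borel_measurable borel"
      using locally_integrable_measurable[OF cylinder_open, of "?T W"] locally_integrable_measurable[OF cylinder_open, of "?T Z"] hW hZ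
      by (simp_all add: has_weak_gradient_altdef set_borel_measurable_def)
    have [measurable]: "fst \<in> borel_measurable (borel :: ('a::topological_space \<times> 'b::topological_space) measure)"
      "snd \<in> borel_measurable (borel :: ('a::topological_space \<times> 'b::topological_space) measure)" for x
      by (intro borel_measurable_continuous_onI continuous_intros)+
    have "(\<lambda>z. snd z powr \<alpha> * ((?A (fst z) *v fst (?I (weak_grad ?C (?T W)) z)) \<bullet> fst (?I (weak_grad ?C (?T Z)) z)
         + snd (?I (weak_grad ?C (?T W)) z) * snd (?I (weak_grad ?C (?T Z)) z) + ?c (fst z) * ?I (?T W) z * ?I (?T Z) z))
       \<in> borel_measurable borel" (is "?H \<in> _")
      by measurable
    also have "?H = (\<lambda>z. indicator ?C z *\<^sub>R ?F z)"
    proof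
      fix z show "?H z = indicator ?C z *\<^sub>R ?F z"
        by (cases "z \<in> ?C") (auto simp: cylinder_def)
    qed
    finally show ?thesis by simp
  qed
  have iSS: "set_integrable lborel ?C ?S"
    by (intro set_integral_sum iS)
  have "a_C \<Omega> A c \<alpha> (?T W) (?T Z) = (LINT z:?C|lborel. ?S z)"
    unfolding a_C_def set_lebesgue_integral_def
    by (rule integral_cong_AE[OF F _ AE]) (use iSS in \<open>simp only: set_integrable_def borel_measurable_integrable\<close>)
  also have "\<dots> = (\<Sum>i\<in>I. \<Sum>j\<in>I. (LINT z:?C|lborel. ?P i j (fst z) * ?m i j (snd z) + ?Q i j (fst z) * ?k i j (snd z)))"
    by (simp only: set_integral_sum(2)[OF set_integral_sum(1)[OF iS]] set_integral_sum(2)[OF iS]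
        cong: sum.cong)
  also have "\<dots> = (\<Sum>i\<in>I. \<Sum>j\<in>I. a_Omega \<Omega> A c (W i) (Z j) * (LINT y:{0..Y}|lborel. y powr \<alpha> * v i y * v j y)
        + L2_inner \<Omega> (W i) (Z j) * (LINT y:{0..Y}|lborel. y powr \<alpha> * deriv (v i) y * deriv (v j) y))"
    by (intro sum.cong refl S)
  finally show ?thesis .
qed

end

section \<open>Discrete spaces and the Galerkin solution\<close>

lemma sum_fun_scale_apply: "(\<Sum>i\<in>I. fun_scale (a i) (f i)) x = (\<Sum>i\<in>I. a i * f i x)"
  by (induction I rule: infinite_finite_induct) (auto simp: fun_scale_def)

lemma basis_family_coords:
  assumes "basis_family N v S" "u \<in> S"
  obtains a where "\<And>y. u y = (\<Sum>i = 1..N. a i * v i y)"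
proof -
  have inj: "inj_on v {1..N}" and u: "u \<in> fun_vs.span (v ` {1..N})"
    using assms by (auto simp: basis_family_def)
  from u obtain b where b: "u = (\<Sum>w\<in>v ` {1..N}. fun_scale (b w) w)"
    by (auto simp: fun_vs.span_finite)
  then have "u y = (\<Sum>i = 1..N. b (v i) * v i y)" for y
    unfolding b sum_fun_scale_apply by (simp only: sum.reindex[OF inj] o_def)
  then show thesis by (rule that)
qed

lemma basis_family_mem:
  assumes "basis_family N v S" "i \<in> {1..N}"
  shows "v i \<in> S"
  using assms fun_vs.span_base[of "v i" "v ` {1..N}"] by (auto simp: basis_family_def)

text \<open>Sums with coefficient functions in \<open>X\<close> form a subspace. It contains every
  product, since the coordinates of the second factor can be moved into the first, which stays in
  \<open>X\<close>; hence it contains the span.\<close>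

lemma tensor_space_coords:
  assumes X: "fun_vs.subspace X" and v: "basis_family N v S" and w: "w \<in> tensor_space X S"
  shows "\<exists>W. (\<forall>i. W i \<in> X) \<and> w = (\<lambda>z. \<Sum>i = 1..N. W i (fst z) * v i (snd z))"
proof -
  define R where "R = {w. \<exists>W. (\<forall>i. W i \<in> X) \<and> w = (\<lambda>z. \<Sum>i = 1..N. W i (fst z) * v i (snd z))}"
  have "fun_vs.subspace R"
    unfolding fun_vs.subspace_def
  proof (intro conjI ballI allI)
    show "0 \<in> R"
      using fun_vs.subspace_0[OF X] by (auto simp: R_def fun_eq_iff intro!: exI[of _ "\<lambda>_. 0"])
    fix w1 w2 assume "w1 \<in> R" "w2 \<in> R"
    then obtain W1 W2 where W: "\<And>i. W1 i \<in> X" "w1 = (\<lambda>z. \<Sum>i = 1..N. W1 i (fst z) * v i (snd z))"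
      "\<And>i. W2 i \<in> X" "w2 = (\<lambda>z. \<Sum>i = 1..N. W2 i (fst z) * v i (snd z))"
      by (auto simp: R_def)
    have "W1 i + W2 i \<in> X" for i using W fun_vs.subspace_add[OF X] by blast
    then show "w1 + w2 \<in> R"
      unfolding R_def W(2,4)
      by (auto simp: fun_eq_iff sum.distrib distrib_right intro!: exI[of _ "\<lambda>i. W1 i + W2 i"])
  next
    fix a w1 assume "w1 \<in> R"
    then obtain W1 where W: "\<And>i. W1 i \<in> X" "w1 = (\<lambda>z. \<Sum>i = 1..N. W1 i (fst z) * v i (snd z))"
      by (auto simp: R_def)
    have "fun_scale a (W1 i) \<in> X" for i using W fun_vs.subspace_scale[OF X] by blast
    then show "fun_scale a w1 \<in> R"
      unfolding R_def W(2)
      by (auto simp: fun_eq_iff fun_scale_def sum_distrib_left mult.assoc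
          intro!: exI[of _ "\<lambda>i. fun_scale a (W1 i)"])
  qed
  moreover have "(\<lambda>z. p (fst z) * u (snd z)) \<in> R" if p: "p \<in> X" and u: "u \<in> S" for p u
  proof -
    obtain a where a: "\<And>y. u y = (\<Sum>i = 1..N. a i * v i y)"
      using basis_family_coords[OF v u] by metis
    have "fun_scale (a i) p \<in> X" for i using p fun_vs.subspace_scale[OF X] by blast
    then show ?thesis
      unfolding R_def a
      by (auto simp: fun_eq_iff fun_scale_def sum_distrib_left mult_ac
          intro!: exI[of _ "\<lambda>i. fun_scale (a i) p"])
  qed
  ultimately have "tensor_space X S \<subseteq> R"
    unfolding tensor_space_def by (intro fun_vs.span_minimal) auto
  then show ?thesis
    using w unfolding R_def by blast
qed

section \<open>Finite element functions\<close>

lemma polynomial_fun_lincomb: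
  assumes "polynomial_fun q f" "polynomial_fun q g"
  shows "polynomial_fun q (\<lambda>x. a * f x + b * g x)"
proof -
  obtain k l where "\<forall>x. f x = (\<Sum>\<beta> | (\<Sum>i\<in>UNIV. \<beta> i) \<le> q. k \<beta> * (\<Prod>i\<in>UNIV. (x $ i) ^ \<beta> i))"
    "\<forall>x. g x = (\<Sum>\<beta> | (\<Sum>i\<in>UNIV. \<beta> i) \<le> q. l \<beta> * (\<Prod>i\<in>UNIV. (x $ i) ^ \<beta> i))"
    using assms unfolding polynomial_fun_def by blast
  then show ?thesis
    unfolding polynomial_fun_def
    by (intro exI[of _ "\<lambda>\<beta>. a * k \<beta> + b * l \<beta>"])
      (simp add: sum_distrib_left distrib_right sum.distrib mult.assoc)
qed

lemma fe_space_lincomb: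
  assumes u: "u \<in> fe_space \<Omega> \<T> q" and w: "w \<in> fe_space \<Omega> \<T> q"
  shows "(\<lambda>x. a * u x + b * w x) \<in> fe_space \<Omega> \<T> q"
proof -
  have "\<exists>p. polynomial_fun q p \<and> (\<forall>x\<in>K. a * u x + b * w x = p x)" if "K \<in> \<T>" for K
  proof -
    have "\<exists>f. polynomial_fun q f \<and> (\<forall>x\<in>K. u x = f x)" "\<exists>g. polynomial_fun q g \<and> (\<forall>x\<in>K. w x = g x)"
      using u w that by (simp_all add: fe_space_def)
    then obtain f g where "polynomial_fun q f" "\<forall>x\<in>K. u x = f x" "polynomial_fun q g" "\<forall>x\<in>K. w x = g x"
      by blast
    then show ?thesis
      by (intro exI[of _ "\<lambda>x. a * f x + b * g x"]) (simp add: polynomial_fun_lincomb)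
  qed
  then show ?thesis
    using u w by (auto simp: fe_space_def intro!: continuous_intros)
qed

lemma fe_space_zero: "(\<lambda>_. 0) \<in> fe_space \<Omega> \<T> q"
  by (auto simp: fe_space_def polynomial_fun_def intro!: exI[of _ "\<lambda>_. 0"])

lemma fe_space_subspace: "fun_vs.subspace (fe_space \<Omega> \<T> q)"
  unfolding fun_vs.subspace_def
proof (intro conjI ballI allI)
  show "0 \<in> fe_space \<Omega> \<T> q" using fe_space_zero by (simp add: zero_fun_def)
  show "u + w \<in> fe_space \<Omega> \<T> q" if "u \<in> fe_space \<Omega> \<T> q" "w \<in> fe_space \<Omega> \<T> q" for u w
    using fe_space_lincomb[OF that, of 1 1] by (simp add: plus_fun_def)
  show "fun_scale c u \<in> fe_space \<Omega> \<T> q" if "u \<in> fe_space \<Omega> \<T> q" for c u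
    using fe_space_lincomb[OF that that, of c 0] by (simp add: fun_scale_def)
qed

text \<open>The part of \<open>D\<close> where \<open>u\<close> is nonzero is open and, by the
  vanishing norm, null; a nonempty open set is never null.\<close>

lemma continuous_zero_of_L2_zero:
  assumes D: "open D" and u: "continuous_on D u" "u \<in> L2 D" and z: "L2_inner D u u \<le> 0" and x: "x \<in> D"
  shows "u x = 0"
proof (rule ccontr)
  assume "u x \<noteq> 0"
  have "AE x in lborel. x \<in> D \<longrightarrow> u x * u x = 0"
    using L2_times_integrable[OF u(2) u(2)] z by (intro set_integral_zero_AE) (auto simp: L2_inner_def)
  then have "AE x in lborel. x \<notin> D \<inter> u -` (- {0})"
    by (rule eventually_mono) auto
  moreover have o: "open (D \<inter> u -` (- {0}))"
    using u(1) D by (intro continuous_open_preimage) auto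
  ultimately have "emeasure lborel (D \<inter> u -` (- {0})) = 0"
    by (simp add: AE_iff_null_sets null_setsD1)
  then have "negligible (D \<inter> u -` (- {0}))"
    using o by (simp add: negligible_iff_null_sets null_sets_def)
  then show False
    using o x \<open>u x \<noteq> 0\<close> open_not_negligible by blast
qed

context reaction_diffusion
begin

lemma a_mu_diff_left:
  assumes "u \<in> H10 \<Omega>" "w \<in> H10 \<Omega>" "z \<in> H10 \<Omega>"
  shows "a_mu \<Omega> A c m (\<lambda>x. u x - w x) z = a_mu \<Omega> A c m u z - a_mu \<Omega> A c m w z"
  using a_mu_lincomb_left[OF assms, of m 1 "-1"] by simp

lemma H10_diff: "u \<in> H10 \<Omega> \<Longrightarrow> w \<in> H10 \<Omega> \<Longrightarrow> (\<lambda>x. u x - w x) \<in> H10 \<Omega>"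
  using H10_lincomb[OF open_Omega, of u w 1 "-1"] by simp

lemma a_mu_scale_right:
  assumes "u \<in> H10 \<Omega>" "w \<in> H10 \<Omega>"
  shows "a_mu \<Omega> A c m u (\<lambda>x. p * w x) = p * a_mu \<Omega> A c m u w"
proof -
  have "(\<lambda>x. p * w x) \<in> H10 \<Omega>"
    using H10_lincomb[OF open_Omega assms(2,2), of p 0] by simp
  then show ?thesis
    using a_mu_lincomb_left[OF assms(2,2,1), of m p 0] assms by (simp add: a_mu_sym)
qed

text \<open>By the symmetry of the form, \<open>u = w\<close> almost everywhere need not be shown.\<close>

lemma a_mu_diff_cong:
  assumes u: "u \<in> H10 \<Omega>" and w: "w \<in> H10 \<Omega>" and p: "p \<in> H10 \<Omega>"
    and eq: "\<And>z. z \<in> H10 \<Omega> \<Longrightarrow> a_mu \<Omega> A c m w z = a_mu \<Omega> A c m u z"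
  shows "a_mu \<Omega> A c m (\<lambda>x. w x - p x) (\<lambda>x. w x - p x) = a_mu \<Omega> A c m (\<lambda>x. u x - p x) (\<lambda>x. u x - p x)"
proof -
  have d: "a_mu \<Omega> A c m (\<lambda>x. w x - p x) z = a_mu \<Omega> A c m (\<lambda>x. u x - p x) z" if "z \<in> H10 \<Omega>" for z
    using that by (simp add: a_mu_diff_left u w p eq)
  then show ?thesis
    using H10_diff[OF w p] H10_diff[OF u p] by (metis a_mu_sym)
qed

text \<open>The summand \<open>m * a_Omega\<close> is nonnegative, so the L2 part cannot be positive
  when the sum is 0. The argument covers m = 0 as well.\<close>

lemma a_mu_zero_imp_L2_inner_le:
  assumes "0 \<le> m" "a_mu \<Omega> A c m e e = 0"
  shows "L2_inner \<Omega> e e \<le> 0"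
  using mult_nonneg_nonneg[OF assms(1) a_Omega_nonneg[of e]] assms(2) by (simp add: a_mu_def)

end

theorem lemma6p1:
  fixes \<Omega> :: "(real^'d) set"
    and A :: "real^'d \<Rightarrow> real^'d^'d"
    and c :: "real^'d \<Rightarrow> real"
    and lam :: "nat \<Rightarrow> real"
    and \<phi> :: "nat \<Rightarrow> real^'d \<Rightarrow> real"
    and s \<alpha> Y :: real
    and f :: "nat \<Rightarrow> real"
    and M q N :: nat
    and G :: "nat \<Rightarrow> real"
    and r :: "nat \<Rightarrow> nat"
    and \<T> :: "(real^'d) set set"
    and \<mu> :: "nat \<Rightarrow> real"
    and v :: "nat \<Rightarrow> real \<Rightarrow> real"
    and U :: "nat \<Rightarrow> real^'d \<Rightarrow> real"
    and P :: "nat \<Rightarrow> (real^'d \<Rightarrow> real) \<Rightarrow> (real^'d \<Rightarrow> real)"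
    and \<U> \<U>\<^sub>M \<U>\<^sub>h\<^sub>M :: "(real^'d) \<times> real \<Rightarrow> real"
  assumes dim: "CARD('d) = 1 \<or> CARD('d) = 2"
    and domain: "bounded_lipschitz_domain \<Omega>"
    and diffusion: "admissible_diffusion \<Omega> A"
    and reaction: "admissible_reaction \<Omega> c"
    and eigen: "eigensystem \<Omega> A c lam \<phi>"
    and s: "0 < s" "s < 1"
    and alpha: "\<alpha> = 1 - 2 * s"
    and f: "f \<in> spectral_space lam (- s)"
    and Y: "0 < Y"
    and mesh_y: "mesh_1d Y M G"
    and mesh_x: "simplicial_mesh \<Omega> \<T>"
    and fe_conforming: "fe_space \<Omega> \<T> q \<subseteq> H10 \<Omega>"
    and N: "N = fun_vs.dim (spline_space Y M G r)"
    and basis: "basis_family N v (spline_space Y M G r)"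
    and stiffness: "\<And>i j. i \<in> {1..N} \<Longrightarrow> j \<in> {1..N} \<Longrightarrow>
          (LINT y:{0..Y}|lborel. y powr \<alpha> * deriv (v i) y * deriv (v j) y)
            = (if i = j then 1 else 0)"
    and mass: "\<And>i j. i \<in> {1..N} \<Longrightarrow> j \<in> {1..N} \<Longrightarrow>
          (LINT y:{0..Y}|lborel. y powr \<alpha> * v i y * v j y) = (if i = j then \<mu> i else 0)"
    and U_space: "\<And>i. i \<in> {1..N} \<Longrightarrow> U i \<in> H10 \<Omega>"
    and U_eq: "\<And>i V. i \<in> {1..N} \<Longrightarrow> V \<in> H10 \<Omega> \<Longrightarrow>
          a_mu \<Omega> A c (\<mu> i) (U i) V = d_const s * v i 0 * dual_pairing \<Omega> \<phi> f V"
    and ritz: "\<And>i. i \<in> {1..N} \<Longrightarrow> ritz_projector \<Omega> A c (\<mu> i) (fe_space \<Omega> \<T> q) (P i)"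
    and exact: "extension_solution \<Omega> A c \<phi> s f (HL_space \<Omega> \<alpha>) \<U>"
    and semidiscrete: "extension_solution \<Omega> A c \<phi> s f
          (tensor_space (H10 \<Omega>) (spline_space Y M G r)) \<U>\<^sub>M"
    and galerkin: "extension_solution \<Omega> A c \<phi> s f
          (tensor_space (fe_space \<Omega> \<T> q) (spline_space Y M G r)) \<U>\<^sub>h\<^sub>M"
  shows "(\<forall>x y. \<U>\<^sub>h\<^sub>M (x, y) = (\<Sum>i = 1..N. P i (U i) x * v i y)) \<and>
         a_C \<Omega> A c \<alpha> (\<lambda>z. \<U>\<^sub>M z - \<U>\<^sub>h\<^sub>M z) (\<lambda>z. \<U>\<^sub>M z - \<U>\<^sub>h\<^sub>M z)
           = (\<Sum>i = 1..N. mu_norm_sq \<Omega> A c (\<mu> i) (\<lambda>x. U i x - P i (U i) x))"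
proof -
  have op: "open \<Omega>" using domain by (simp add: bounded_lipschitz_domain_def)
  interpret reaction_diffusion \<Omega> A c
    by unfold_locales (fact op diffusion reaction)+
  let ?S = "spline_space Y M G r" and ?X = "fe_space \<Omega> \<T> q" and ?T = "\<lambda>W z. \<Sum>i = 1..N. W i (fst z) * v i (snd z)"
  let ?a = "\<lambda>i. a_mu \<Omega> A c (\<mu> i)"
  have v: "v i \<in> ?S" if "i \<in> {1..N}" for i
    by (rule basis_family_mem[OF basis that])
  have \<alpha>: "-1 < \<alpha>" using s alpha by simp
  have \<phi>: "\<phi> k \<in> L2 \<Omega>" for k
    using eigen H10_L2(1)[OF op] by (simp add: eigensystem_def)

  have a_C_diag: "a_C \<Omega> A c \<alpha> (?T W) (?T Z) = (\<Sum>i = 1..N. ?a i (W i) (Z i))"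
    if "\<And>i. W i \<in> H10 \<Omega>" "\<And>i. Z i \<in> H10 \<Omega>" for W Z
  proof -
    have "a_C \<Omega> A c \<alpha> (?T W) (?T Z)
      = (\<Sum>i = 1..N. \<Sum>j = 1..N. a_Omega \<Omega> A c (W i) (Z j) * (LINT y:{0..Y}|lborel. y powr \<alpha> * v i y * v j y)
        + L2_inner \<Omega> (W i) (Z j) * (LINT y:{0..Y}|lborel. y powr \<alpha> * deriv (v i) y * deriv (v j) y))"
      by (rule a_C_tensor[OF _ \<alpha> mesh_y Y v that]) auto
    \<comment> \<open>Off the diagonal both integrals are 0; on it they are \<open>\<mu> i\<close>
      and 1, the two coefficients of \<open>a_mu\<close>.\<close>
    also have "\<dots> = (\<Sum>i = 1..N. \<Sum>j = 1..N. if i = j then ?a i (W i) (Z j) else 0)"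
      by (intro sum.cong refl) (simp add: mass stiffness a_mu_def)
    also have "\<dots> = (\<Sum>i = 1..N. ?a i (W i) (Z i))"
      by (intro sum.cong refl) simp
    finally show ?thesis .
  qed

  text \<open>If \<open>v j 0 \<noteq> 0\<close>, homogeneity of the pairing is read off the equation of \<open>U j\<close>, so that the
    convergence of its series is never needed.\<close>
  have load: "d_const s * dual_pairing \<Omega> \<phi> f (tr \<Omega> (\<lambda>z. V (fst z) * v j (snd z))) = ?a j (U j) V"
    if j: "j \<in> {1..N}" and V: "V \<in> H10 \<Omega>" for j V
  proof -
    obtain B where B: "\<And>y. \<bar>v j y\<bar> \<le> B" using spline_bounded[OF v[OF j]] by metis
    have tr: "dual_pairing \<Omega> \<phi> f (tr \<Omega> (\<lambda>z. V (fst z) * v j (snd z))) = dual_pairing \<Omega> \<phi> f (\<lambda>x. v j 0 * V x)"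
      by (rule dual_pairing_tr_tensor[OF op H10_L2(1)[OF op V] spline_borel[OF v[OF j]] B
            spline_continuous_on_Ici[OF v[OF j] Y] \<phi>])
    show ?thesis
    proof (cases "v j 0 = 0")
      \<comment> \<open>Then \<open>v j 0 * V\<close> is the zero function, and both its pairing and
        the right-hand side of \<open>U_eq\<close> are 0.\<close>
      case True
      then show ?thesis
        using U_eq[OF j V] unfolding tr by (simp add: dual_pairing_def L2_inner_def)
    next
      case False
      have "(\<lambda>x. v j 0 * V x) \<in> H10 \<Omega>"
        using H10_lincomb[OF op V V, of "v j 0" 0] by simp
      from U_eq[OF j this] show ?thesis
        unfolding tr a_mu_scale_right[OF U_space[OF j] V] using False by simp
    qed
  qed

  \<comment> \<open>The set \<open>X\<close> is kept general because the statement is used twice: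
    with \<open>H10 \<Omega>\<close> for the semidiscrete solution and with the finite element space
    for the Galerkin solution.\<close>
  have component: "?a j (W j) V = ?a j (U j) V"
    if sol: "extension_solution \<Omega> A c \<phi> s f (tensor_space X ?S) (?T W)" and X: "X \<subseteq> H10 \<Omega>"
      and W: "\<And>i. W i \<in> X" and V: "V \<in> X" and j: "j \<in> {1..N}" for X W V j
  proof -
    \<comment> \<open>\<open>?Z\<close> rewrites the single product as a sum over the whole basis,
      so that the diagonal formula isolates the j-th term.\<close>
    let ?\<psi> = "\<lambda>z. V (fst z) * v j (snd z)" and ?Z = "\<lambda>i. if i = j then V else (\<lambda>_. 0)"
    have "?\<psi> \<in> tensor_space X ?S"
      unfolding tensor_space_def using V v[OF j] by (intro fun_vs.span_base) blast
    then have "a_C \<Omega> A c \<alpha> (?T W) ?\<psi> = d_const s * dual_pairing \<Omega> \<phi> f (tr \<Omega> ?\<psi>)"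
      using sol by (simp add: extension_solution_def alpha)
    also have "\<dots> = ?a j (U j) V"
      by (rule load[OF j]) (use V X in blast)
    also have "?\<psi> = ?T ?Z"
      using j by (intro ext) (simp add: if_distrib[of "\<lambda>f. f _"] if_distrib[of "\<lambda>x. x * _"] cong: if_cong)
    also have "a_C \<Omega> A c \<alpha> (?T W) (?T ?Z) = (\<Sum>i = 1..N. ?a i (W i) (?Z i))"
      by (rule a_C_diag) (use W V X H10_zero[OF op] in auto)
    also have "\<dots> = (\<Sum>i = 1..N. if i = j then ?a j (W j) V else 0)"
    proof (intro sum.cong refl)
      fix i
      \<comment> \<open>The zero function is treated as 0 times \<open>V\<close>, because its chosen
        weak gradient may be nonzero on a null set.\<close>
      have "?a i (W i) (\<lambda>_. 0) = 0"
        using a_mu_scale_right[of "W i" V "\<mu> i" 0] W V X by auto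
      then show "?a i (W i) (?Z i) = (if i = j then ?a j (W j) V else 0)" by simp
    qed
    also have "\<dots> = ?a j (W j) V" using j by simp
    finally show ?thesis .
  qed

  have mu_nonneg: "0 \<le> \<mu> i" if i: "i \<in> {1..N}" for i
  proof -
    \<comment> \<open>The diagonal mass entry is a weighted integral of a square.\<close>
    have "0 \<le> (LINT y:{0..Y}|lborel. y powr \<alpha> * v i y * v i y)"
      unfolding set_lebesgue_integral_def by (rule integral_nonneg_AE) (simp add: mult.assoc)
    then show ?thesis using mass[OF i i] by simp
  qed

  have "\<U>\<^sub>M \<in> tensor_space (H10 \<Omega>) ?S"
    using semidiscrete by (simp add: extension_solution_def)
  from tensor_space_coords[OF H10_subspace[OF op] basis this]
  obtain W where "(\<forall>i. W i \<in> H10 \<Omega>) \<and> \<U>\<^sub>M = ?T W" ..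
  then have W: "\<And>i. W i \<in> H10 \<Omega>" "\<U>\<^sub>M = ?T W"
    by blast+
  have "\<U>\<^sub>h\<^sub>M \<in> tensor_space ?X ?S"
    using galerkin by (simp add: extension_solution_def)
  from tensor_space_coords[OF fe_space_subspace basis this]
  obtain V where "(\<forall>i. V i \<in> ?X) \<and> \<U>\<^sub>h\<^sub>M = ?T V" ..
  then have V: "\<And>i. V i \<in> ?X" "\<U>\<^sub>h\<^sub>M = ?T V"
    by blast+

  have VP: "V i = P i (U i)" if i: "i \<in> {1..N}" for i
  proof -
    have PX: "P i (U i) \<in> ?X" and P0: "\<And>w. w \<in> ?X \<Longrightarrow> ?a i (\<lambda>x. U i x - P i (U i) x) w = 0"
      using ritz[OF i] U_space[OF i] by (auto simp: ritz_projector_def)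
    let ?e = "\<lambda>x. V i x - P i (U i) x"
    have e: "?e \<in> ?X" using fe_space_lincomb[OF V(1)[of i] PX, of 1 "-1"] by simp
    have H: "V i \<in> H10 \<Omega>" "P i (U i) \<in> H10 \<Omega>" "?e \<in> H10 \<Omega>" "U i \<in> H10 \<Omega>"
      using V(1)[of i] PX e U_space[OF i] fe_conforming by auto
    \<comment> \<open>By the Galerkin equation and by Ritz orthogonality, \<open>V i\<close> and
      \<open>P i (U i)\<close> both act like \<open>U i\<close> when tested on \<open>?X\<close>.
      Their difference lies in \<open>?X\<close> and is therefore orthogonal to itself.\<close>
    have "?a i (V i) ?e = ?a i (U i) ?e"
      by (rule component[OF galerkin[unfolded V(2)] fe_conforming V(1) e i])
    then have "?a i ?e ?e = 0"
      using P0[OF e] H by (simp add: a_mu_diff_left)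
    then have L: "L2_inner \<Omega> ?e ?e \<le> 0"
      by (rule a_mu_zero_imp_L2_inner_le[OF mu_nonneg[OF i]])
    \<comment> \<open>Equality is required at every x: on \<Omega> it follows from continuity and
      the zero L2 norm, elsewhere from the extension by zero built into \<open>?X\<close>.\<close>
    show ?thesis
    proof
      fix x
      show "V i x = P i (U i) x"
      proof (cases "x \<in> \<Omega>")
        case True
        have "continuous_on (closure \<Omega>) ?e"
          using e by (simp add: fe_space_def)
        then have "continuous_on \<Omega> ?e"
          by (rule continuous_on_subset[OF _ closure_subset])
        from continuous_zero_of_L2_zero[OF op this H10_L2(1)[OF op H(3)] L True]
        show ?thesis by simp
      next
        case False
        then show ?thesis using V(1)[of i] PX by (simp add: fe_space_def)
      qed
    qed
  qed

  have "a_C \<Omega> A c \<alpha> (\<lambda>z. \<U>\<^sub>M z - \<U>\<^sub>h\<^sub>M z) (\<lambda>z. \<U>\<^sub>M z - \<U>\<^sub>h\<^sub>M z)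
      = (\<Sum>i = 1..N. ?a i (\<lambda>x. W i x - V i x) (\<lambda>x. W i x - V i x))"
  proof -
    \<comment> \<open>Both solutions are expanded in the same basis, so the error is again a tensor
      sum with components in \<open>H10 \<Omega>\<close>.\<close>
    have "(\<lambda>z. \<U>\<^sub>M z - \<U>\<^sub>h\<^sub>M z) = ?T (\<lambda>i x. W i x - V i x)"
      by (simp add: W(2) V(2) left_diff_distrib sum_subtractf)
    then show ?thesis
      using a_C_diag[of "\<lambda>i x. W i x - V i x" "\<lambda>i x. W i x - V i x"] H10_diff W(1) V(1) fe_conforming
      by (simp add: subset_iff)
  qed
  also have "\<dots> = (\<Sum>i = 1..N. mu_norm_sq \<Omega> A c (\<mu> i) (\<lambda>x. U i x - P i (U i) x))"
  proof (intro sum.cong refl)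
    fix i assume i: "i \<in> {1..N}"
    \<comment> \<open>\<open>W i\<close> and \<open>U i\<close> satisfy the same equation on
      \<open>H10 \<Omega>\<close>, so their distances to \<open>V i\<close> have equal energy
      although the two representatives may differ on a null set.\<close>
    have "?a i (\<lambda>x. W i x - V i x) (\<lambda>x. W i x - V i x) = ?a i (\<lambda>x. U i x - V i x) (\<lambda>x. U i x - V i x)"
    proof (rule a_mu_diff_cong[OF U_space[OF i] W(1)])
      show "V i \<in> H10 \<Omega>" using V(1) fe_conforming by blast
      show "?a i (W i) z = ?a i (U i) z" if "z \<in> H10 \<Omega>" for z
        by (rule component[OF semidiscrete[unfolded W(2)] subset_refl W(1) that i])
    qed
    then show "?a i (\<lambda>x. W i x - V i x) (\<lambda>x. W i x - V i x) = mu_norm_sq \<Omega> A c (\<mu> i) (\<lambda>x. U i x - P i (U i) x)"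
      by (simp add: mu_norm_sq_def VP[OF i])
  qed
  finally show ?thesis
    by (simp add: V(2) VP)
qed

end
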